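(* Let $\Omega$ be a bounded open set in $\mathbb{H}^n$. Let $u,v$ be continuous functions on $\bar\Omega$ which are quaternionic plurisubharmonic in $\Omega$. Assume that $$\det\left(\frac{\partial^2 u}{\partial\bar q_i\partial q_j}\right)\le\det\left(\frac{\partial^2 v}{\partial\bar q_i\partial q_j}\right)\quad\text{in }\Omega$$ (as an inequality of measures). Then $$\min\{u(z)-v(z)\mid z\in\bar\Omega\}=\min\{u(z)-v(z)\mid z\in\partial\Omega\}.$$
   Context: $\mathbb{H}$ is the skew field of quaternions, $q=t+ix+jy+kz$; $\mathbb{H}^n$ is a right $\mathbb{H}$-vector space with coordinates $q_m=t_m+ix_m+jy_m+kz_m$. Set $$\frac{\partial f}{\partial\bar q_m}=\frac{\partial f}{\partial t_m}+i\frac{\partial f}{\partial x_m}+j\frac{\partial f}{\partial y_m}+k\frac{\partial f}{\partial z_m},\qquad \frac{\partial f}{\partial q_m}=\overline{\frac{\partial\bar f}{\partial\bar q_m}}=\frac{\partial f}{\partial t_m}-\frac{\partial f}{\partial x_m}i-\frac{\partial f}{\partial y_m}j-\frac{\partial f}{\partial z_m}k .$$ For real valued $f\in C^2$ the matrix $\left(\frac{\partial^2 f}{\partial\bar q_i\partial q_j}\right)$ is hyperhermitian (equal to its conjugate transpose). Moore determinant: for a hyperhermitian $n\times n$ matrix $A=(a_{ij})$ let ${}^{\mathbb R}A$ be the real $4n\times 4n$ matrix of the symmetric bilinear form $(x,y)\mapsto \mathrm{Re}\sum_{i,j}\bar x_i a_{ij}y_j$ on $\mathbb{H}^n\cong\mathbb{R}^{4n}$.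 There is a unique polynomial $P$ on the real vector space of hyperhermitian $n\times n$ matrices with $\det({}^{\mathbb R}A)=P(A)^4$ for all $A$ and $P(\mathrm{Id})=1$; the Moore determinant is $\det A:=P(A)\in\mathbb{R}$. A real valued function $f$ on an open subset of $\mathbb{R}^m$ is subharmonic if it is upper semi-continuous and for every point $x_0$ and all sufficiently small $r>0$ one has $f(x_0)\le\int_{S(x_0,r)}f\,d\sigma$, where $\sigma$ is the normalized Lebesgue measure on the sphere $S(x_0,r)$. A function $f:\Omega\to\mathbb{R}$ is quaternionic plurisubharmonic if it is upper semi-continuous and its restriction to (the intersection of $\Omega$ with) any affine right quaternionic line $\{a+v\lambda:\lambda\in\mathbb{H}\}$, $v\ne0$, is subharmonic. For a continuous quaternionic plurisubharmonic $f$ on $\Omega$, the measure $\det\left(\frac{\partial^2 f}{\partial\bar q_i\partial q_j}\right)$ is the non-negative measure defined as the weak limit of the measures with densities $\det\left(\frac{\partial^2 g_N}{\partial\bar q_i\partial q_j}\right)$ (Moore determinant) with respect to Lebesgue measure, where $g_N$ are $C^2$ quaternionic plurisubharmonic functions converging to $f$ uniformly on compact subsets (locally, e.g. on relatively compact subdomains, such $g_N$ are obtained by convolution with smooth non-negative radial kernels); the limit exists and does not depend on the choice of $\{g_N\}$. Weak convergence means convergence of integrals against continuous compactly supported functions. *)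

theory Defs
  imports "HOL-Analysis.Analysis"
begin

section \<open>The skew field of quaternions\<close>

datatype quat = Quat (qRe: real) (qIm1: real) (qIm2: real) (qIm3: real)

lemma quat_eq_iff:
  "p = q \<longleftrightarrow> qRe p = qRe q \<and> qIm1 p = qIm1 q \<and> qIm2 p = qIm2 q \<and> qIm3 p = qIm3 q"
  by (cases p; cases q) simp

instantiation quat :: ring_1
begin

definition "0 = Quat 0 0 0 0"
definition "1 = Quat 1 0 0 0"
definition "p + q = Quat (qRe p + qRe q) (qIm1 p + qIm1 q) (qIm2 p + qIm2 q) (qIm3 p + qIm3 q)"
definition "p - q = Quat (qRe p - qRe q) (qIm1 p - qIm1 q) (qIm2 p - qIm2 q) (qIm3 p - qIm3 q)"
definition "- q = Quat (- qRe q) (- qIm1 q) (- qIm2 q) (- qIm3 q)"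
definition "p * q = Quat
  (qRe p * qRe q - qIm1 p * qIm1 q - qIm2 p * qIm2 q - qIm3 p * qIm3 q)
  (qRe p * qIm1 q + qIm1 p * qRe q + qIm2 p * qIm3 q - qIm3 p * qIm2 q)
  (qRe p * qIm2 q - qIm1 p * qIm3 q + qIm2 p * qRe q + qIm3 p * qIm1 q)
  (qRe p * qIm3 q + qIm1 p * qIm2 q - qIm2 p * qIm1 q + qIm3 p * qRe q)"

lemmas quat_ring_defs =
  zero_quat_def one_quat_def plus_quat_def minus_quat_def uminus_quat_def times_quat_def

instance
proof
  fix p q r :: quat
  show "p * q * r = p * (q * r)" "(p + q) * r = p * r + q * r" "p * (q + r) = p * q + p * r"
    by (simp_all add: plus_quat_def times_quat_def algebra_simps)
qed (simp_all add: quat_ring_defs quat_eq_iff)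

end

instantiation quat :: real_inner
begin

definition "r *\<^sub>R q = Quat (r * qRe q) (r * qIm1 q) (r * qIm2 q) (r * qIm3 q)"
definition "inner p q = qRe p * qRe q + qIm1 p * qIm1 q + qIm2 p * qIm2 q + qIm3 p * qIm3 q"
definition "norm (q::quat) = sqrt (inner q q)"
definition "dist p q = norm (p - q)" for p q :: quat
definition "sgn q = inverse (norm q) *\<^sub>R q" for q :: quat
definition
  "(uniformity :: (quat \<times> quat) filter) = (INF e\<in>{0 <..}. principal {(x, y). dist x y < e})"
definition
  "open (U :: quat set) \<longleftrightarrow> (\<forall>x\<in>U. \<forall>\<^sub>F (x', y) in uniformity. x' = x \<longrightarrow> y \<in> U)"

instance
proof
  fix p q r :: quat and a b :: real
  show "inner p p = 0 \<longleftrightarrow> p = 0"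
  proof
    assume "inner p p = 0"
    then have "qRe p ^ 2 + qIm1 p ^ 2 + qIm2 p ^ 2 + qIm3 p ^ 2 = 0"
      by (simp add: inner_quat_def power2_eq_square)
    then show "p = 0"
      by (simp add: quat_eq_iff zero_quat_def add_nonneg_eq_0_iff)
  qed (simp add: inner_quat_def zero_quat_def)
  show "inner p q = inner q p"
    by (simp add: inner_quat_def mult.commute)
  show "inner (p + q) r = inner p r + inner q r" "inner (a *\<^sub>R p) q = a * inner p q"
    by (simp_all add: inner_quat_def plus_quat_def scaleR_quat_def algebra_simps)
  show "0 \<le> inner p p"
    by (simp add: inner_quat_def)
  show "a *\<^sub>R (p + q) = a *\<^sub>R p + a *\<^sub>R q" "(a + b) *\<^sub>R p = a *\<^sub>R p + b *\<^sub>R p"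
    "a *\<^sub>R b *\<^sub>R p = (a * b) *\<^sub>R p" "1 *\<^sub>R p = p"
    by (simp_all add: scaleR_quat_def plus_quat_def algebra_simps)
qed (fact norm_quat_def dist_quat_def sgn_quat_def uniformity_quat_def open_quat_def)+

end

definition quat_i :: quat where "quat_i = Quat 0 1 0 0"
definition quat_j :: quat where "quat_j = Quat 0 0 1 0"
definition quat_k :: quat where "quat_k = Quat 0 0 0 1"

lemmas quat_units_defs = one_quat_def quat_i_def quat_j_def quat_k_def

lemma quat_unit_relations:
  "quat_i * quat_i = -1" "quat_j * quat_j = -1" "quat_k * quat_k = -1"
  "quat_i * quat_j = quat_k" "quat_j * quat_i = - quat_k"
  "quat_j * quat_k = quat_i" "quat_k * quat_j = - quat_i"
  "quat_k * quat_i = quat_j" "quat_i * quat_k = - quat_j"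
  by (simp_all add: quat_units_defs times_quat_def uminus_quat_def)

instantiation quat :: euclidean_space
begin

definition "Basis = {1, quat_i, quat_j, quat_k}"

instance
proof
  fix p q :: quat
  show "inner p q = (if p = q then 1 else 0)" if "p \<in> Basis" "q \<in> Basis"
    using that unfolding Basis_quat_def quat_units_defs
    by (elim insertE emptyE) (simp_all only: inner_quat_def quat.sel quat.inject, simp_all)
  show "(\<forall>u\<in>Basis. inner p u = 0) \<longleftrightarrow> p = 0"
    unfolding Basis_quat_def quat_units_defs zero_quat_def
    by (cases p) (simp add: inner_quat_def)
qed (simp_all add: Basis_quat_def)

end

lemma DIM_quat [simp]: "DIM(quat) = 4"
  unfolding Basis_quat_def quat_units_defs by simp

definition quat_cnj :: "quat \<Rightarrow> quat" where
  "quat_cnj q = Quat (qRe q) (- qIm1 q) (- qIm2 q) (- qIm3 q)"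

instantiation quat :: real_normed_div_algebra
begin

definition "inverse q = inverse ((norm q)\<^sup>2) *\<^sub>R quat_cnj q" for q :: quat
definition "p div q = p * inverse q" for p q :: quat

instance
proof
  fix p q :: quat and a :: real
  show "a *\<^sub>R p * q = a *\<^sub>R (p * q)" "p * a *\<^sub>R q = a *\<^sub>R (p * q)"
    by (simp_all add: scaleR_quat_def times_quat_def quat_eq_iff algebra_simps)
  show "norm (p * q) = norm p * norm q"
    unfolding norm_quat_def real_sqrt_mult [symmetric]
    by (rule arg_cong [where f = sqrt])
      (simp add: inner_quat_def times_quat_def algebra_simps)
  have *: "q * quat_cnj q = (norm q)\<^sup>2 *\<^sub>R 1" "quat_cnj q * q = (norm q)\<^sup>2 *\<^sub>R 1" for q
    by (simp_all add: power2_norm_eq_inner inner_quat_def times_quat_def quat_cnj_def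
        scaleR_quat_def one_quat_def quat_eq_iff algebra_simps)
  show "inverse p * p = 1" "p * inverse p = 1" if "p \<noteq> 0"
  proof -
    have n: "inverse ((norm p)\<^sup>2) * (norm p)\<^sup>2 = 1"
      using that by simp
    have "r *\<^sub>R x * y = r *\<^sub>R (x * y)" "x * r *\<^sub>R y = r *\<^sub>R (x * y)" for r and x y :: quat
      by (simp_all add: scaleR_quat_def times_quat_def quat_eq_iff algebra_simps)
    then show "inverse p * p = 1" "p * inverse p = 1"
      by (simp_all only: inverse_quat_def * scaleR_scaleR n scaleR_one)
  qed
  show "inverse (0::quat) = 0"
    by (simp add: inverse_quat_def)
  show "p div q = p * inverse q"
    by (fact divide_quat_def)
qed

end


section \<open>Hyperhermitian matrices and the Moore determinant\<close>

definition hyperhermitian :: "quat^'n^'n \<Rightarrow> bool" where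
  "hyperhermitian A \<longleftrightarrow> (\<forall>i j. A $ i $ j = quat_cnj (A $ j $ i))"

text \<open>The elements of the numeral type \<^typ>\<open>4\<close> are \<open>0, 1, 2, 3\<close> (with \<open>4 = 0\<close>).\<close>

definition quat_unit :: "4 \<Rightarrow> quat" where
  "quat_unit c = (if c = 0 then 1 else if c = 1 then quat_i else if c = 2 then quat_j else quat_k)"

text \<open>
  Matrix of the real bilinear form \<open>(x, y) \<mapsto> Re (\<Sum>i j. cnj (x i) * a i j * y j)\<close> with respect
  to the real basis of the quaternionic space formed by the vectors \<open>axis m (quat_unit c)\<close>.
\<close>

definition real_form :: "quat^'n^'n \<Rightarrow> quat^'n \<Rightarrow> quat^'n \<Rightarrow> real" where
  "real_form A x y = qRe (\<Sum>i\<in>UNIV. \<Sum>j\<in>UNIV. quat_cnj (x $ i) * A $ i $ j * y $ j)"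

definition real_matrix :: "quat^'n^'n \<Rightarrow> real^('n \<times> 4)^('n \<times> 4)" where
  "real_matrix A = (\<chi> r s. real_form A (axis (fst r) (quat_unit (snd r)))
                                       (axis (fst s) (quat_unit (snd s))))"

text \<open>
  A polynomial on the real vector space of hyperhermitian matrices is the restriction of a
  polynomial on the space of all quaternionic matrices, since linear forms extend.
  Extensionality makes the function unique as a function on the whole type.
\<close>

definition moore_det :: "quat^'n^'n \<Rightarrow> real" where
  "moore_det = (THE P. P \<in> extensional {A. hyperhermitian A} \<and>
     (\<exists>p. real_polynomial_function p \<and> (\<forall>A. hyperhermitian A \<longrightarrow> P A = p A)) \<and>
     (\<forall>A. hyperhermitian A \<longrightarrow> det (real_matrix A) = P A ^ 4) \<and>
     P (mat 1) = 1)"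


section \<open>The quaternionic Hessian\<close>

definition dir_deriv ::
  "('a::real_normed_vector \<Rightarrow> 'b::real_normed_vector) \<Rightarrow> 'a \<Rightarrow> 'a \<Rightarrow> 'b" where
  "dir_deriv f z e = vector_derivative (\<lambda>s::real. f (z + s *\<^sub>R e)) (at 0)"

definition dqbar :: "'n \<Rightarrow> (quat^'n \<Rightarrow> quat) \<Rightarrow> quat^'n \<Rightarrow> quat" where
  "dqbar m f z = dir_deriv f z (axis m 1)
     + quat_i * dir_deriv f z (axis m quat_i)
     + quat_j * dir_deriv f z (axis m quat_j)
     + quat_k * dir_deriv f z (axis m quat_k)"

definition dq :: "'n \<Rightarrow> (quat^'n \<Rightarrow> quat) \<Rightarrow> quat^'n \<Rightarrow> quat" where
  "dq m f z = dir_deriv f z (axis m 1)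
     - dir_deriv f z (axis m quat_i) * quat_i
     - dir_deriv f z (axis m quat_j) * quat_j
     - dir_deriv f z (axis m quat_k) * quat_k"

definition quat_hessian :: "(quat^'n \<Rightarrow> real) \<Rightarrow> quat^'n \<Rightarrow> quat^'n^'n" where
  "quat_hessian f z = (\<chi> i j. dqbar i (dq j (\<lambda>w. of_real (f w))) z)"

definition C2_on :: "'a::real_normed_vector set \<Rightarrow> ('a \<Rightarrow> real) \<Rightarrow> bool" where
  "C2_on U f \<longleftrightarrow> (\<exists>(f' :: 'a \<Rightarrow> 'a \<Rightarrow>\<^sub>L real) (f'' :: 'a \<Rightarrow> 'a \<Rightarrow>\<^sub>L ('a \<Rightarrow>\<^sub>L real)).
     (\<forall>x\<in>U. (f has_derivative blinfun_apply (f' x)) (at x)) \<and>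
     (\<forall>x\<in>U. (f' has_derivative blinfun_apply (f'' x)) (at x)) \<and>
     continuous_on U f'')"


section \<open>Subharmonic and quaternionic plurisubharmonic functions\<close>

definition upper_semicontinuous_on :: "'a::topological_space set \<Rightarrow> ('a \<Rightarrow> real) \<Rightarrow> bool" where
  "upper_semicontinuous_on U f \<longleftrightarrow>
     (\<forall>x\<in>U. \<forall>a. f x < a \<longrightarrow> (\<forall>\<^sub>F y in at x within U. f y < a))"

text \<open>
  The normalized surface measure of the sphere, realized as the image of the normalized Lebesgue
  measure of the unit ball under the radial projection; it is concentrated on \<open>sphere x r\<close>.
\<close>

definition sphere_measure :: "'a::euclidean_space \<Rightarrow> real \<Rightarrow> 'a measure" where
  "sphere_measure x r =
     distr (uniform_measure lborel (ball 0 1)) borel (\<lambda>y. x + r *\<^sub>R sgn y)"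

text \<open>
  An upper semicontinuous function is bounded above on a sphere, so that its integral always exists
  in \<open>[-\<infinity>, \<infinity>)\<close>. As the Bochner integral of a non-integrable function is \<open>0\<close>, the
  inequality has to be accompanied by integrability, which excludes the value \<open>-\<infinity>\<close>.
\<close>

definition subharmonic_on :: "'a::euclidean_space set \<Rightarrow> ('a \<Rightarrow> real) \<Rightarrow> bool" where
  "subharmonic_on U f \<longleftrightarrow> upper_semicontinuous_on U f \<and>
     (\<forall>x\<in>U. \<forall>\<^sub>F r in at_right 0.
        set_integrable (sphere_measure x r) (sphere x r) f \<and>
        f x \<le> (LINT y:sphere x r|sphere_measure x r. f y))"

definition right_mult :: "quat^'n \<Rightarrow> quat \<Rightarrow> quat^'n" where
  "right_mult v c = (\<chi> m. v $ m * c)"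

text \<open>
  A right quaternionic line is parametrized by \<open>c \<mapsto> a + v c\<close>. This is a similarity with
  factor \<open>norm v\<close>, so it maps spheres to spheres and preserves their normalized measures.
\<close>

definition quat_psh_on :: "(quat^'n) set \<Rightarrow> (quat^'n \<Rightarrow> real) \<Rightarrow> bool" where
  "quat_psh_on \<Omega> f \<longleftrightarrow> upper_semicontinuous_on \<Omega> f \<and>
     (\<forall>a v. v \<noteq> 0 \<longrightarrow>
        subharmonic_on {c. a + right_mult v c \<in> \<Omega>} (\<lambda>c. f (a + right_mult v c)))"


section \<open>The Monge-Ampere measure of a continuous plurisubharmonic function\<close>

text \<open>
  The measure \<open>\<mu>\<close> on \<open>\<Omega>\<close> is the Monge-Ampere measure of \<open>f\<close> if on every open \<open>U \<subseteq> \<Omega>\<close> it is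
  the weak limit of the Moore determinants of the Hessians of any sequence of \<open>C\<^sup>2\<close>
  plurisubharmonic functions on \<open>U\<close> converging to \<open>f\<close> uniformly on compact subsets of \<open>U\<close>.
  On relatively compact \<open>U\<close> such sequences are obtained by convolution, and therefore at most one
  locally finite Borel measure on \<open>\<Omega>\<close> has this property.
\<close>

definition is_MA_measure ::
  "(quat^'n) set \<Rightarrow> (quat^'n \<Rightarrow> real) \<Rightarrow> (quat^'n) measure \<Rightarrow> bool" where
  "is_MA_measure \<Omega> f \<mu> \<longleftrightarrow>
     sets \<mu> = sets (restrict_space borel \<Omega>) \<and>
     (\<forall>K. compact K \<and> K \<subseteq> \<Omega> \<longrightarrow> emeasure \<mu> K < \<infinity>) \<and>
     (\<forall>U g \<phi>. open U \<and> U \<subseteq> \<Omega> \<and>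
        (\<forall>N::nat. C2_on U (g N) \<and> quat_psh_on U (g N)) \<and>
        (\<forall>K. compact K \<and> K \<subseteq> U \<longrightarrow> uniform_limit K g f sequentially) \<and>
        continuous_on UNIV \<phi> \<and> compact (closure {x. \<phi> x \<noteq> 0}) \<and> closure {x. \<phi> x \<noteq> 0} \<subseteq> U \<longrightarrow>
        (\<lambda>N. LINT x|lborel. \<phi> x * moore_det (quat_hessian (g N) x))
          \<longlonglongrightarrow> (LINT x|\<mu>. \<phi> x))"

end

theory Submission
  imports Defs "HOL-Computational_Algebra.Polynomial"
begin

text \<open>
  Suppose that \<open>u - v\<close> takes at an interior point a value below its minimum \<open>m\<close> on the boundary. For
  a small \<open>\<epsilon> > 0\<close> and a suitable constant \<open>c\<close> the function \<open>d = v + \<epsilon> |x|\<^sup>2 + c - u\<close> is negative on the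
  boundary and positive at that point, so its superlevel sets \<open>{d \<ge> a}\<close> with \<open>a > 0\<close> are compact
  subsets of \<open>\<Omega>\<close>. The heart of the proof is the mass inequality

    \<open>\<nu> {d \<ge> b} + (4 \<epsilon>)\<^sup>n vol {d \<ge> b} \<le> \<mu> {d \<ge> a}\<close>  for \<open>0 < a < b\<close>  (\<open>moore_det_mass_inequality\<close>).

  Together with \<open>\<mu> \<le> \<nu>\<close> it says that \<open>\<nu> {d \<ge> a}\<close> exceeds \<open>\<nu> {d \<ge> b}\<close> by an amount that is bounded
  below as long as \<open>b \<le> s\<close>, where \<open>{d > s}\<close> is nonempty. Along an infinite decreasing sequence of
  levels this gives a compact set of infinite mass, a contradiction (\<open>MA_comparison_interior\<close>).

  For the mass inequality, \<open>u\<close> and \<open>v\<close> are replaced by smooth approximations \<open>u\<^sub>N\<close> and \<open>v\<^sub>N\<close>, obtained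
  by convolution (\<open>psh_smooth_approximation\<close>), and glued. Let \<open>d\<^sub>N = v\<^sub>N + \<epsilon> |x|\<^sup>2 + c - u\<^sub>N\<close> and let \<open>p\<close>
  be a smooth convex function of one variable that vanishes for small arguments and has slope 1 for
  large ones. Then \<open>w\<^sub>N = u\<^sub>N + p(d\<^sub>N)\<close> is a smooth regularized maximum: it coincides with \<open>u\<^sub>N\<close> near
  the edge of \<open>{d \<ge> a}\<close>, differs from \<open>v\<^sub>N + \<epsilon> |x|\<^sup>2\<close> by a constant on \<open>{d \<ge> b}\<close>, and its Hessian is
  a convex combination of the two Hessians plus a positive multiple of a rank-one matrix, hence
  nonnegative. The Moore determinant of the Hessian is a null Lagrangian: its integral
  vanishes for every compactly supported function of class \<open>C\<^sup>2\<close> (\<open>integral_moore_det_hessian_zero\<close>).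
  Therefore \<open>u\<^sub>N\<close> and \<open>w\<^sub>N\<close> have the same mass on \<open>{d \<ge> a}\<close>, and superadditivity of the
  determinant, \<open>det (A + c I) \<ge> det A + c\<^sup>n\<close> for nonnegative \<open>A\<close>, produces the volume term.

  The null Lagrangian property is proved by Fourier analysis. The Fourier coefficients of a Hessian are
  multiples of the rank-one matrices \<open>\<xi> \<xi>\<^sup>*\<close>. The determinant is affine along each rank-one direction
  and vanishes on combinations of \<open>\<xi>\<^sub>1 \<xi>\<^sub>1\<^sup>*, \<dots>, \<xi>\<^sub>n \<xi>\<^sub>n\<^sup>*\<close> if the \<open>\<xi>\<^sub>k\<close> are dependent. Thus, expanded
  into products of plane waves, it contains only products whose frequencies satisfy no relation
  \<open>\<Sum> \<plusminus> \<xi>\<^sub>k = 0\<close>, and each of these integrates to zero over a period cube. Convolution with a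
  trigonometric kernel reduces the general case to finite sums.

  All facts about the Moore determinant come from diagonalization: a hyperhermitian matrix has
  an orthonormal system of quaternionic eigenvectors with real eigenvalues, each of which counts
  four times for the associated real matrix, so that the Moore determinant is the
  product of these eigenvalues.
\<close>

section \<open>Quaternions and the real structure of the quaternionic space\<close>

text \<open>
  The numeral type with four elements is enumerated as \<open>{1, 2, 3, 4}\<close>; this identity translates to
  the labels \<open>0, 1, 2, 3\<close> of the quaternionic units.
\<close>

lemma four_eq_zero: "(4 :: 4) = 0"
  by simp

lemma UNIV_4_from_0: "(UNIV :: 4 set) = {0, 1, 2, 3}"
  by (auto simp: UNIV_4 four_eq_zero)

lemma sum_4_from_0: "sum f (UNIV :: 4 set) = f 0 + f 1 + f 2 + f (3::4)"
  by (simp add: sum_4 four_eq_zero ac_simps)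

lemma quat_unit_simps [simp]:
  "quat_unit 0 = Quat 1 0 0 0" "quat_unit 1 = Quat 0 1 0 0"
  "quat_unit 2 = Quat 0 0 1 0" "quat_unit 3 = Quat 0 0 0 1"
  by (simp_all add: quat_unit_def quat_units_defs)

lemma all_4: "(\<forall>c::4. P c) \<longleftrightarrow> P 0 \<and> P 1 \<and> P 2 \<and> P 3"
  using UNIV_4_from_0 by (metis UNIV_I insertE singletonD)

lemma quat_unit_inner: "quat_unit c \<bullet> quat_unit d = (if c = d then 1 else 0)"
proof -
  have "\<forall>c d. quat_unit c \<bullet> quat_unit d = (if c = d then 1 else 0)"
    by (simp add: all_4 inner_quat_def)
  then show ?thesis by blast
qed

lemma quat_sum_units: "q = (\<Sum>c\<in>UNIV. (quat_unit c \<bullet> q) *\<^sub>R quat_unit c)"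
  by (cases q) (simp add: sum_4_from_0 inner_quat_def scaleR_quat_def plus_quat_def)

lemma quat_parseval: "p \<bullet> q = (\<Sum>c\<in>UNIV. (quat_unit c \<bullet> p) * (quat_unit c \<bullet> q))"
  by (cases p; cases q) (simp add: sum_4_from_0 inner_quat_def)

lemma quat_cnj_mult: "quat_cnj (p * q) = quat_cnj q * quat_cnj p"
  by (simp add: quat_cnj_def times_quat_def)

lemma quat_cnj_cnj [simp]: "quat_cnj (quat_cnj q) = q"
  by (simp add: quat_cnj_def)

lemma quat_cnj_add: "quat_cnj (p + q) = quat_cnj p + quat_cnj q"
  by (simp add: quat_cnj_def plus_quat_def)

lemma quat_cnj_zero [simp]: "quat_cnj 0 = 0"
  by (simp add: quat_cnj_def zero_quat_def)

lemma quat_cnj_one [simp]: "quat_cnj 1 = 1"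
  by (simp add: quat_cnj_def one_quat_def)

lemma quat_cnj_scaleR: "quat_cnj (r *\<^sub>R q) = r *\<^sub>R quat_cnj q"
  by (simp add: quat_cnj_def scaleR_quat_def)

lemma quat_cnj_sum: "quat_cnj (sum f A) = (\<Sum>a\<in>A. quat_cnj (f a))"
  by (induction A rule: infinite_finite_induct) (simp_all add: quat_cnj_add)

lemma quat_inner_Re: "p \<bullet> q = qRe (quat_cnj p * q)"
  by (simp add: inner_quat_def quat_cnj_def times_quat_def)

lemma quat_inner_mult_right: "(p * r) \<bullet> q = p \<bullet> (q * quat_cnj r)"
  by (simp add: inner_quat_def quat_cnj_def times_quat_def algebra_simps)

lemma quat_inner_mult_left: "(r * p) \<bullet> q = p \<bullet> (quat_cnj r * q)"
  by (simp add: inner_quat_def quat_cnj_def times_quat_def algebra_simps)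

lemma qRe_sum: "qRe (sum f A) = (\<Sum>a\<in>A. qRe (f a))"
  by (induction A rule: infinite_finite_induct) (simp_all add: zero_quat_def plus_quat_def)

text \<open>
  Multiplication by a quaternion is a similarity, hence it maps the orthonormal basis of units to an orthogonal
  basis of vectors of equal length.
\<close>

lemma quat_orthonormal_mult: "(q * quat_unit c) \<bullet> (q * quat_unit d) = (if c = d then q \<bullet> q else 0)"
proof -
  have "\<forall>c d. (q * quat_unit c) \<bullet> (q * quat_unit d) = (if c = d then q \<bullet> q else 0)"
    by (cases q) (simp add: all_4 inner_quat_def times_quat_def algebra_simps)
  then show ?thesis by blast
qed

lemma right_mult_nth [simp]: "right_mult v c $ m = v $ m * c"
  by (simp add: right_mult_def)

lemma inner_right_mult: "right_mult v c \<bullet> w = v \<bullet> right_mult w (quat_cnj c)"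
  by (simp add: inner_vec_def quat_inner_mult_right)

lemma right_mult_mult: "right_mult (right_mult v c) d = right_mult v (c * d)"
  by (simp add: vec_eq_iff mult.assoc)

lemma right_mult_orthonormal:
  "right_mult v (quat_unit c) \<bullet> right_mult v (quat_unit d) = (if c = d then v \<bullet> v else 0)"
  by (simp add: inner_vec_def quat_orthonormal_mult)

lemma right_mult_scaleR_left: "right_mult (r *\<^sub>R v) c = r *\<^sub>R right_mult v c"
  by (simp add: vec_eq_iff)

lemma linear_right_mult: "linear (right_mult v)"
  by (rule linearI) (simp_all add: vec_eq_iff distrib_left)

lemma linear_right_mult_left: "linear (\<lambda>v. right_mult v c)"
  by (rule linearI) (simp_all add: vec_eq_iff distrib_right)

lemma right_mult_units: "right_mult v q = (\<Sum>c\<in>UNIV. (quat_unit c \<bullet> q) *\<^sub>R right_mult v (quat_unit c))"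
  by (subst (1) quat_sum_units [of q])
     (simp add: linear_sum [OF linear_right_mult] linear_scale [OF linear_right_mult])

lemma norm_right_mult: "norm (right_mult v c) = norm v * norm c"
proof -
  have "(norm (right_mult v c))\<^sup>2 = (norm v * norm c)\<^sup>2"
    unfolding power_mult_distrib norm_vec_def L2_set_def
    by (simp add: norm_mult power_mult_distrib sum_distrib_right sum_nonneg)
  then show ?thesis
    by (simp add: power2_eq_iff_nonneg)
qed

text \<open>
  The index type is that of the rows and columns of \<^const>\<open>real_matrix\<close>, whose entries are then
  inner products with these vectors.
\<close>

definition qaxis :: "'n \<times> 4 \<Rightarrow> quat^'n" where
  "qaxis r = axis (fst r) (quat_unit (snd r))"

lemma qaxis_inner: "qaxis r \<bullet> v = quat_unit (snd r) \<bullet> (v $ fst r)"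
  by (simp add: qaxis_def inner_axis')

lemma qaxis_orthonormal: "qaxis r \<bullet> qaxis s = (if r = s then 1 else 0)"
  by (auto simp: qaxis_inner) (auto simp: qaxis_def axis_def quat_unit_inner prod_eq_iff)

lemma sum_pair4: "(\<Sum>r\<in>(UNIV :: ('n::finite \<times> 4) set). f r) = (\<Sum>i\<in>UNIV. \<Sum>c\<in>UNIV. f (i, c))"
  by (simp add: sum.cartesian_product)

lemma qaxis_parseval: "(\<Sum>r\<in>UNIV. (qaxis r \<bullet> v) * (qaxis r \<bullet> w)) = v \<bullet> w"
  by (simp add: sum_pair4 qaxis_inner quat_parseval [symmetric]) (simp add: inner_vec_def)

section \<open>Diagonalization of hyperhermitian matrices\<close>

lemma matrix_vector_right_mult: "A *v right_mult x c = right_mult (A *v x) c"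
  for A :: "quat^'n^'n"
  by (simp add: vec_eq_iff matrix_vector_mult_def sum_distrib_right mult.assoc)

lemma real_form_inner: "real_form A x y = x \<bullet> (A *v y)"
  by (simp add: real_form_def inner_vec_def matrix_vector_mult_def quat_inner_Re qRe_sum
      sum_distrib_left mult.assoc)

lemma real_matrix_nth: "real_matrix A $ r $ s = qaxis r \<bullet> (A *v qaxis s)"
  by (simp add: real_matrix_def real_form_inner qaxis_def)

lemma hyperhermitian_self_adjoint:
  assumes "hyperhermitian A"
  shows "(A *v x) \<bullet> y = x \<bullet> (A *v y)"
proof -
  have "(A *v x) \<bullet> y = (\<Sum>i\<in>UNIV. \<Sum>j\<in>UNIV. (A $ i $ j * x $ j) \<bullet> y $ i)"
    by (simp add: inner_vec_def matrix_vector_mult_def inner_sum_left)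
  also have "\<dots> = (\<Sum>i\<in>UNIV. \<Sum>j\<in>UNIV. x $ j \<bullet> (A $ j $ i * y $ i))"
  proof -
    have "quat_cnj (A $ i $ j) = A $ j $ i" for i j
      using assms by (metis hyperhermitian_def)
    then show ?thesis by (simp add: quat_inner_mult_left)
  qed
  also have "\<dots> = x \<bullet> (A *v y)"
    by (subst sum.swap) (simp add: inner_vec_def matrix_vector_mult_def inner_sum_right)
  finally show ?thesis .
qed

lemma linear_matrix_vector: "linear ((*v) (A :: quat^'n^'n))"
  by (rule linearI)
     (simp_all add: vec_eq_iff matrix_vector_mult_def distrib_left sum.distrib scaleR_sum_right)

text \<open>
  The eigenvalues are real, and multiplication by a real number commutes with quaternions, so every right
  multiple of an eigenvector is again an eigenvector for the same eigenvalue. Orthonormality is demanded of the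
  \<open>4 n\<close> vectors obtained with the units, which makes them a real eigenbasis of
  \<^const>\<open>real_matrix\<close>.
\<close>

definition eigensystem :: "quat^'n^'n \<Rightarrow> ('n \<Rightarrow> quat^'n) \<Rightarrow> ('n \<Rightarrow> real) \<Rightarrow> bool" where
  "eigensystem A x l \<longleftrightarrow> (\<forall>i. A *v x i = l i *\<^sub>R x i) \<and>
     (\<forall>i j c d. right_mult (x i) (quat_unit c) \<bullet> right_mult (x j) (quat_unit d)
        = (if i = j \<and> c = d then 1 else 0))"

text \<open>
  In the real basis given by an eigensystem, \<open>real_matrix A\<close> becomes diagonal, with each eigenvalue
  occurring once for each of the four units.
\<close>

lemma det_real_matrix_eigensystem:
  fixes A :: "quat^'n^'n"
  assumes A: "hyperhermitian A" and E: "eigensystem A x l"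
  shows "det (real_matrix A) = (\<Prod>i\<in>UNIV. l i) ^ 4"
proof -
  define y where "y s = right_mult (x (fst s)) (quat_unit (snd s))" for s :: "'n \<times> 4"
  define U :: "real^('n \<times> 4)^('n \<times> 4)" where "U = (\<chi> r s. qaxis r \<bullet> y s)"
  define D :: "real^('n \<times> 4)^('n \<times> 4)" where "D = (\<chi> r s. if r = s then l (fst r) else 0)"
  have "transpose U ** U = mat 1"
    using E by (auto simp: vec_eq_iff matrix_matrix_mult_def transpose_def U_def mat_def
        qaxis_parseval y_def eigensystem_def prod_eq_iff)
  then have dU: "det U \<noteq> 0"
    by (metis det_I det_mul det_transpose mult_zero_left zero_neq_one)
  have Ay: "A *v y s = l (fst s) *\<^sub>R y s" for s
    using E by (simp add: y_def eigensystem_def matrix_vector_right_mult right_mult_scaleR_left)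
  have "(real_matrix A ** U) $ r $ s = (U ** D) $ r $ s" for r s
  proof -
    have sw: "qaxis r \<bullet> (A *v qaxis t) = qaxis t \<bullet> (A *v qaxis r)" for t
      using hyperhermitian_self_adjoint [OF A, of "qaxis r" "qaxis t"] by (simp add: inner_commute)
    have "(real_matrix A ** U) $ r $ s = (\<Sum>t\<in>UNIV. (qaxis r \<bullet> (A *v qaxis t)) * (qaxis t \<bullet> y s))"
      by (simp add: matrix_matrix_mult_def real_matrix_nth U_def)
    also have "\<dots> = (\<Sum>t\<in>UNIV. (qaxis t \<bullet> (A *v qaxis r)) * (qaxis t \<bullet> y s))"
      by (simp only: sw)
    also have "\<dots> = qaxis r \<bullet> (A *v y s)"
      by (simp add: qaxis_parseval hyperhermitian_self_adjoint [OF A])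
    also have "\<dots> = (U ** D) $ r $ s"
      by (simp add: Ay matrix_matrix_mult_def U_def D_def if_distrib cong: if_cong)
    finally show ?thesis .
  qed
  then have "real_matrix A ** U = U ** D"
    by (simp add: vec_eq_iff)
  then have "det (real_matrix A) = det D"
    using dU by (metis det_mul mult.commute mult_right_cancel)
  also have "\<dots> = (\<Prod>s\<in>(UNIV :: ('n \<times> 4) set). l (fst s))"
    by (subst det_diagonal) (simp_all add: D_def)
  also have "\<dots> = (\<Prod>i\<in>UNIV. \<Prod>c\<in>(UNIV :: 4 set). l i)"
    by (subst prod.cartesian_product) (simp add: split_def)
  finally show ?thesis
    by (simp add: prod_power_distrib)
qed

text \<open>
  If a nonnegative form vanishes at \<open>y\<close>, then \<open>y\<close> is a minimum and the first variation
  of the form in every direction \<open>z\<close> vanishes. Applied to \<open>\<kappa> - A\<close>, this turns a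
  maximum point of the form of \<open>A\<close> into an eigenvector.
\<close>

lemma psd_form_kernel:
  fixes B :: "'a::real_inner \<Rightarrow> 'a"
  assumes "linear B" and sym: "\<And>x y. B x \<bullet> y = x \<bullet> B y"
    and W: "subspace W" and pos: "\<And>w. w \<in> W \<Longrightarrow> 0 \<le> w \<bullet> B w"
    and y: "y \<in> W" "y \<bullet> B y = 0" and z: "z \<in> W"
  shows "z \<bullet> B y = 0"
proof (rule ccontr)
  assume nz: "z \<bullet> B y \<noteq> 0"
  define \<beta> where "\<beta> = z \<bullet> B y"
  define \<gamma> where "\<gamma> = z \<bullet> B z"
  have q: "0 \<le> 2 * t * \<beta> + t\<^sup>2 * \<gamma>" for t
  proof -
    have "y + t *\<^sub>R z \<in> W"
      using W y z by (simp add: subspace_add subspace_scale)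
    then have "0 \<le> (y + t *\<^sub>R z) \<bullet> B (y + t *\<^sub>R z)"
      by (rule pos)
    also have "\<dots> = y \<bullet> B y + t * (z \<bullet> B y) + t * (B z \<bullet> y) + t\<^sup>2 * (z \<bullet> B z)"
      by (simp add: linear_add [OF assms(1)] linear_scale [OF assms(1)] inner_add inner_commute
          power2_eq_square algebra_simps)
    finally show ?thesis
      by (simp add: y sym \<beta>_def \<gamma>_def)
  qed
  have g: "0 \<le> \<gamma>" using pos [OF z] by (simp add: \<gamma>_def)
  have "0 \<le> 2 * (- \<beta> / (\<gamma> + 1)) * \<beta> + (- \<beta> / (\<gamma> + 1))\<^sup>2 * \<gamma>" by (rule q)
  (* The quadratic inequality is contradicted near its vertex; gamma + 1 avoids a division by zero. *)
  also have "\<dots> = \<beta>\<^sup>2 / (\<gamma> + 1)\<^sup>2 * (\<gamma> - 2 * (\<gamma> + 1))"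
    using g by (simp add: power2_eq_square divide_simps) (simp add: algebra_simps)
  also have "\<dots> < 0"
    using nz g by (intro mult_pos_neg) (auto simp: \<beta>_def)
  finally show False by simp
qed

text \<open>
  Eigenvectors are produced one after another. The orthogonal complement of the right multiples of the first
  \<open>k\<close> eigenvectors is stable under \<open>A\<close>, because \<open>A\<close> is self-adjoint, and
  under right multiplication; for \<open>k < n\<close> it is nonzero by a dimension count. A unit vector in it
  that maximizes the form of \<open>A\<close> is the next eigenvector.
\<close>

lemma eigensystem_exists:
  fixes A :: "quat^'n^'n"
  assumes A: "hyperhermitian A"
  shows "\<exists>x l. eigensystem A x l"
proof -
  let ?P = "\<lambda>k (x :: nat \<Rightarrow> quat^'n) l. (\<forall>i<k. A *v x i = l i *\<^sub>R x i \<and> norm (x i) = 1) \<and>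
     (\<forall>i<k. \<forall>j<k. i \<noteq> j \<longrightarrow> (\<forall>q. right_mult (x i) q \<bullet> x j = 0))"
  have "k \<le> CARD('n) \<Longrightarrow> \<exists>x l. ?P k x l" for k
  proof (induction k)
    case 0
    show ?case by simp
  next
    case (Suc k)
    then obtain x l where P: "?P k x l" by auto
    define W where "W = {y. \<forall>i<k. \<forall>q. right_mult (x i) q \<bullet> y = 0}"
    have sW: "subspace W"
      by (auto simp: W_def subspace_def inner_add_right)
    have rW: "right_mult y q \<in> W" if "y \<in> W" for y q
      using that by (simp add: W_def inner_commute [of _ "right_mult y q"])
        (simp add: inner_right_mult right_mult_mult inner_commute)
    have AW: "A *v y \<in> W" if "y \<in> W" for y
    proof -
      have "right_mult (x i) q \<bullet> (A *v y) = 0" if "i < k" for i q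
      proof -
        have "right_mult (x i) q \<bullet> (A *v y) = right_mult (A *v x i) q \<bullet> y"
          by (simp add: hyperhermitian_self_adjoint [OF A, symmetric] matrix_vector_right_mult)
        also have "\<dots> = 0"
          using P \<open>y \<in> W\<close> that by (simp add: W_def right_mult_scaleR_left)
        finally show ?thesis .
      qed
      then show ?thesis by (simp add: W_def)
    qed
    have "\<exists>y. y \<in> W \<and> y \<noteq> 0"
    proof -
      define X where "X = (\<lambda>(i, c). right_mult (x i) (quat_unit c)) ` ({..<k} \<times> UNIV)"
      have "dim X \<le> card X"
        by (rule dim_le_card') (simp add: X_def)
      also have "card X \<le> k * 4"
        unfolding X_def by (rule order_trans [OF card_image_le]) (simp_all add: card_cartesian_product)
      also have "\<dots> < DIM(quat^'n)"
        using Suc.prems by simp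
      finally obtain y where y: "y \<noteq> 0" "\<And>v. v \<in> span X \<Longrightarrow> orthogonal y v"
        using orthogonal_to_subspace_exists by metis
      have "right_mult (x i) q \<bullet> y = 0" if "i < k" for i q
      proof -
        have "right_mult (x i) q \<in> span X"
          by (subst right_mult_units, intro span_sum span_scale span_base)
             (use that in \<open>auto simp: X_def image_iff\<close>)
        then show ?thesis
          using y(2) unfolding orthogonal_def by (metis inner_commute)
      qed
      then show ?thesis using y(1) by (auto simp: W_def)
    qed
    then obtain y0 where y0: "y0 \<in> W" "y0 \<noteq> 0" by blast
    define S where "S = W \<inter> sphere 0 1"
    have "closed W" using sW by (rule closed_subspace)
    then have "compact S" unfolding S_def by (intro closed_Int_compact compact_sphere)
    moreover have "(1 / norm y0) *\<^sub>R y0 \<in> S"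
      using y0 sW by (simp add: S_def subspace_scale)
    moreover have "continuous_on S (\<lambda>y. y \<bullet> (A *v y))"
      using linear_continuous_on [OF linear_conv_bounded_linear [THEN iffD1, OF linear_matrix_vector]]
      by (intro continuous_intros) 
    ultimately obtain y where yS: "y \<in> S" and ymax: "\<And>z. z \<in> S \<Longrightarrow> z \<bullet> (A *v z) \<le> y \<bullet> (A *v y)"
      using continuous_attains_sup [of S "\<lambda>y. y \<bullet> (A *v y)"] by blast
    define \<kappa> where "\<kappa> = y \<bullet> (A *v y)"
    define B where "B z = \<kappa> *\<^sub>R z - A *v z" for z
    have yW: "y \<in> W" and ny: "norm y = 1" using yS by (auto simp: S_def)
    have lB: "linear B"
      unfolding B_def by (intro linear_compose_sub linear_scale_self linear_matrix_vector)
    have posB: "0 \<le> w \<bullet> B w" if "w \<in> W" for w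
    proof (cases "w = 0")
      case False
      have "(1 / norm w) *\<^sub>R w \<in> S" using that False sW by (simp add: S_def subspace_scale)
      then have "((1 / norm w) *\<^sub>R w) \<bullet> (A *v ((1 / norm w) *\<^sub>R w)) \<le> \<kappa>"
        unfolding \<kappa>_def by (rule ymax)
      then have "(1 / norm w)\<^sup>2 * (w \<bullet> (A *v w)) \<le> \<kappa>"
        by (simp add: linear_scale [OF linear_matrix_vector] power2_eq_square)
      then have "w \<bullet> (A *v w) \<le> \<kappa> * (norm w)\<^sup>2"
        using False by (simp add: field_simps)
      then show ?thesis by (simp add: B_def inner_diff_right power2_norm_eq_inner)
    qed simp
    have "B y \<bullet> B y = 0"
    proof (rule psd_form_kernel [OF lB _ sW posB yW])
      show "B u \<bullet> w = u \<bullet> B w" for u w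
        by (simp add: B_def inner_diff hyperhermitian_self_adjoint [OF A])
      show "y \<bullet> B y = 0"
        using ny by (simp add: B_def inner_diff_right \<kappa>_def norm_eq_1)
      show "B y \<in> W"
        using yW AW sW by (simp add: B_def subspace_diff subspace_scale)
    qed
    then have Ay: "A *v y = \<kappa> *\<^sub>R y" by (simp add: B_def)
    have o1: "right_mult (x i) q \<bullet> y = 0" if "i < k" for i q
      using yW that by (simp add: W_def)
    have o2: "right_mult y q \<bullet> x i = 0" if "i < k" for i q
      using o1 [OF that, of "quat_cnj q"] by (metis inner_commute inner_right_mult)
    have "?P (Suc k) (x(k := y)) (l(k := \<kappa>))"
      using P Ay ny o1 o2 by (simp add: less_Suc_eq all_conj_distrib)
    then show ?case by blast
  qed
  then obtain x l where P: "?P (CARD('n)) x l" by blast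
  obtain h :: "'n \<Rightarrow> nat" where h: "bij_betw h UNIV {0..<CARD('n)}"
    using ex_bij_betw_finite_nat [of "UNIV :: 'n set"] by auto
  have hl: "h i < CARD('n)" for i using h by (auto simp: bij_betw_def)
  have hi: "h i = h j \<longleftrightarrow> i = j" for i j using h by (auto simp: bij_betw_def inj_on_def)
  have "eigensystem A (x \<circ> h) (l \<circ> h)"
    unfolding eigensystem_def
  proof (intro conjI allI)
    show "A *v (x \<circ> h) i = (l \<circ> h) i *\<^sub>R (x \<circ> h) i" for i using P hl by simp
    show "right_mult ((x \<circ> h) i) (quat_unit c) \<bullet> right_mult ((x \<circ> h) j) (quat_unit d)
        = (if i = j \<and> c = d then 1 else 0)" for i j c d
    proof (cases "i = j")
      case True
      then show ?thesis using P hl by (simp add: right_mult_orthonormal norm_eq_1)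
    next
      case False
      have "right_mult (x (h i)) (quat_unit c) \<bullet> right_mult (x (h j)) (quat_unit d) =
          right_mult (x (h i)) (quat_unit c * quat_cnj (quat_unit d)) \<bullet> x (h j)"
        by (simp add: inner_commute [of _ "right_mult (x (h j)) _"] inner_right_mult right_mult_mult)
      also have "\<dots> = 0" using P hl hi False by blast
      finally show ?thesis using False by simp
    qed
  qed
  then show ?thesis by blast
qed

section \<open>The Moore determinant as the product of the eigenvalues\<close>

text \<open>
  Restriction to rays turns questions about polynomial functions on a vector space into questions about
  polynomials in one variable, where unique factorization is available, while the coefficients keep a polynomial
  dependence on the direction.
\<close>

lemma real_polynomial_along_rays:
  fixes f :: "'a::real_normed_vector \<Rightarrow> real"
  assumes "real_polynomial_function f"
  shows "\<exists>D. (\<forall>a t. f (t *\<^sub>R a) = poly (D a) t) \<and> (\<forall>k. real_polynomial_function (\<lambda>a. coeff (D a) k))"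
  using assms
proof induction
  case (linear f)
  have "real_polynomial_function (\<lambda>a. coeff [:0, f a:] k)" for k
  proof (cases "k = 1")
    case True
    then show ?thesis using linear by (simp add: real_polynomial_function.intros(1))
  next
    case False
    then have "coeff [:0, f a:] k = 0" for a
      by (cases k) (auto simp: coeff_pCons split: nat.split)
    then show ?thesis by (simp add: real_polynomial_function.intros(2))
  qed
  moreover have "f (t *\<^sub>R a) = poly [:0, f a:] t" for a t
    using linear by (simp add: linear_simps)
  ultimately show ?case by (intro exI [of _ "\<lambda>a. [:0, f a:]"]) blast
next
  case (const c)
  show ?case by (intro exI [of _ "\<lambda>a. [:c:]"]) (auto simp: real_polynomial_function.intros)
next
  case (add f g)
  then obtain D E where "\<forall>a t. f (t *\<^sub>R a) = poly (D a) t" "\<forall>a t. g (t *\<^sub>R a) = poly (E a) t"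
    "\<forall>k. real_polynomial_function (\<lambda>a. coeff (D a) k)" "\<forall>k. real_polynomial_function (\<lambda>a. coeff (E a) k)"
    by blast
  then show ?case
    by (intro exI [of _ "\<lambda>a. D a + E a"]) (auto intro: real_polynomial_function.intros)
next
  case (mult f g)
  then obtain D E where "\<forall>a t. f (t *\<^sub>R a) = poly (D a) t" "\<forall>a t. g (t *\<^sub>R a) = poly (E a) t"
    "\<forall>k. real_polynomial_function (\<lambda>a. coeff (D a) k)" "\<forall>k. real_polynomial_function (\<lambda>a. coeff (E a) k)"
    by blast
  then show ?case
    by (intro exI [of _ "\<lambda>a. D a * E a"])
       (auto simp: coeff_mult intro!: real_polynomial_function_sum real_polynomial_function.intros(4))
qed

text \<open>
  With constant term 1, the coefficients of a square root can be solved for recursively by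
  \<open>d\<^sub>k = 2 q\<^sub>k + \<Sum>\<^bsub>0<i<k\<^esub> q\<^sub>i q\<^bsub>k-i\<^esub>\<close>, and each
  \<open>q\<^sub>k\<close> is a polynomial in the \<open>d\<^sub>i\<close>. Two applications give fourth roots.
\<close>

lemma coeff_square_root_polynomial:
  fixes q d :: "'a::real_normed_vector \<Rightarrow> real poly"
  assumes sq: "\<And>a. a \<in> S \<Longrightarrow> q a ^ 2 = d a" and q0: "\<And>a. a \<in> S \<Longrightarrow> coeff (q a) 0 = 1"
    and d: "\<And>k. \<exists>c. real_polynomial_function c \<and> (\<forall>a\<in>S. coeff (d a) k = c a)"
  shows "\<exists>c. real_polynomial_function c \<and> (\<forall>a\<in>S. coeff (q a) k = c a)"
proof (induction k rule: less_induct)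
  case (less k)
  show ?case
  proof (cases k)
    case 0
    then show ?thesis
      using q0 by (intro exI [of _ "\<lambda>_. 1"]) (auto intro: real_polynomial_function.intros)
  next
    case (Suc j)
    from less.IH obtain c where c: "\<And>i. i < k \<Longrightarrow> real_polynomial_function (c i)"
      "\<And>i a. i < k \<Longrightarrow> a \<in> S \<Longrightarrow> coeff (q a) i = c i a"
      by metis
    obtain e where e: "real_polynomial_function e" "\<And>a. a \<in> S \<Longrightarrow> coeff (d a) k = e a"
      using d by metis
    have "coeff (q a) k = (e a - (\<Sum>i\<in>{1..j}. c i a * c (k - i) a)) / 2" if a: "a \<in> S" for a
    proof -
      have "e a = coeff (q a * q a) k"
        using e(2) [OF a] sq [OF a] by (simp add: power2_eq_square)
      also have "\<dots> = (\<Sum>i\<le>Suc j. coeff (q a) i * coeff (q a) (k - i))"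
        by (simp add: coeff_mult Suc)
      also have "\<dots> = (\<Sum>i\<in>{1..j}. coeff (q a) i * coeff (q a) (k - i)) + 2 * coeff (q a) k"
      proof -
        have "{..Suc j} = insert 0 (insert (Suc j) {1..j})" by auto
        then show ?thesis using q0 [OF a] Suc by simp
      qed
      also have "(\<Sum>i\<in>{1..j}. coeff (q a) i * coeff (q a) (k - i)) = (\<Sum>i\<in>{1..j}. c i a * c (k - i) a)"
        by (rule sum.cong) (use a c(2) Suc in auto)
      finally show ?thesis by simp
    qed
    moreover have "real_polynomial_function (\<lambda>a. (e a - (\<Sum>i\<in>{1..j}. c i a * c (k - i) a)) / 2)"
      using e(1) c(1) Suc
      by (intro real_polynomial_function_divide real_polynomial_function_diff real_polynomial_function_sum
          real_polynomial_function.intros(4)) auto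
    ultimately show ?thesis by blast
  qed
qed

text \<open>
  In \<open>p\<^sup>4 - q\<^sup>4 = (p - q) (p + q) (p\<^sup>2 + q\<^sup>2)\<close> the last two factors do not
  vanish at 0.
\<close>

lemma poly_fourth_root_unique:
  fixes p q :: "real poly"
  assumes "p ^ 4 = q ^ 4" "poly p 0 = 1" "poly q 0 = 1"
  shows "p = q"
proof -
  have "(p - q) * ((p + q) * (p ^ 2 + q ^ 2)) = p ^ 4 - q ^ 4"
    by (simp add: power2_eq_square power4_eq_xxxx algebra_simps)
  then have "(p - q) * ((p + q) * (p ^ 2 + q ^ 2)) = 0" using assms by simp
  moreover have "poly (p + q) 0 \<noteq> 0" "poly (p ^ 2 + q ^ 2) 0 \<noteq> 0"
    using assms(2,3) by simp_all
  then have "p + q \<noteq> 0" "p ^ 2 + q ^ 2 \<noteq> 0" by (metis poly_0)+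
  ultimately show ?thesis by auto
qed

lemma poly_eqI_everywhere:
  fixes p q :: "real poly"
  assumes "\<And>t. poly p t = poly q t"
  shows "p = q"
  using assms poly_eq_poly_eq_iff by blast

lemma matrix_vector_mult_add_mat: "(A + c *\<^sub>R B) *v x = A *v x + c *\<^sub>R (B *v x)"
  for A B :: "quat^'n^'n"
  by (simp add: vec_eq_iff matrix_vector_mult_def distrib_right sum.distrib scaleR_sum_right)

lemma poly_altdef_le:
  fixes p :: "'a::comm_semiring_1 poly"
  assumes "degree p \<le> n"
  shows "poly p x = (\<Sum>i\<le>n. coeff p i * x ^ i)"
  unfolding poly_altdef using assms
  by (intro sum.mono_neutral_left) (auto simp: coeff_eq_0)

lemma real_matrix_linear: "linear (\<lambda>A :: quat^'n^'n. real_matrix A $ r $ s)"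
proof (rule linearI)
  fix A B :: "quat^'n^'n" and c :: real
  show "real_matrix (A + B) $ r $ s = real_matrix A $ r $ s + real_matrix B $ r $ s"
    using matrix_vector_mult_add_mat [of A 1 B] by (simp add: real_matrix_nth inner_add_right)
  show "real_matrix (c *\<^sub>R B) $ r $ s = c *\<^sub>R real_matrix B $ r $ s"
    using matrix_vector_mult_add_mat [of 0 c B] by (simp add: real_matrix_nth)
qed

lemma hyperhermitian_mat_1: "hyperhermitian (mat 1 :: quat^'n^'n)"
  by (auto simp: hyperhermitian_def mat_def)

lemma hyperhermitian_add: "hyperhermitian A \<Longrightarrow> hyperhermitian B \<Longrightarrow> hyperhermitian (A + B)"
  unfolding hyperhermitian_def vector_add_component quat_cnj_add
  by (intro allI arg_cong2 [where f = "(+)"]) blast+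

lemma hyperhermitian_scaleR: "hyperhermitian A \<Longrightarrow> hyperhermitian (r *\<^sub>R A)"
  unfolding hyperhermitian_def vector_scaleR_component quat_cnj_scaleR
  by (intro allI arg_cong2 [where f = "(*\<^sub>R)"] refl) blast

lemma eigensystem_shift:
  assumes "eigensystem A x l"
  shows "eigensystem (mat 1 + t *\<^sub>R A) x (\<lambda>i. 1 + t * l i)"
  using assms by (simp add: eigensystem_def matrix_vector_mult_add_mat scaleR_add_left)

lemma real_polynomial_det_real_matrix:
  "real_polynomial_function (\<lambda>A :: quat^'n^'n. det (real_matrix (mat 1 + A)))"
proof -
  have "real_polynomial_function (\<lambda>A :: quat^'n^'n. real_matrix (mat 1 + A) $ r $ s)" for r s
  proof -
    have "real_matrix (mat 1 + A) $ r $ s = real_matrix (mat 1) $ r $ s + real_matrix A $ r $ s" for A :: "quat^'n^'n"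
      using linear_add [OF real_matrix_linear] by blast
    moreover have "bounded_linear (\<lambda>A :: quat^'n^'n. real_matrix A $ r $ s)"
      using real_matrix_linear linear_conv_bounded_linear by blast
    ultimately show ?thesis
      by (simp add: real_polynomial_function.intros)
  qed
  then show ?thesis
    unfolding det_def
    by (intro real_polynomial_function_sum real_polynomial_function.intros(4) real_polynomial_function.intros(2)
        real_polynomial_function_prod) auto
qed

lemma poly_prod_linear: "poly (\<Prod>i\<in>I. [:1, l i:]) t = (\<Prod>i\<in>I. 1 + t * l i)"
  by (simp add: poly_prod)

lemma degree_prod_linear: "finite I \<Longrightarrow> degree (\<Prod>i\<in>I. [:1, l i :: real:]) \<le> card I"
  by (rule order_trans [OF degree_prod_sum_le])
     (auto intro!: order_trans [OF sum_bounded_above [of I _ 1]])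

text \<open>
  For an eigensystem of \<open>A\<close> the product \<open>\<Prod> (1 + t l\<^sub>i)\<close> is the fourth root
  of the polynomial \<open>t \<mapsto> det (real_matrix (1 + t A))\<close> with constant term 1. Its
  coefficients are therefore polynomials in \<open>A\<close>, and evaluating it at \<open>t = 1\<close> for
  \<open>A - 1\<close> in place of \<open>A\<close> gives the product of the eigenvalues of \<open>A\<close> as
  a polynomial in \<open>A\<close>.
\<close>

lemma moore_polynomial_exists:
  "\<exists>P. real_polynomial_function P \<and>
     (\<forall>(A :: quat^'n^'n) x l. hyperhermitian A \<longrightarrow> eigensystem A x l \<longrightarrow> P A = (\<Prod>i\<in>UNIV. l i))"
proof -
  obtain D where D: "\<And>a t. det (real_matrix (mat 1 + t *\<^sub>R a)) = poly (D a) t"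
    and Dk: "\<And>k. real_polynomial_function (\<lambda>a :: quat^'n^'n. coeff (D a) k)"
    using real_polynomial_along_rays [OF real_polynomial_det_real_matrix] by metis
  define S :: "(quat^'n^'n) set" where "S = Collect hyperhermitian"
  obtain X L where E: "\<And>A. A \<in> S \<Longrightarrow> eigensystem A (X A) (L A)"
    using eigensystem_exists unfolding S_def mem_Collect_eq by metis
  define q where "q A = (\<Prod>i\<in>(UNIV::'n set). [:1, L A i:])" for A
  have q4: "(q A ^ 2) ^ 2 = D A" if "A \<in> S" for A
  proof (rule poly_eqI_everywhere)
    fix t
    have "poly (D A) t = (\<Prod>i\<in>UNIV. 1 + t * L A i) ^ 4"
      unfolding D [symmetric]
      by (rule det_real_matrix_eigensystem [OF _ eigensystem_shift [OF E [OF that]]])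
         (use that in \<open>auto simp: S_def hyperhermitian_add hyperhermitian_scaleR hyperhermitian_mat_1\<close>)
    then show "poly ((q A ^ 2) ^ 2) t = poly (D A) t"
      by (simp add: q_def poly_prod_linear poly_power flip: power_mult)
  qed
  have q0: "coeff (q A) 0 = 1" for A
    by (simp add: q_def poly_prod flip: poly_0_coeff_0)
  have "\<exists>c. real_polynomial_function c \<and> (\<forall>A\<in>S. coeff (q A ^ 2) k = c A)" for k
    by (rule coeff_square_root_polynomial [of S _ D]) (use q4 q0 Dk in \<open>auto simp: coeff_0_power\<close>)
  then have "\<exists>c. real_polynomial_function c \<and> (\<forall>A\<in>S. coeff (q A) k = c A)" for k
    by (rule coeff_square_root_polynomial [of S q "\<lambda>A. q A ^ 2", OF refl q0]) 
  then obtain c where c: "\<And>k. real_polynomial_function (c k)" "\<And>k A. A \<in> S \<Longrightarrow> coeff (q A) k = c k A"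
    by metis
  define P where "P A = (\<Sum>k\<le>CARD('n). c k (A - mat 1))" for A
  have "real_polynomial_function P"
    unfolding P_def [abs_def]
  proof (rule real_polynomial_function_sum)
    fix k
    have "polynomial_function (\<lambda>A :: quat^'n^'n. A - mat 1)" by (intro polynomial_function_diff polynomial_function_const polynomial_function_bounded_linear bounded_linear_ident)
    from real_polynomial_function_compose [OF this c(1)]
    show "real_polynomial_function (\<lambda>A. c k (A - mat 1))" by (simp add: o_def)
  qed simp
  moreover have "P A = (\<Prod>i\<in>UNIV. l i)" if A: "hyperhermitian A" and xl: "eigensystem A x l" for A x l
  proof -
    let ?B = "A - mat 1"
    have BS: "?B \<in> S"
      using hyperhermitian_add [OF A hyperhermitian_scaleR [OF hyperhermitian_mat_1, of "-1"]]
      by (simp add: S_def)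
    define r where "r = (\<Prod>i\<in>(UNIV::'n set). [:1, l i - 1:])"
    have "eigensystem ?B x (\<lambda>i. l i - 1)"
      using xl matrix_vector_mult_add_mat [of A "-1" "mat 1"] by (simp add: eigensystem_def scaleR_diff_left)
    then have "(q ?B) ^ 4 = r ^ 4"
    proof (intro poly_eqI_everywhere)
      fix t
      assume e: "eigensystem ?B x (\<lambda>i. l i - 1)"
      have "poly (D ?B) t = (\<Prod>i\<in>UNIV. 1 + t * (l i - 1)) ^ 4"
        unfolding D [symmetric]
        by (rule det_real_matrix_eigensystem [OF _ eigensystem_shift [OF e]])
           (use BS in \<open>auto simp: S_def hyperhermitian_add hyperhermitian_scaleR hyperhermitian_mat_1\<close>)
      moreover have "(q ?B) ^ 4 = D ?B" using q4 [OF BS] by (simp flip: power_mult)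
      ultimately show "poly ((q ?B) ^ 4) t = poly (r ^ 4) t"
        by (simp add: r_def poly_prod_linear poly_power)
    qed
    then have "q ?B = r"
      by (rule poly_fourth_root_unique) (simp_all add: q_def r_def poly_prod)
    have "P A = (\<Sum>k\<le>CARD('n). coeff r k * 1 ^ k)"
      using c(2) [OF BS] \<open>q ?B = r\<close> by (simp add: P_def)
    also have "\<dots> = poly r 1"
      by (rule poly_altdef_le [symmetric]) (simp add: r_def degree_prod_linear)
    also have "\<dots> = (\<Prod>i\<in>UNIV. l i)"
      by (simp add: r_def poly_prod)
    finally show ?thesis .
  qed
  ultimately show ?thesis by blast
qed

text \<open>
  On each line through the identity matrix the two functions are polynomials in one variable with equal fourth
  powers and value 1 at the identity. A sign ambiguity is excluded because a polynomial, unlike a pointwise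
  root, cannot switch branches.
\<close>

lemma moore_det_unique:
  fixes P Q :: "quat^'n^'n \<Rightarrow> real"
  assumes P: "real_polynomial_function p" "\<And>A. hyperhermitian A \<Longrightarrow> P A = p A" "P (mat 1) = 1"
    and Q: "real_polynomial_function q" "\<And>A. hyperhermitian A \<Longrightarrow> Q A = q A" "Q (mat 1) = 1"
    and PQ: "\<And>A. hyperhermitian A \<Longrightarrow> P A ^ 4 = Q A ^ 4"
    and A: "hyperhermitian A"
  shows "P A = Q A"
proof -
  have pf: "polynomial_function (\<lambda>B :: quat^'n^'n. mat 1 + B)"
    by (intro polynomial_function_add polynomial_function_const polynomial_function_bounded_linear bounded_linear_ident)
  obtain D where D: "\<And>a t. p (mat 1 + t *\<^sub>R a) = poly (D a) t"
    using real_polynomial_along_rays [OF real_polynomial_function_compose [OF pf P(1)]] unfolding o_def by metis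
  obtain E where E: "\<And>a t. q (mat 1 + t *\<^sub>R a) = poly (E a) t"
    using real_polynomial_along_rays [OF real_polynomial_function_compose [OF pf Q(1)]] unfolding o_def by metis
  let ?B = "A - mat 1"
  have h: "hyperhermitian (mat 1 + t *\<^sub>R ?B)" for t
    using hyperhermitian_add [OF hyperhermitian_mat_1 hyperhermitian_scaleR [OF
        hyperhermitian_add [OF A hyperhermitian_scaleR [OF hyperhermitian_mat_1, of "-1"]]]] by simp
  have "D ?B = E ?B"
  proof (rule poly_fourth_root_unique)
    show "D ?B ^ 4 = E ?B ^ 4"
      using PQ [OF h] P(2) [OF h] Q(2) [OF h]
      by (intro poly_eqI_everywhere) (simp add: poly_power flip: D E)
    show "poly (D ?B) 0 = 1" "poly (E ?B) 0 = 1"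
      using P(2) [OF hyperhermitian_mat_1] P(3) Q(2) [OF hyperhermitian_mat_1] Q(3)
      by (simp_all flip: D E)
  qed
  then have "p (mat 1 + 1 *\<^sub>R ?B) = q (mat 1 + 1 *\<^sub>R ?B)" by (simp only: D E)
  then show ?thesis using P(2) [OF A] Q(2) [OF A] by simp
qed

text \<open>
  Existence and uniqueness together evaluate the definite description of \<^const>\<open>moore_det\<close>.
\<close>

lemma moore_det_characterization:
  "\<exists>p. real_polynomial_function p \<and> (\<forall>A :: quat^'n^'n. hyperhermitian A \<longrightarrow> moore_det A = p A) \<and>
     (\<forall>(A :: quat^'n^'n) x l. hyperhermitian A \<longrightarrow> eigensystem A x l \<longrightarrow> moore_det A = (\<Prod>i\<in>UNIV. l i))"
proof -
  obtain p where p: "real_polynomial_function p"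
    "\<And>(A :: quat^'n^'n) x l. hyperhermitian A \<Longrightarrow> eigensystem A x l \<Longrightarrow> p A = (\<Prod>i\<in>UNIV. l i)"
    using moore_polynomial_exists by metis
  define P where "P = restrict p (Collect hyperhermitian)"
  have PA: "P A = p A" if "hyperhermitian A" for A using that by (simp add: P_def)
  have P4: "det (real_matrix A) = P A ^ 4" if "hyperhermitian A" for A :: "quat^'n^'n"
    using eigensystem_exists [OF that] p(2) [OF that] PA [OF that] det_real_matrix_eigensystem [OF that]
    by metis
  have P1: "P (mat 1) = 1"
  proof -
    obtain x l where e: "eigensystem (mat 1 :: quat^'n^'n) x l"
      using eigensystem_exists [OF hyperhermitian_mat_1] by blast
    have "x i \<noteq> 0" for i
    proof
      assume "x i = 0"
      moreover have "right_mult (x i) (quat_unit 0) \<bullet> right_mult (x i) (quat_unit 0) = 1"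
        using e by (simp add: eigensystem_def del: quat_unit_simps)
      ultimately show False by (simp add: right_mult_orthonormal del: quat_unit_simps)
    qed
    moreover have "x i = l i *\<^sub>R x i" for i using e by (simp add: eigensystem_def)
    ultimately have "l i = 1" for i
      by (metis scaleR_cancel_right scaleR_one)
    then show ?thesis using PA [OF hyperhermitian_mat_1] p(2) [OF hyperhermitian_mat_1 e] by simp
  qed
  have "moore_det = P"
    unfolding moore_det_def
  proof (rule the_equality)
    show "P \<in> extensional {A. hyperhermitian A} \<and>
     (\<exists>p. real_polynomial_function p \<and> (\<forall>A. hyperhermitian A \<longrightarrow> P A = p A)) \<and>
     (\<forall>A. hyperhermitian A \<longrightarrow> det (real_matrix A) = P A ^ 4) \<and> P (mat 1) = 1"
      using p(1) PA P4 P1 by (auto simp: P_def)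
  next
    fix Q :: "quat^'n^'n \<Rightarrow> real"
    assume Q: "Q \<in> extensional {A. hyperhermitian A} \<and>
     (\<exists>p. real_polynomial_function p \<and> (\<forall>A. hyperhermitian A \<longrightarrow> Q A = p A)) \<and>
     (\<forall>A. hyperhermitian A \<longrightarrow> det (real_matrix A) = Q A ^ 4) \<and> Q (mat 1) = 1"
    then obtain q where q: "real_polynomial_function q" "\<And>A. hyperhermitian A \<Longrightarrow> Q A = q A" by blast
    have "Q A = P A" for A
    proof (cases "hyperhermitian A")
      case True
      show ?thesis
        by (rule moore_det_unique [OF q _ p(1) PA P1 _ True]) (use Q P4 in auto)
    next
      case False
      then show ?thesis using Q by (auto simp: P_def extensional_def)
    qed
    then show "Q = P" by blast
  qed
  then show ?thesis using p PA by (intro exI [of _ p]) auto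
qed

lemma moore_det_eigensystem:
  "hyperhermitian A \<Longrightarrow> eigensystem A x l \<Longrightarrow> moore_det A = (\<Prod>i\<in>UNIV. l i)"
  using moore_det_characterization by blast

lemma det_real_matrix_moore:
  "hyperhermitian A \<Longrightarrow> det (real_matrix A) = moore_det A ^ 4"
  by (metis eigensystem_exists moore_det_eigensystem det_real_matrix_eigensystem)


section \<open>Positivity, singular matrices and rank-one perturbations\<close>

definition psd :: "quat^'n^'n \<Rightarrow> bool" where
  "psd A \<longleftrightarrow> hyperhermitian A \<and> (\<forall>v. 0 \<le> v \<bullet> (A *v v))"

lemma eigensystem_inner_self:
  assumes "eigensystem A x l"
  shows "x i \<bullet> x i = 1"
proof -
  have "right_mult (x i) (quat_unit 0) \<bullet> right_mult (x i) (quat_unit 0) = 1"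
    using assms by (simp add: eigensystem_def del: quat_unit_simps)
  then show ?thesis by (simp add: right_mult_orthonormal del: quat_unit_simps)
qed

lemma psd_eigenvalue_nonneg:
  assumes "psd A" "eigensystem A x l"
  shows "0 \<le> l i"
proof -
  have "0 \<le> x i \<bullet> (A *v x i)" using assms(1) by (simp add: psd_def)
  then show ?thesis
    using assms(2) eigensystem_inner_self [OF assms(2)] by (simp add: eigensystem_def)
qed

lemma moore_det_nonneg:
  assumes "psd A"
  shows "0 \<le> moore_det A"
proof -
  have h: "hyperhermitian A" using assms by (simp add: psd_def)
  then obtain x l where e: "eigensystem A x l" using eigensystem_exists by blast
  then show ?thesis
    using moore_det_eigensystem [OF h e] psd_eigenvalue_nonneg [OF assms e] by (simp add: prod_nonneg)
qed

lemma prod_add_const_ge: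
  fixes l :: "'i \<Rightarrow> real"
  assumes "finite I" "I \<noteq> {}" "\<And>i. i \<in> I \<Longrightarrow> 0 \<le> l i" "0 \<le> c"
  shows "(\<Prod>i\<in>I. l i) + c ^ card I \<le> (\<Prod>i\<in>I. l i + c)"
  using assms(1,2,3)
proof (induction rule: finite_ne_induct)
  case (insert i I)
  have "(\<Prod>i\<in>insert i I. l i) + c ^ card (insert i I) = l i * (\<Prod>i\<in>I. l i) + c * c ^ card I"
    using insert by simp
  also have "\<dots> \<le> (l i + c) * ((\<Prod>i\<in>I. l i) + c ^ card I)"
    using insert.prems assms(4) by (simp add: algebra_simps prod_nonneg)
  also have "\<dots> \<le> (l i + c) * (\<Prod>i\<in>I. l i + c)"
    using insert assms(4) by (intro mult_left_mono) auto
  finally show ?case using insert by simp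
qed simp

text \<open>
  Adding \<open>c\<close> times the identity shifts all eigenvalues by \<open>c\<close>. The lower bound is the
  source of the strict gain in the comparison of masses.
\<close>

lemma moore_det_add_scalar:
  fixes A :: "quat^'n^'n"
  assumes "psd A" "0 \<le> c"
  shows "moore_det A + c ^ CARD('n) \<le> moore_det (A + c *\<^sub>R mat 1)"
proof -
  have h: "hyperhermitian A" using assms by (simp add: psd_def)
  then obtain x l where e: "eigensystem A x l" using eigensystem_exists by blast
  have e': "eigensystem (A + c *\<^sub>R mat 1) x (\<lambda>i. l i + c)"
    using e by (simp add: eigensystem_def matrix_vector_mult_add_mat scaleR_add_left)
  have h': "hyperhermitian (A + c *\<^sub>R mat 1)"
    by (intro hyperhermitian_add h hyperhermitian_scaleR hyperhermitian_mat_1)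
  show ?thesis
    unfolding moore_det_eigensystem [OF h e] moore_det_eigensystem [OF h' e']
    using assms(2) by (intro prod_add_const_ge psd_eigenvalue_nonneg [OF assms(1) e]) auto
qed

lemma moore_det_scaleR:
  fixes A :: "quat^'n^'n"
  assumes h: "hyperhermitian A"
  shows "moore_det (t *\<^sub>R A) = t ^ CARD('n) * moore_det A"
proof -
  obtain x l where e: "eigensystem A x l" using eigensystem_exists [OF h] by blast
  have e': "eigensystem (t *\<^sub>R A) x (\<lambda>i. t * l i)"
    using e matrix_vector_mult_add_mat [of 0 t A] by (simp add: eigensystem_def)
  show ?thesis
    unfolding moore_det_eigensystem [OF h e] moore_det_eigensystem [OF hyperhermitian_scaleR [OF h] e']
    by (simp add: prod.distrib)
qed

text \<open>
  A kernel vector of \<open>A\<close> is a kernel vector of the real matrix, so the fourth power of the Moore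
  determinant vanishes.
\<close>

lemma moore_det_singular:
  fixes A :: "quat^'n^'n"
  assumes h: "hyperhermitian A" and x: "A *v x = 0" "x \<noteq> 0"
  shows "moore_det A = 0"
proof -
  define X :: "real^('n \<times> 4)" where "X = (\<chi> r. qaxis r \<bullet> x)"
  have "X \<noteq> 0"
  proof
    assume "X = 0"
    then have "qaxis r \<bullet> x = 0" for r by (metis X_def vec_lambda_beta zero_index)
    then have "x \<bullet> x = 0" using qaxis_parseval [of x x] by simp
    with x show False by simp
  qed
  moreover have "real_matrix A *v X = 0"
  proof -
    have "(real_matrix A *v X) $ r = 0" for r
    proof -
      have "(real_matrix A *v X) $ r = (\<Sum>s\<in>UNIV. (qaxis s \<bullet> (A *v qaxis r)) * (qaxis s \<bullet> x))"
        using hyperhermitian_self_adjoint [OF h, of "qaxis r"]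
        by (simp add: matrix_vector_mult_def [of "real_matrix A"] real_matrix_nth X_def inner_commute)
      also have "\<dots> = 0"
        by (simp add: qaxis_parseval hyperhermitian_self_adjoint [OF h] x)
      finally show ?thesis .
    qed
    then show ?thesis by (simp add: vec_eq_iff)
  qed
  ultimately have "det (real_matrix A) = 0"
    by (metis invertible_det_nz invertible_def matrix_left_invertible_ker)
  then show ?thesis using det_real_matrix_moore [OF h] by simp
qed

text \<open>
  Affine in each variable separately means a combination of square-free monomials. The coefficients
  \<open>p\<close> are left unspecified; later they are determined by evaluation at indicator functions.
\<close>

lemma multiaffine_expansion:
  fixes f :: "('k \<Rightarrow> real) \<Rightarrow> real"
  assumes "finite S" and "\<And>k \<theta>. k \<in> S \<Longrightarrow> \<exists>a b. \<forall>t. f (\<theta>(k := t)) = a + b * t"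
  shows "\<exists>p. \<forall>\<theta>. (\<forall>k. k \<notin> S \<longrightarrow> \<theta> k = 0) \<longrightarrow> f \<theta> = (\<Sum>T\<in>Pow S. p T * (\<Prod>k\<in>T. \<theta> k))"
  using assms
proof (induction S arbitrary: f rule: finite_induct)
  case empty
  show ?case
  proof (intro exI allI impI)
    fix \<theta> :: "'k \<Rightarrow> real" assume "\<forall>k. k \<notin> {} \<longrightarrow> \<theta> k = 0"
    then have "\<theta> = (\<lambda>_. 0)" by auto
    then show "f \<theta> = (\<Sum>T\<in>Pow {}. f (\<lambda>_. 0) * (\<Prod>k\<in>T. \<theta> k))" by simp
  qed
next
  case (insert k S)
  define f0 where "f0 \<theta> = f (\<theta>(k := 0))" for \<theta>
  define f1 where "f1 \<theta> = f (\<theta>(k := 1)) - f (\<theta>(k := 0))" for \<theta>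
  have f: "f \<theta> = f0 \<theta> + \<theta> k * f1 \<theta>" for \<theta>
  proof -
    obtain a b where ab: "\<And>t. f (\<theta>(k := t)) = a + b * t" using insert.prems [of k \<theta>] by blast
    show ?thesis using ab [of 0] ab [of 1] ab [of "\<theta> k"] by (simp add: f0_def f1_def)
  qed
  have A: "\<exists>a b. \<forall>t. f (\<theta>(j := t, k := c)) = a + b * t" if "j \<in> S" for j \<theta> c
  proof -
    have "\<theta>(j := t, k := c) = (\<theta>(k := c))(j := t)" for t
      using insert.hyps that by (auto simp: fun_upd_twist)
    then show ?thesis using insert.prems [of j "\<theta>(k := c)"] that by (simp only: insertI2)
  qed
  have "\<exists>a b. \<forall>t. f0 (\<theta>(j := t)) = a + b * t" if "j \<in> S" for j \<theta>
    using A [OF that] by (simp add: f0_def)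
  from insert.IH [OF this] obtain p0 where
    p0: "\<And>\<theta>. (\<forall>k. k \<notin> S \<longrightarrow> \<theta> k = 0) \<Longrightarrow> f0 \<theta> = (\<Sum>T\<in>Pow S. p0 T * (\<Prod>k\<in>T. \<theta> k))" by blast
  have "\<exists>a b. \<forall>t. f1 (\<theta>(j := t)) = a + b * t" if j: "j \<in> S" for j \<theta>
  proof -
    obtain a b c d where "\<And>t. f (\<theta>(j := t, k := 0)) = a + b * t" "\<And>t. f (\<theta>(j := t, k := 1)) = c + d * t"
      using A [OF j] by metis
    then have "\<forall>t. f1 (\<theta>(j := t)) = (c - a) + (d - b) * t" by (simp add: f1_def algebra_simps)
    then show ?thesis by blast
  qed
  from insert.IH [OF this] obtain p1 where
    p1: "\<And>\<theta>. (\<forall>k. k \<notin> S \<longrightarrow> \<theta> k = 0) \<Longrightarrow> f1 \<theta> = (\<Sum>T\<in>Pow S. p1 T * (\<Prod>k\<in>T. \<theta> k))" by blast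
  define p where "p T = (if k \<in> T then p1 (T - {k}) else p0 T)" for T
  show ?case
  proof (intro exI [of _ p] allI impI)
    fix \<theta> :: "'k \<Rightarrow> real" assume \<theta>: "\<forall>j. j \<notin> insert k S \<longrightarrow> \<theta> j = 0"
    let ?z = "\<theta>(k := 0)"
    have z: "\<forall>j. j \<notin> S \<longrightarrow> ?z j = 0" using \<theta> by simp
    have pr: "(\<Prod>j\<in>T. ?z j) = (\<Prod>j\<in>T. \<theta> j)" if "T \<in> Pow S" for T
      using that insert.hyps by (intro prod.cong) auto
    have "f0 \<theta> = f0 ?z" "f1 \<theta> = f1 ?z" by (simp_all add: f0_def f1_def)
    then have "f \<theta> = (\<Sum>T\<in>Pow S. p0 T * (\<Prod>k\<in>T. \<theta> k)) + \<theta> k * (\<Sum>T\<in>Pow S. p1 T * (\<Prod>k\<in>T. \<theta> k))"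
      using f [of \<theta>] p0 [OF z] p1 [OF z] pr by simp
    also have "\<dots> = (\<Sum>T\<in>Pow S. p T * (\<Prod>k\<in>T. \<theta> k)) + (\<Sum>T\<in>insert k ` Pow S. p T * (\<Prod>k\<in>T. \<theta> k))"
    proof (intro arg_cong2 [where f = "(+)"])
      show "(\<Sum>T\<in>Pow S. p0 T * (\<Prod>k\<in>T. \<theta> k)) = (\<Sum>T\<in>Pow S. p T * (\<Prod>k\<in>T. \<theta> k))"
        using insert.hyps by (intro sum.cong) (auto simp: p_def)
      have inj: "inj_on (insert k) (Pow S)"
        using insert.hyps by (auto simp: inj_on_def)
      have "\<theta> k * (p1 T * (\<Prod>k\<in>T. \<theta> k)) = p (insert k T) * (\<Prod>k\<in>insert k T. \<theta> k)" if "T \<in> Pow S" for T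
      proof -
        have "k \<notin> T" "finite T" using that insert.hyps finite_subset by auto
        then show ?thesis by (simp add: p_def)
      qed
      then show "\<theta> k * (\<Sum>T\<in>Pow S. p1 T * (\<Prod>k\<in>T. \<theta> k)) = (\<Sum>T\<in>insert k ` Pow S. p T * (\<Prod>k\<in>T. \<theta> k))"
        by (simp add: sum.reindex [OF inj] sum_distrib_left)
    qed
    also have "\<dots> = (\<Sum>T\<in>Pow (insert k S). p T * (\<Prod>k\<in>T. \<theta> k))"
      unfolding Pow_insert using insert.hyps by (subst sum.union_disjoint) auto
    finally show "f \<theta> = (\<Sum>T\<in>Pow (insert k S). p T * (\<Prod>k\<in>T. \<theta> k))" .
  qed
qed

definition outer :: "real^'m \<Rightarrow> real^'m^'m" where
  "outer w = (\<chi> r s. w $ r * w $ s)"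

text \<open>
  An orthogonal matrix that rotates \<open>w\<close> to a multiple of a coordinate vector turns the perturbation
  into a change of a single row, and the determinant is linear in that row.
\<close>

lemma det_add_rank_one_affine:
  fixes B :: "real^'m^'m"
  shows "\<exists>a b. \<forall>t. det (B + t *\<^sub>R outer w) = a + b * t"
proof -
  obtain k :: 'm where True by blast
  have "norm w = norm (norm w *\<^sub>R axis k (1::real))" by simp
  then obtain F :: "real^'m \<Rightarrow> real^'m" where F: "orthogonal_transformation F" "F w = norm w *\<^sub>R axis k 1"
    by (rule orthogonal_transformation_exists)
  define Q where "Q = matrix F"
  have Qw: "Q *v w = norm w *\<^sub>R axis k 1"
    using F by (simp add: Q_def matrix_works orthogonal_transformation_linear)
  have dQ: "det Q \<noteq> 0"
    using F(1) det_orthogonal_matrix [of Q] orthogonal_transformation_matrix [of F]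
    by (auto simp: Q_def)
  have "(Q ** (B + t *\<^sub>R outer w)) = (\<chi> i. if i = k then (Q ** B) $ k + (t * norm w) *s w else (Q ** B) $ i)" for t
  proof -
    have "(Q ** outer w) $ i $ j = (Q *v w) $ i * w $ j" for i j
      by (simp add: matrix_matrix_mult_def matrix_vector_mult_def outer_def sum_distrib_right mult.assoc)
    moreover have "(Q ** (B + t *\<^sub>R outer w)) $ i $ j = (Q ** B) $ i $ j + t * (Q ** outer w) $ i $ j" for i j
      by (simp add: matrix_matrix_mult_def distrib_left sum.distrib sum_distrib_left mult_ac)
    ultimately show ?thesis
      by (auto simp: vec_eq_iff Qw axis_def)
  qed
  moreover have "(\<chi> i. if i = k then (Q ** B) $ k else (Q ** B) $ i) = Q ** B"
    by (simp add: vec_eq_iff)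
  ultimately have "det Q * det (B + t *\<^sub>R outer w) = det (Q ** B) +
      (t * norm w) * det (\<chi> i. if i = k then w else (Q ** B) $ i)" for t
    by (simp add: det_row_add det_row_mul flip: det_mul)
  then have "det (B + t *\<^sub>R outer w) = det (Q ** B) / det Q +
      (norm w * det (\<chi> i. if i = k then w else (Q ** B) $ i) / det Q) * t" for t
    using dQ by (simp add: field_simps)
  then show ?thesis by blast
qed

definition rank1 :: "quat^'n \<Rightarrow> quat^'n^'n" where
  "rank1 \<xi> = (\<chi> i j. \<xi> $ i * quat_cnj (\<xi> $ j))"

lemma hyperhermitian_rank1: "hyperhermitian (rank1 \<xi>)"
  by (simp add: hyperhermitian_def rank1_def quat_cnj_mult)

text \<open>
  As a real operator \<open>\<xi> \<xi>\<^sup>*\<close> is the sum of the four rank-one operators given by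
  \<open>\<xi>\<close> times the units, so its quadratic form is nonnegative and its kernel is the orthogonal
  complement of the right line through \<open>\<xi>\<close>.
\<close>

lemma rank1_mult: "rank1 \<xi> *v y = (\<Sum>c\<in>UNIV. (right_mult \<xi> (quat_unit c) \<bullet> y) *\<^sub>R right_mult \<xi> (quat_unit c))"
proof -
  define q where "q = (\<Sum>j\<in>UNIV. quat_cnj (\<xi> $ j) * y $ j)"
  have "rank1 \<xi> *v y = right_mult \<xi> q"
    by (simp add: vec_eq_iff rank1_def matrix_vector_mult_def q_def sum_distrib_left mult.assoc)
  moreover have "quat_unit c \<bullet> q = right_mult \<xi> (quat_unit c) \<bullet> y" for c
    by (simp add: q_def inner_sum_right inner_vec_def quat_inner_mult_left del: quat_unit_simps)
  ultimately show ?thesis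
    by (simp add: right_mult_units [of \<xi> q] del: quat_unit_simps)
qed

text \<open>
  The real matrix changes by four rank-one terms with the same factor \<open>t\<close>, hence its determinant is
  a polynomial in \<open>t\<close> of degree at most 4. That determinant is the fourth power of the Moore
  determinant, which is itself a polynomial in \<open>t\<close> and so has degree at most 1.
\<close>

lemma moore_det_rank1_affine:
  fixes A :: "quat^'n^'n"
  assumes h: "hyperhermitian A"
  shows "\<exists>a b. \<forall>t. moore_det (A + t *\<^sub>R rank1 \<xi>) = a + b * t"
proof -
  define w :: "4 \<Rightarrow> real^('n \<times> 4)" where "w c = (\<chi> r. qaxis r \<bullet> right_mult \<xi> (quat_unit c))" for c
  have h': "hyperhermitian (A + t *\<^sub>R rank1 \<xi>)" for t
    by (intro hyperhermitian_add h hyperhermitian_scaleR hyperhermitian_rank1)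
  have rm: "real_matrix (A + t *\<^sub>R rank1 \<xi>) = real_matrix A + (\<Sum>c\<in>UNIV. t *\<^sub>R outer (w c))" for t
  proof -
    have "real_matrix (A + t *\<^sub>R rank1 \<xi>) $ r $ s = (real_matrix A + (\<Sum>c\<in>UNIV. t *\<^sub>R outer (w c))) $ r $ s" for r s
      by (simp add: real_matrix_nth matrix_vector_mult_add_mat rank1_mult inner_add_right inner_sum_right
          outer_def w_def sum_distrib_left mult_ac inner_commute)
    then show ?thesis by (simp add: vec_eq_iff)
  qed
  define f where "f \<theta> = det (real_matrix A + (\<Sum>c\<in>UNIV. \<theta> c *\<^sub>R outer (w c)))" for \<theta> :: "4 \<Rightarrow> real"
  have "\<exists>a b. \<forall>t. f (\<theta>(c := t)) = a + b * t" for c \<theta>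
  proof -
    have "f (\<theta>(c := t)) = det ((real_matrix A + (\<Sum>d\<in>UNIV - {c}. \<theta> d *\<^sub>R outer (w d))) + t *\<^sub>R outer (w c))" for t
      by (simp add: f_def sum.remove [of UNIV c] algebra_simps)
    moreover obtain a b where "\<And>t. det ((real_matrix A + (\<Sum>d\<in>UNIV - {c}. \<theta> d *\<^sub>R outer (w d))) + t *\<^sub>R outer (w c)) = a + b * t"
      using det_add_rank_one_affine by blast
    ultimately show ?thesis
      by (intro exI [of _ a] exI [of _ b]) (simp only: simp_thms)
  qed
  then obtain p where p: "\<And>\<theta>. f \<theta> = (\<Sum>T\<in>Pow UNIV. p T * (\<Prod>k\<in>T. \<theta> k))"
    using multiaffine_expansion [of UNIV f, OF finite] by (metis UNIV_I)
  obtain P where P: "real_polynomial_function P" "\<And>A :: quat^'n^'n. hyperhermitian A \<Longrightarrow> moore_det A = P A"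
    using moore_det_characterization by metis
  have pf: "polynomial_function (\<lambda>B :: quat^'n^'n. A + B)"
    by (intro polynomial_function_add polynomial_function_const polynomial_function_bounded_linear bounded_linear_ident)
  obtain D where D: "\<And>a t. P (A + t *\<^sub>R a) = poly (D a) t"
    using real_polynomial_along_rays [OF real_polynomial_function_compose [OF pf P(1)]] unfolding o_def by metis
  define g where "g = D (rank1 \<xi>)"
  have m: "moore_det (A + t *\<^sub>R rank1 \<xi>) = poly g t" for t
    using P(2) [OF h'] D by (simp add: g_def)
  have "g ^ 4 = (\<Sum>T\<in>Pow (UNIV :: 4 set). monom (p T) (card T))"
  proof (rule poly_eqI_everywhere)
    fix t
    have "poly (g ^ 4) t = f (\<lambda>_. t)"
      using det_real_matrix_moore [OF h'] by (simp add: poly_power f_def rm flip: m)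
    then show "poly (g ^ 4) t = poly (\<Sum>T\<in>Pow (UNIV :: 4 set). monom (p T) (card T)) t"
      by (simp add: p poly_sum poly_monom)
  qed
  moreover have "degree (\<Sum>T\<in>Pow (UNIV :: 4 set). monom (p T) (card T)) \<le> 4"
  proof (rule degree_sum_le)
    fix T :: "4 set"
    have "card T \<le> 4" using card_mono [of UNIV T] by simp
    then show "degree (monom (p T) (card T)) \<le> 4"
      using degree_monom_le order_trans by blast
  qed simp
  ultimately have "degree (g ^ 4) \<le> 4" by simp
  then have "degree g \<le> 1"
    by (cases "g = 0") (auto simp: degree_power_eq)
  then have "poly g t = coeff g 0 + coeff g 1 * t" for t
    by (simp add: poly_altdef_le [of g 1])
  then show ?thesis using m by auto
qed

section \<open>Functions with two continuous derivatives\<close>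

text \<open>
  The derivatives are recorded as the gradient and the Hessian operator, given by plain vector-valued functions;
  this makes algebraic operations on them explicit. The symmetry of the second derivative is part of the data,
  since it is evident for all functions that are constructed below.
\<close>

definition C2_data :: "('a::euclidean_space \<Rightarrow> real) \<Rightarrow> ('a \<Rightarrow> 'a) \<Rightarrow> ('a \<Rightarrow> 'a \<Rightarrow> 'a) \<Rightarrow> bool" where
  "C2_data f G H \<longleftrightarrow> (\<forall>x. (f has_derivative (\<lambda>h. G x \<bullet> h)) (at x)) \<and>
     (\<forall>x. (G has_derivative H x) (at x)) \<and>
     (\<forall>h. continuous_on UNIV (\<lambda>x. H x h)) \<and> (\<forall>x h k. H x h \<bullet> k = h \<bullet> H x k)"

lemma C2_data_continuous:
  assumes "C2_data f G H"
  shows "continuous_on A f" "continuous_on A G" "continuous_on A (\<lambda>x. H x h)" "linear (H x)"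
  using assms unfolding C2_data_def
  by (blast intro: continuous_at_imp_continuous_on has_derivative_continuous continuous_on_subset has_derivative_linear)+

text \<open>
  Derivatives are local, so the supports of gradient and Hessian are controlled by that of the function.
\<close>

lemma C2_data_locally_zero:
  assumes C: "C2_data f G H" and S: "open S" "\<And>x. x \<in> S \<Longrightarrow> f x = 0" and x: "x \<in> S"
  shows "G x = 0" "H x h = 0"
proof -
  have G0: "G y = 0" if "y \<in> S" for y
  proof -
    have "(f has_derivative (\<lambda>h. 0)) (at y)"
      by (rule has_derivative_transform_within_open [OF has_derivative_const [of 0] S(1) that]) (simp add: S)
    moreover have "(f has_derivative (\<lambda>h. G y \<bullet> h)) (at y)" using C by (simp add: C2_data_def)
    ultimately have "(\<lambda>h. G y \<bullet> h) = (\<lambda>h. 0)" by (rule has_derivative_unique [rotated])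
    then show ?thesis by (metis inner_eq_zero_iff)
  qed
  then show "G x = 0" using x by blast
  have "(G has_derivative (\<lambda>h. 0)) (at x)"
    by (rule has_derivative_transform_within_open [OF has_derivative_const [of 0] S(1) x]) (simp add: G0)
  moreover have "(G has_derivative H x) (at x)" using C by (simp add: C2_data_def)
  ultimately have "H x = (\<lambda>h. 0)" by (rule has_derivative_unique [rotated])
  then show "H x h = 0" by simp
qed

lemma integrable_compact_support:
  fixes f :: "'a::euclidean_space \<Rightarrow> 'b::{banach, second_countable_topology}"
  assumes "continuous_on UNIV f" "\<And>x. x \<notin> cball 0 R \<Longrightarrow> f x = 0"
  shows "integrable lborel f"
proof -
  have "integrable lborel (\<lambda>x. indicator (cball 0 R) x *\<^sub>R f x)"
    by (rule borel_integrable_compact) (auto intro: continuous_on_subset assms)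
  also have "(\<lambda>x. indicator (cball 0 R) x *\<^sub>R f x) = f"
    using assms(2) by (auto simp: indicator_def fun_eq_iff)
  finally show ?thesis .
qed

lemma integral_lborel_translate:
  fixes f :: "'a::euclidean_space \<Rightarrow> 'b::{banach, second_countable_topology}"
  assumes "f \<in> borel_measurable borel"
  shows "(\<integral>x. f (a + x) \<partial>lborel) = (\<integral>x. f x \<partial>lborel)"
proof -
  have "(\<integral>x. f x \<partial>lborel) = (\<integral>x. f x \<partial>(distr lborel borel ((+) a)))"
    by (simp add: lborel_distr_plus)
  also have "\<dots> = (\<integral>x. f (a + x) \<partial>lborel)"
    by (rule integral_distr) (use assms in auto)
  finally show ?thesis by simp
qed

lemma integral_lborel_reflect:
  fixes f :: "'a::euclidean_space \<Rightarrow> 'b::{banach, second_countable_topology}"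
  assumes [measurable]: "f \<in> borel_measurable borel"
  shows "(\<integral>x. f (a - x) \<partial>lborel) = (\<integral>x. f x \<partial>lborel)"
proof -
  have "lborel = distr lborel borel (\<lambda>x. a + (- 1) *\<^sub>R (x::'a))"
    using lborel_affine [of "-1" a] by (simp add: density_1)
  then have "(\<integral>x. f x \<partial>lborel) = (\<integral>x. f x \<partial>(distr lborel borel (\<lambda>x. a + (- 1) *\<^sub>R x)))"
    by simp
  also have "\<dots> = (\<integral>x. f (a - x) \<partial>lborel)"
    by (subst integral_distr) auto
  finally show ?thesis by simp
qed

text \<open>
  By translation invariance every difference quotient of \<open>F\<close> in the direction \<open>h\<close> has
  integral zero, and the difference quotients converge dominatedly to the derivative.
\<close>

lemma integral_directional_derivative_zero:
  fixes F :: "'a::euclidean_space \<Rightarrow> real"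
  assumes D: "\<And>x. (F has_derivative F' x) (at x)" and c: "continuous_on UNIV (\<lambda>x. F' x h)"
    and z: "\<And>x. x \<notin> cball 0 R \<Longrightarrow> F x = 0"
  shows "(\<integral>x. F' x h \<partial>lborel) = 0"
proof -
  define t where "t N = inverse (real (Suc N))" for N
  have t: "0 < t N" "t N \<le> 1" for N by (auto simp: t_def divide_simps)
  have cF: "continuous_on UNIV F"
    using D by (blast intro: continuous_at_imp_continuous_on has_derivative_continuous)
  have [measurable]: "F \<in> borel_measurable borel" by (rule borel_measurable_continuous_onI [OF cF])
  let ?D = "\<lambda>N x. (F (x + t N *\<^sub>R h) - F x) / t N"
  obtain M where M: "\<And>x. x \<in> cball 0 (R + 2 * norm h) \<Longrightarrow> \<bar>F' x h\<bar> \<le> M"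
  proof -
    have "compact ((\<lambda>x. F' x h) ` cball 0 (R + 2 * norm h))"
      by (intro compact_continuous_image continuous_on_subset [OF c]) auto
    then show ?thesis using that compact_imp_bounded bounded_iff by (metis imageI real_norm_def)
  qed
  have der: "((\<lambda>s. F (x + s *\<^sub>R h)) has_real_derivative F' (x + s *\<^sub>R h) h) (at s)" for x s
  proof -
    have "((\<lambda>s. F (x + s *\<^sub>R h)) has_derivative (\<lambda>u. F' (x + s *\<^sub>R h) (u *\<^sub>R h))) (at s)"
      by (rule has_derivative_compose [OF _ D]) (auto intro!: derivative_eq_intros)
    moreover have "F' (x + s *\<^sub>R h) (u *\<^sub>R h) = F' (x + s *\<^sub>R h) h * u" for u
      using has_derivative_linear [OF D, of "x + s *\<^sub>R h"] by (simp add: linear_scale)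
    ultimately show ?thesis by (simp add: has_field_derivative_def)
  qed
  have mvt: "\<exists>s\<in>{0<..<t N}. ?D N x = F' (x + s *\<^sub>R h) h" for N x
  proof -
    obtain s where "0 < s" "s < t N"
      "F (x + t N *\<^sub>R h) - F (x + 0 *\<^sub>R h) = (t N - 0) * (F' (x + s *\<^sub>R h) h)"
      using MVT2 [of 0 "t N" "\<lambda>s. F (x + s *\<^sub>R h)" "\<lambda>s. F' (x + s *\<^sub>R h) h", OF t(1) der] by blast
    then show ?thesis using t(1) [of N] by (intro bexI [of _ s]) (auto simp: field_simps)
  qed
  have "(\<lambda>N. \<integral>x. ?D N x \<partial>lborel) \<longlonglongrightarrow> (\<integral>x. F' x h \<partial>lborel)"
  proof (rule integral_dominated_convergence)
    show "(\<lambda>x. F' x h) \<in> borel_measurable lborel"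
      using borel_measurable_continuous_onI [OF c] by simp
    show "?D N \<in> borel_measurable lborel" for N by measurable
    show "integrable lborel (\<lambda>x. indicator (cball 0 (R + norm h)) x *\<^sub>R M)"
      by (rule borel_integrable_compact) auto
    show "AE x in lborel. (\<lambda>N. ?D N x) \<longlonglongrightarrow> F' x h"
    proof (rule AE_I2)
      fix x
      have t0: "t \<longlonglongrightarrow> 0" unfolding t_def by (rule LIMSEQ_inverse_real_of_nat)
      have "((\<lambda>s. F (x + s *\<^sub>R h)) has_real_derivative F' x h) (at 0)"
        using der [of x 0] by simp
      then have "((\<lambda>s. (F (x + s *\<^sub>R h) - F x) / s) \<longlongrightarrow> F' x h) (at 0)"
        by (simp add: DERIV_def)
      then show "(\<lambda>N. ?D N x) \<longlonglongrightarrow> F' x h"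
        by (rule filterlim_compose) (use t0 t(1) in \<open>simp add: filterlim_at less_imp_neq [THEN not_sym]\<close>)
    qed
    show "AE x in lborel. norm (?D N x) \<le> indicator (cball 0 (R + norm h)) x *\<^sub>R M" for N
    proof (rule AE_I2)
      fix x
      show "norm (?D N x) \<le> indicator (cball 0 (R + norm h)) x *\<^sub>R M"
      proof (cases "x \<in> cball 0 (R + norm h)")
        case True
        obtain s where s: "s \<in> {0<..<t N}" "?D N x = F' (x + s *\<^sub>R h) h" using mvt by blast
        have "norm (s *\<^sub>R h) \<le> norm h"
          using s(1) t [of N] by (simp add: mult_left_le_one_le)
        then have "x + s *\<^sub>R h \<in> cball 0 (R + 2 * norm h)"
          using True norm_triangle_ineq [of x "s *\<^sub>R h"] by simp
        then show ?thesis using M s(2) True by simp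
      next
        case False
        have "norm (t N *\<^sub>R h) \<le> norm h" using t [of N] by (simp add: mult_left_le_one_le)
        then have "R < norm (x + t N *\<^sub>R h)"
          using False norm_triangle_ineq4 [of "x + t N *\<^sub>R h" "t N *\<^sub>R h"] by simp
        moreover have "R < norm x" using False by (simp add: not_le) (smt (verit) norm_ge_zero)
        ultimately show ?thesis using z False by simp
      qed
    qed
  qed
  moreover have "(\<integral>x. ?D N x \<partial>lborel) = 0" for N
  proof -
    have i: "integrable lborel F" by (rule integrable_compact_support [OF cF z])
    have "integrable lborel (\<lambda>x. F (x + t N *\<^sub>R h))"
    proof (rule integrable_compact_support)
      show "continuous_on UNIV (\<lambda>x. F (x + t N *\<^sub>R h))"
        by (intro continuous_on_compose2 [OF cF] continuous_intros) auto
      show "F (x + t N *\<^sub>R h) = 0" if "x \<notin> cball 0 (R + norm (t N *\<^sub>R h))" for x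
        using that norm_triangle_ineq4 [of "x + t N *\<^sub>R h" "t N *\<^sub>R h"] by (intro z) simp
    qed
    moreover have "(\<integral>x. F (x + t N *\<^sub>R h) \<partial>lborel) = (\<integral>x. F x \<partial>lborel)"
      using integral_lborel_translate [of F "t N *\<^sub>R h"] by (simp add: add.commute)
    ultimately show ?thesis using i by simp
  qed
  ultimately have "(\<lambda>N. 0) \<longlonglongrightarrow> (\<integral>x. F' x h \<partial>lborel)" by (simp only:)
  then show ?thesis by (simp add: LIMSEQ_const_iff)
qed

text \<open>
  Integration by parts twice: the Fourier transform of the second derivative is
  \<open>- \<xi> \<xi>\<^sup>T\<close> times that of the function. The phase \<open>a\<close> covers sines as
  well.
\<close>

lemma integral_hessian_cos:
  fixes f :: "'a::euclidean_space \<Rightarrow> real"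
  assumes C: "C2_data f G H" and z: "\<And>x. x \<notin> cball 0 R \<Longrightarrow> f x = 0"
  shows "(\<integral>y. (H y h \<bullet> k) * cos (\<xi> \<bullet> y + a) \<partial>lborel) =
    - ((\<xi> \<bullet> h) * (\<xi> \<bullet> k)) * (\<integral>y. f y * cos (\<xi> \<bullet> y + a) \<partial>lborel)"
proof -
  have zG: "G x = 0" "H x h = 0" if "x \<notin> cball 0 R" for x h
    using C2_data_locally_zero [OF C, of "- cball 0 R"] z that by auto
  note cs = C2_data_continuous [OF C]
  have d: "(f has_derivative (\<lambda>h. G x \<bullet> h)) (at x)" "(G has_derivative H x) (at x)" for x
    using C by (auto simp: C2_data_def)
  have 1: "(\<integral>x. (H x h \<bullet> k) * cos (\<xi> \<bullet> x + a) - (G x \<bullet> k) * ((\<xi> \<bullet> h) * sin (\<xi> \<bullet> x + a)) \<partial>lborel) = 0"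
  proof (rule integral_directional_derivative_zero [where h = h and
        F' = "\<lambda>x h. (H x h \<bullet> k) * cos (\<xi> \<bullet> x + a) - (G x \<bullet> k) * ((\<xi> \<bullet> h) * sin (\<xi> \<bullet> x + a))"])
    show "((\<lambda>x. (G x \<bullet> k) * cos (\<xi> \<bullet> x + a)) has_derivative
        (\<lambda>h. (H x h \<bullet> k) * cos (\<xi> \<bullet> x + a) - (G x \<bullet> k) * ((\<xi> \<bullet> h) * sin (\<xi> \<bullet> x + a)))) (at x)" for x
      by (auto intro!: derivative_eq_intros d simp: algebra_simps)
    show "continuous_on UNIV (\<lambda>x. (H x h \<bullet> k) * cos (\<xi> \<bullet> x + a) - (G x \<bullet> k) * ((\<xi> \<bullet> h) * sin (\<xi> \<bullet> x + a)))"
      by (intro continuous_intros cs)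
    show "(G x \<bullet> k) * cos (\<xi> \<bullet> x + a) = 0" if "x \<notin> cball 0 R" for x using zG [OF that] by simp
  qed
  have 2: "(\<integral>x. (G x \<bullet> k) * sin (\<xi> \<bullet> x + a) + (\<xi> \<bullet> k) * (f x * cos (\<xi> \<bullet> x + a)) \<partial>lborel) = 0"
  proof (rule integral_directional_derivative_zero [where h = k and
        F' = "\<lambda>x k. (G x \<bullet> k) * sin (\<xi> \<bullet> x + a) + (\<xi> \<bullet> k) * (f x * cos (\<xi> \<bullet> x + a))"])
    show "((\<lambda>x. f x * sin (\<xi> \<bullet> x + a)) has_derivative
        (\<lambda>k. (G x \<bullet> k) * sin (\<xi> \<bullet> x + a) + (\<xi> \<bullet> k) * (f x * cos (\<xi> \<bullet> x + a)))) (at x)" for x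
      by (auto intro!: derivative_eq_intros d simp: algebra_simps)
    show "continuous_on UNIV (\<lambda>x. (G x \<bullet> k) * sin (\<xi> \<bullet> x + a) + (\<xi> \<bullet> k) * (f x * cos (\<xi> \<bullet> x + a)))"
      by (intro continuous_intros cs)
    show "f x * sin (\<xi> \<bullet> x + a) = 0" if "x \<notin> cball 0 R" for x using z [OF that] by simp
  qed
  have i1: "integrable lborel (\<lambda>x. (H x h \<bullet> k) * cos (\<xi> \<bullet> x + a))"
    by (rule integrable_compact_support [where R = R]) (auto intro!: continuous_intros cs simp: zG)
  have i2: "integrable lborel (\<lambda>x. (G x \<bullet> k) * sin (\<xi> \<bullet> x + a))"
    by (rule integrable_compact_support [where R = R]) (auto intro!: continuous_intros cs simp: zG)
  have i3: "integrable lborel (\<lambda>x. f x * cos (\<xi> \<bullet> x + a))"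
    by (rule integrable_compact_support [where R = R]) (auto intro!: continuous_intros cs simp: z)
  have "(\<integral>x. (H x h \<bullet> k) * cos (\<xi> \<bullet> x + a) \<partial>lborel) = (\<xi> \<bullet> h) * (\<integral>x. (G x \<bullet> k) * sin (\<xi> \<bullet> x + a) \<partial>lborel)"
  proof -
    have "(\<integral>x. (H x h \<bullet> k) * cos (\<xi> \<bullet> x + a) \<partial>lborel) - (\<integral>x. (\<xi> \<bullet> h) * ((G x \<bullet> k) * sin (\<xi> \<bullet> x + a)) \<partial>lborel) = 0"
      using 1 i1 i2 by (subst Bochner_Integration.integral_diff [symmetric]) (auto simp: mult_ac)
    then show ?thesis by simp
  qed
  moreover have "(\<integral>x. (G x \<bullet> k) * sin (\<xi> \<bullet> x + a) \<partial>lborel) = - (\<xi> \<bullet> k) * (\<integral>x. f x * cos (\<xi> \<bullet> x + a) \<partial>lborel)"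
  proof -
    have "(\<integral>x. (G x \<bullet> k) * sin (\<xi> \<bullet> x + a) \<partial>lborel) + (\<integral>x. (\<xi> \<bullet> k) * (f x * cos (\<xi> \<bullet> x + a)) \<partial>lborel) = 0"
      using 2 i2 i3 by simp
    then show ?thesis by simp
  qed
  ultimately show ?thesis by simp
qed

section \<open>Trigonometric products over a period cube\<close>

lemma integral_exp_interval_zero:
  assumes "0 < T" and j: "j \<noteq> (0::int)"
  shows "(\<integral>t. indicator {-T..T} t *\<^sub>R exp (\<i> * of_real (pi / T * of_int j * t)) \<partial>lborel) = 0"
proof -
  define c where "c = pi / T * of_int j"
  have c0: "c \<noteq> 0" using assms by (simp add: c_def)
  define F where "F t = exp (\<i> * of_real (c * t)) / (\<i> * of_real c)" for t :: real
  have "(\<integral>t. indicator {-T..T} t *\<^sub>R exp (\<i> * of_real (c * t)) \<partial>lborel) = F T - F (- T)"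
  proof (rule integral_FTC_atLeastAtMost)
    show "(F has_vector_derivative exp (\<i> * of_real (c * t))) (at t within {-T..T})" for t
      unfolding F_def of_real_mult
      by (rule has_vector_derivative_real_field [where f = "\<lambda>z. exp (\<i> * (of_real c * z)) / (\<i> * of_real c)"])
         (use c0 in \<open>auto intro!: derivative_eq_intros simp: complex_eq_iff\<close>)
    show "continuous_on {- T..T} (\<lambda>t. exp (\<i> * of_real (c * t)))"
      by (intro continuous_intros)
  qed (use assms in simp)
  also have "\<dots> = 0"
  proof -
    have "\<i> * complex_of_real (c * T) = \<i> * of_real (c * - T) + of_int j * (2 * of_real pi * \<i>)"
      using assms by (simp add: c_def algebra_simps)
    then have "exp (\<i> * complex_of_real (c * T)) =
        exp (\<i> * of_real (c * - T)) * exp (of_int j * (2 * of_real pi * \<i>))"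
      by (simp only: exp_add)
    also have "exp (of_int j * (2 * of_real pi * \<i>)) = 1"
      using exp_integer_2pi [of "of_int j"] by (simp add: mult_ac)
    finally show ?thesis by (simp add: F_def)
  qed
  finally show ?thesis by (simp add: c_def)
qed

definition cube :: "real \<Rightarrow> 'a::euclidean_space set" where
  "cube T = cbox (- T *\<^sub>R One) (T *\<^sub>R One)"

lemma mem_cube: "x \<in> cube T \<longleftrightarrow> (\<forall>b\<in>Basis. \<bar>x \<bullet> b\<bar> \<le> T)"
  by (auto simp: cube_def mem_box abs_le_iff)

lemma compact_cube: "compact (cube T)"
  by (simp add: cube_def)

lemma cball_subset_cube: "cball 0 T \<subseteq> cube T"
  using Basis_le_norm order_trans by (fastforce simp: mem_cube)

text \<open>
  The wave \<open>cos (\<xi> \<bullet> x)\<close> is \<open>2 T\<close>-periodic in each coordinate exactly if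
  \<open>\<xi>\<close> lies in this lattice.
\<close>

definition freq :: "real \<Rightarrow> 'a::euclidean_space \<Rightarrow> bool" where
  "freq T \<xi> \<longleftrightarrow> (\<forall>b\<in>Basis. \<exists>j::int. \<xi> \<bullet> b = pi / T * of_int j)"

lemma freq_simps: "freq T 0" "freq T \<xi> \<Longrightarrow> freq T \<eta> \<Longrightarrow> freq T (\<xi> + \<eta>)"
  "freq T \<xi> \<Longrightarrow> freq T \<eta> \<Longrightarrow> freq T (\<xi> - \<eta>)"
proof -
  show "freq T 0" by (auto simp: freq_def intro: exI [of _ 0])
  assume "freq T \<xi>" "freq T \<eta>"
  then obtain j l where "\<And>b. b \<in> Basis \<Longrightarrow> \<xi> \<bullet> b = pi / T * of_int (j b)"
    "\<And>b. b \<in> Basis \<Longrightarrow> \<eta> \<bullet> b = pi / T * of_int (l b)"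
    unfolding freq_def by metis
  then have "\<And>b. b \<in> Basis \<Longrightarrow> (\<xi> + \<eta>) \<bullet> b = pi / T * of_int (j b + l b)"
    "\<And>b. b \<in> Basis \<Longrightarrow> (\<xi> - \<eta>) \<bullet> b = pi / T * of_int (j b - l b)"
    by (simp_all add: inner_add_left inner_diff_left distrib_left right_diff_distrib)
  then show "freq T (\<xi> + \<eta>)" "freq T (\<xi> - \<eta>)" unfolding freq_def by metis+
qed

lemma freq_sum: "(\<And>i. i \<in> I \<Longrightarrow> freq T (f i)) \<Longrightarrow> freq T (sum f I)"
  by (induction I rule: infinite_finite_induct) (auto simp: freq_simps)

lemma integral_exp_cube_zero:
  fixes \<zeta> :: "'a::euclidean_space"
  assumes T: "0 < T" and f: "freq T \<zeta>" and nz: "\<zeta> \<noteq> 0"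
  shows "(\<integral>x. indicator (cube T) x *\<^sub>R exp (\<i> * of_real (\<zeta> \<bullet> x)) \<partial>lborel) = 0"
proof -
  obtain j where j: "\<And>b. b \<in> Basis \<Longrightarrow> \<zeta> \<bullet> b = pi / T * of_int (j b)"
    using f unfolding freq_def by metis
  obtain b0 where b0: "b0 \<in> Basis" "\<zeta> \<bullet> b0 \<noteq> 0" using nz euclidean_all_zero_iff by blast
  let ?g = "\<lambda>b t. indicator {-T..T} t *\<^sub>R exp (\<i> * complex_of_real (pi / T * of_int (j b) * t))"
  interpret product_sigma_finite "\<lambda>b::'a. lborel :: real measure" ..
  have int: "integrable lborel (?g b)" for b
    by (rule borel_integrable_compact) (use T in \<open>auto intro!: continuous_intros\<close>)
  have eq: "indicator (cube T) (\<Sum>b\<in>Basis. f b *\<^sub>R b) *\<^sub>R exp (\<i> * of_real (\<zeta> \<bullet> (\<Sum>b\<in>Basis. f b *\<^sub>R b)))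
      = (\<Prod>b\<in>Basis. ?g b (f b))" for f :: "'a \<Rightarrow> real"
  proof -
    have "(\<Prod>b\<in>Basis. ?g b (f b)) = (\<Prod>b\<in>(Basis::'a set). of_real (indicator {-T..T} (f b))) *
        (\<Prod>b\<in>Basis. exp (\<i> * complex_of_real (\<zeta> \<bullet> b * f b)))"
      by (simp add: prod.distrib [symmetric] scaleR_conv_of_real j cong: prod.cong)
    also have "(\<Prod>b\<in>Basis. exp (\<i> * complex_of_real (\<zeta> \<bullet> b * f b))) =
        exp (\<i> * of_real (\<zeta> \<bullet> (\<Sum>b\<in>Basis. f b *\<^sub>R b)))"
      by (simp add: exp_sum [symmetric] inner_sum_right sum_distrib_left mult_ac)
    also have "(\<Prod>b\<in>(Basis::'a set). complex_of_real (indicator {-T..T} (f b))) =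
        of_real (indicator (cube T) (\<Sum>b\<in>(Basis::'a set). f b *\<^sub>R b))"
    proof (cases "\<forall>b\<in>(Basis::'a set). \<bar>f b\<bar> \<le> T")
      case True
      then show ?thesis by (auto simp: mem_cube indicator_def abs_le_iff intro!: prod.neutral)
    next
      case False
      then obtain b where b: "b \<in> (Basis::'a set)" "\<not> \<bar>f b\<bar> \<le> T" by auto
      then have "(\<Sum>b\<in>(Basis::'a set). f b *\<^sub>R b) \<notin> cube T" by (auto simp: mem_cube)
      moreover have "(\<Prod>b\<in>(Basis::'a set). complex_of_real (indicator {-T..T} (f b))) = 0"
        using b by (intro prod_zero) (auto simp: abs_le_iff intro!: bexI [of _ b])
      ultimately show ?thesis by simp
    qed
    finally show ?thesis by (simp add: scaleR_conv_of_real)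
  qed
  have "(\<integral>x. indicator (cube T) x *\<^sub>R exp (\<i> * of_real (\<zeta> \<bullet> x)) \<partial>lborel) =
      (\<integral>f. (\<Prod>b\<in>Basis. ?g b (f b)) \<partial>(\<Pi>\<^sub>M b\<in>(Basis::'a set). lborel))"
  proof (subst lborel_eq, subst integral_distr)
    have [measurable]: "cube T \<in> sets (borel :: 'a measure)" by (simp add: cube_def)
    show "(\<lambda>x. indicat_real (cube T) x *\<^sub>R exp (\<i> * of_real (\<zeta> \<bullet> x))) \<in> borel_measurable borel"
      by measurable
  qed (simp_all only: eq, measurable)
  also have "\<dots> = (\<Prod>b\<in>Basis. \<integral>t. ?g b t \<partial>lborel)"
    by (rule product_integral_prod) (use int in auto)
  also have "\<dots> = 0"
    using integral_exp_interval_zero [OF T, of "j b0"] b0 j T by (intro prod_zero) auto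
  finally show ?thesis .
qed

text \<open>
  Written with exponentials, the product is a combination of waves with frequencies
  \<open>\<Sum>\<^bsub>k\<in>J\<^esub> \<xi>\<^sub>k - \<Sum>\<^bsub>k\<in>I-J\<^esub> \<xi>\<^sub>k\<close>. If
  none of these is zero, every wave has mean zero over the period cube.
\<close>

lemma integral_prod_trig_zero:
  fixes \<xi> :: "'k \<Rightarrow> 'a::euclidean_space"
  assumes T: "0 < T" and fin: "finite I" and fr: "\<And>k. k \<in> I \<Longrightarrow> freq T (\<xi> k)"
    and nz: "\<And>J. J \<subseteq> I \<Longrightarrow> (\<Sum>k\<in>J. \<xi> k) \<noteq> (\<Sum>k\<in>I - J. \<xi> k)"
  shows "(\<integral>x. indicator (cube T) x * (\<Prod>k\<in>I. a k * cos (\<xi> k \<bullet> x) + b k * sin (\<xi> k \<bullet> x)) \<partial>lborel) = 0"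
proof -
  define z where "z k = Complex (a k) (- b k) / 2" for k
  define E where "E \<zeta> x = exp (\<i> * complex_of_real (\<zeta> \<bullet> x))" for \<zeta> x :: 'a
  have En: "E (- \<zeta>) x = cis (- (\<zeta> \<bullet> x))" and Ep: "E \<zeta> x = cis (\<zeta> \<bullet> x)" for \<zeta> x
    by (simp_all add: E_def cis_conv_exp)
  have tr: "complex_of_real (a k * cos (\<xi> k \<bullet> x) + b k * sin (\<xi> k \<bullet> x)) =
      z k * E (\<xi> k) x + cnj (z k) * E (- \<xi> k) x" for k x
    unfolding En Ep by (simp add: complex_eq_iff z_def field_simps)
  have Eprod: "(\<Prod>k\<in>J. E (f k) x) = E (\<Sum>k\<in>J. f k) x" for J :: "'k set" and f x
    by (cases "finite J") (simp_all add: E_def exp_sum [symmetric] inner_sum_left sum_distrib_left)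
  have Eadd: "E \<zeta> x * E \<eta> x = E (\<zeta> + \<eta>) x" for \<zeta> \<eta> x
    by (simp add: E_def exp_add [symmetric] inner_add_left distrib_left)
  define c where "c J = (\<Prod>k\<in>J. z k) * (\<Prod>k\<in>I - J. cnj (z k))" for J
  define \<zeta> where "\<zeta> J = (\<Sum>k\<in>J. \<xi> k) + (\<Sum>k\<in>I - J. - \<xi> k)" for J
  have expand: "complex_of_real (\<Prod>k\<in>I. a k * cos (\<xi> k \<bullet> x) + b k * sin (\<xi> k \<bullet> x)) =
      (\<Sum>J\<in>Pow I. c J * E (\<zeta> J) x)" for x
  proof -
    have "complex_of_real (\<Prod>k\<in>I. a k * cos (\<xi> k \<bullet> x) + b k * sin (\<xi> k \<bullet> x)) =
      (\<Prod>k\<in>I. z k * E (\<xi> k) x + cnj (z k) * E (- \<xi> k) x)"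
      unfolding of_real_prod tr ..
    also have "\<dots> = (\<Sum>J\<in>Pow I. (\<Prod>k\<in>J. z k * E (\<xi> k) x) * (\<Prod>k\<in>I - J. cnj (z k) * E (- \<xi> k) x))"
      by (rule prod_add [OF fin])
    also have "\<dots> = (\<Sum>J\<in>Pow I. c J * E (\<zeta> J) x)"
      by (intro sum.cong refl) (simp add: prod.distrib Eprod c_def \<zeta>_def Eadd [symmetric] mult_ac)
    finally show ?thesis .
  qed
  have int: "integrable lborel (\<lambda>x. indicator (cube T) x *\<^sub>R E \<eta> x)" for \<eta>
    unfolding E_def by (rule borel_integrable_compact) (auto intro!: continuous_intros compact_cube)
  have E0: "(\<integral>x. indicator (cube T) x *\<^sub>R E (\<zeta> J) x \<partial>lborel) = 0" if "J \<subseteq> I" for J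
    unfolding E_def
  proof (rule integral_exp_cube_zero [OF T])
    show "\<zeta> J \<noteq> 0" using nz [OF that] by (simp add: \<zeta>_def sum_negf)
    show "freq T (\<zeta> J)"
      using that fr by (auto simp: \<zeta>_def sum_negf intro!: freq_simps freq_sum)
  qed
  have "complex_of_real (\<integral>x. indicator (cube T) x * (\<Prod>k\<in>I. a k * cos (\<xi> k \<bullet> x) + b k * sin (\<xi> k \<bullet> x)) \<partial>lborel) =
      (\<integral>x. (\<Sum>J\<in>Pow I. c J * (indicator (cube T) x *\<^sub>R E (\<zeta> J) x)) \<partial>lborel)"
    unfolding integral_complex_of_real [symmetric] of_real_mult expand
    by (simp add: sum_distrib_left scaleR_conv_of_real mult_ac)
  also have "\<dots> = (\<Sum>J\<in>Pow I. c J * (\<integral>x. indicator (cube T) x *\<^sub>R E (\<zeta> J) x \<partial>lborel))"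
    by (subst Bochner_Integration.integral_sum)
       (simp_all only: integral_mult_right_zero integrable_mult_right int)
  also have "\<dots> = 0" using E0 by simp
  finally show ?thesis by simp
qed

section \<open>Mixed discriminants and resonating frequencies\<close>

text \<open>
  Moebius inversion on the lattice of subsets: the sums over all subfamilies determine \<open>p\<close>.
\<close>

lemma expansion_coefficient_zero:
  fixes p :: "'k set \<Rightarrow> real"
  assumes fin: "finite T" and z: "\<And>R. R \<subseteq> T \<Longrightarrow> (\<Sum>U\<in>Pow R. p U) = 0"
  shows "p T = 0"
  using fin z
proof (induction T rule: finite_psubset_induct)
  case (psubset T)
  have "p U = 0" if "U \<subset> T" for U
    using psubset.IH [OF that] psubset.prems that by (meson order_trans psubset_imp_subset)
  then have "(\<Sum>U\<in>Pow T - {T}. p U) = 0" by (intro sum.neutral) auto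
  moreover have "(\<Sum>U\<in>Pow T. p U) = p T + (\<Sum>U\<in>Pow T - {T}. p U)"
    using psubset.hyps by (intro sum.remove) auto
  ultimately show ?case
    using psubset.prems [of T] by simp
qed

text \<open>
  A square-free polynomial that is homogeneous of degree \<open>n\<close> contains only monomials of degree
  \<open>n\<close>. Comparing its values at multiples by 2 detects this, since \<open>2 ^ k = 2 ^ n\<close> only
  if \<open>k = n\<close>.
\<close>

lemma expansion_coefficient_degree:
  fixes p :: "'k set \<Rightarrow> real"
  assumes fin: "finite T" and h: "\<And>R. R \<subseteq> T \<Longrightarrow> (\<Sum>U\<in>Pow R. p U * 2 ^ card U) = 2 ^ n * (\<Sum>U\<in>Pow R. p U)"
    and T: "card T \<noteq> n"
  shows "p T = 0"
proof -
  have "p T * (2 ^ card T - 2 ^ n) = 0"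
    by (rule expansion_coefficient_zero [of T "\<lambda>U. p U * (2 ^ card U - 2 ^ n)"])
       (use fin h in \<open>auto simp: right_diff_distrib sum_subtractf mult.commute simp flip: sum_distrib_right\<close>)
  then show ?thesis using T by simp
qed

lemma hyperhermitian_sum: "(\<And>i. i \<in> I \<Longrightarrow> hyperhermitian (A i)) \<Longrightarrow> hyperhermitian (sum A I)"
proof (induction I rule: infinite_finite_induct)
  case (insert x F)
  then show ?case by (simp add: hyperhermitian_add)
qed (auto simp: hyperhermitian_def)

lemma matrix_vector_mult_sum: "(\<Sum>i\<in>I. c i *\<^sub>R A i) *v x = (\<Sum>i\<in>I. c i *\<^sub>R (A i *v x))"
  for A :: "'i \<Rightarrow> quat^'n^'n"
proof (induction I rule: infinite_finite_induct)
  case (insert i I)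
  then show ?case
    using matrix_vector_mult_add_mat [of "\<Sum>i\<in>I. c i *\<^sub>R A i" "c i" "A i" x] by (simp add: add.commute)
qed auto

text \<open>
  A relation \<open>\<Sum> \<plusminus> \<xi>\<^sub>k = 0\<close> among \<open>n\<close> vectors forces them
  into a proper subspace, and a nonzero vector orthogonal to all their right multiples is annihilated by every
  \<open>\<xi>\<^sub>k \<xi>\<^sub>k\<^sup>*\<close>.
\<close>

lemma moore_det_rank1_sum_singular:
  fixes \<xi> :: "'k \<Rightarrow> quat^'n"
  assumes fin: "finite I" and card: "card I = CARD('n)"
    and J: "J \<subseteq> I" "(\<Sum>k\<in>J. \<xi> k) = (\<Sum>k\<in>I - J. \<xi> k)" and R: "R \<subseteq> I"
  shows "moore_det (\<Sum>k\<in>R. rank1 (\<xi> k)) = 0"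
proof -
  have "I \<noteq> {}" using card by auto
  then obtain j where j: "j \<in> I" by blast
  define X where "X = (\<lambda>(k, c). right_mult (\<xi> k) (quat_unit c)) ` ((I - {j}) \<times> UNIV)"
  have "dim X \<le> card X"
    by (rule dim_le_card') (use fin in \<open>simp add: X_def\<close>)
  also have "card X \<le> card (I - {j}) * 4"
    unfolding X_def using fin by (intro order_trans [OF card_image_le]) (simp_all add: card_cartesian_product)
  also have "\<dots> < DIM(quat^'n)"
    using j fin card by (simp add: card_Diff_singleton)
  finally obtain x where x: "x \<noteq> 0" "\<And>v. v \<in> span X \<Longrightarrow> orthogonal x v"
    using orthogonal_to_subspace_exists by metis
  have s1: "right_mult (\<xi> k) (quat_unit c) \<in> span X" if "k \<in> I - {j}" for k c
    by (rule span_base) (use that in \<open>auto simp: X_def image_iff\<close>)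
  have xj: "right_mult (\<xi> j) (quat_unit c) \<in> span X" for c
  proof -
    let ?r = "\<lambda>v. right_mult v (quat_unit c)"
    have rs: "?r (sum \<xi> A) = (\<Sum>k\<in>A. ?r (\<xi> k))" for A
      by (rule linear_sum [OF linear_right_mult_left])
    have s: "(\<Sum>k\<in>A. ?r (\<xi> k)) \<in> span X" if "A \<subseteq> I - {j}" for A
      using that s1 by (intro span_sum) blast
    have eq: "(\<Sum>k\<in>J. ?r (\<xi> k)) = (\<Sum>k\<in>I - J. ?r (\<xi> k))"
      using J(2) by (simp flip: rs)
    show ?thesis
    proof (cases "j \<in> J")
      case True
      then have "?r (\<xi> j) = (\<Sum>k\<in>I - J. ?r (\<xi> k)) - (\<Sum>k\<in>J - {j}. ?r (\<xi> k))"
        using eq sum.remove [OF finite_subset [OF J(1) fin] True, of "\<lambda>k. ?r (\<xi> k)"]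
        by (simp add: eq_diff_eq)
      then show ?thesis using J True by (auto intro!: span_diff s)
    next
      case False
      then have "?r (\<xi> j) = (\<Sum>k\<in>J. ?r (\<xi> k)) - (\<Sum>k\<in>I - J - {j}. ?r (\<xi> k))"
        using eq sum.remove [of "I - J" j "\<lambda>k. ?r (\<xi> k)"] j fin by (simp add: eq_diff_eq)
      then show ?thesis using J False by (auto intro!: span_diff s)
    qed
  qed
  have "rank1 (\<xi> k) *v x = 0" if "k \<in> I" for k
  proof -
    have "right_mult (\<xi> k) (quat_unit c) \<bullet> x = 0" for c
      using s1 [of k c] xj [of c] x(2) that unfolding orthogonal_def by (metis Diff_iff inner_commute singletonD)
    then show ?thesis by (simp add: rank1_mult)
  qed
  then have "(\<Sum>k\<in>R. rank1 (\<xi> k)) *v x = 0"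
    using matrix_vector_mult_sum [of "\<lambda>_. 1" "\<lambda>k. rank1 (\<xi> k)" R x] R
    by (simp add: subset_iff)
  then show ?thesis
    by (intro moore_det_singular [OF _ _ x(1)]) (simp_all add: hyperhermitian_sum hyperhermitian_rank1)
qed

text \<open>
  As a function of the amplitudes the determinant is multiaffine, hence a combination of products of waves over
  sets \<open>I\<close> of frequencies. The coefficient of such a product vanishes by homogeneity unless
  \<open>I\<close> has \<open>n\<close> elements, and it vanishes by singularity of the matrices involved if the
  frequencies in \<open>I\<close> satisfy a relation \<open>\<Sum> \<plusminus> \<xi>\<^sub>k = 0\<close>. The
  remaining products have integral zero.
\<close>

lemma integral_moore_det_trig_zero:
  fixes \<xi> :: "'k \<Rightarrow> quat^'n"
  assumes T: "0 < T" and fin: "finite S" and fr: "\<And>k. k \<in> S \<Longrightarrow> freq T (\<xi> k)"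
  shows "(\<integral>x. indicator (cube T) x * moore_det (\<Sum>k\<in>S. (a k * cos (\<xi> k \<bullet> x) + b k * sin (\<xi> k \<bullet> x)) *\<^sub>R rank1 (\<xi> k)) \<partial>lborel) = 0"
proof -
  define f where "f \<theta> = moore_det (\<Sum>k\<in>S. \<theta> k *\<^sub>R rank1 (\<xi> k))" for \<theta> :: "'k \<Rightarrow> real"
  have hh: "hyperhermitian (\<Sum>k\<in>A. \<theta> k *\<^sub>R rank1 (\<xi> k))" for \<theta> A
    by (intro hyperhermitian_sum hyperhermitian_scaleR hyperhermitian_rank1)
  have "\<exists>a b. \<forall>t. f (\<theta>(k := t)) = a + b * t" if "k \<in> S" for k \<theta>
  proof -
    have "f (\<theta>(k := t)) = moore_det ((\<Sum>l\<in>S - {k}. \<theta> l *\<^sub>R rank1 (\<xi> l)) + t *\<^sub>R rank1 (\<xi> k))" for t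
      unfolding f_def by (rule arg_cong [where f = moore_det])
        (use fin that in \<open>simp add: sum.remove [of S k] add.commute\<close>)
    moreover obtain c d where "\<And>t. moore_det ((\<Sum>l\<in>S - {k}. \<theta> l *\<^sub>R rank1 (\<xi> l)) + t *\<^sub>R rank1 (\<xi> k)) = c + d * t"
      using moore_det_rank1_affine [OF hh] by blast
    ultimately show ?thesis
      by (intro exI [of _ c] exI [of _ d]) (simp only: simp_thms)
  qed
  then obtain p where p: "\<And>\<theta>. (\<And>k. k \<notin> S \<Longrightarrow> \<theta> k = 0) \<Longrightarrow> f \<theta> = (\<Sum>I\<in>Pow S. p I * (\<Prod>k\<in>I. \<theta> k))"
    using multiaffine_expansion [of S f, OF fin] by blast
  have fS: "f \<theta> = (\<Sum>I\<in>Pow S. p I * (\<Prod>k\<in>I. \<theta> k))" for \<theta>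
  proof -
    have "f \<theta> = f (\<lambda>k. if k \<in> S then \<theta> k else 0)"
      unfolding f_def by (intro arg_cong [where f = moore_det] sum.cong) auto
    also have "\<dots> = (\<Sum>I\<in>Pow S. p I * (\<Prod>k\<in>I. if k \<in> S then \<theta> k else 0))"
      by (rule p) simp
    also have "\<dots> = (\<Sum>I\<in>Pow S. p I * (\<Prod>k\<in>I. \<theta> k))"
      by (intro sum.cong arg_cong2 [where f = "(*)"] prod.cong refl) auto
    finally show ?thesis .
  qed
  have ind: "f (\<lambda>k. if k \<in> R then c else 0) = (\<Sum>I\<in>Pow R. p I * c ^ card I)" if R: "R \<subseteq> S" for R c
  proof -
    have "(\<Sum>I\<in>Pow S. p I * (\<Prod>k\<in>I. if k \<in> R then c else 0)) = (\<Sum>I\<in>Pow R. p I * c ^ card I)"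
    proof (rule sum.mono_neutral_cong_right)
      show "\<forall>I\<in>Pow S - Pow R. p I * (\<Prod>k\<in>I. if k \<in> R then c else 0) = 0"
      proof
        fix I assume "I \<in> Pow S - Pow R"
        then obtain i where "i \<in> I" "i \<notin> R" "finite I" using fin finite_subset by blast
        then have "(\<Prod>k\<in>I. if k \<in> R then c else 0) = 0" by (intro prod_zero) auto
        then show "p I * (\<Prod>k\<in>I. if k \<in> R then c else 0) = 0" by simp
      qed
      show "p I * (\<Prod>k\<in>I. if k \<in> R then c else 0) = p I * c ^ card I" if "I \<in> Pow R" for I
      proof -
        have "(\<Prod>k\<in>I. if k \<in> R then c else 0) = (\<Prod>k\<in>I. c)" using that by (intro prod.cong) auto
        then show ?thesis by simp
      qed
    qed (use R fin in auto)
    then show ?thesis by (simp only: fS)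
  qed
  have fR: "(\<Sum>I\<in>Pow R. p I) = moore_det (\<Sum>k\<in>R. rank1 (\<xi> k))" if "R \<subseteq> S" for R
  proof -
    have "(\<Sum>k\<in>S. (if k \<in> R then 1 else 0) *\<^sub>R rank1 (\<xi> k)) = (\<Sum>k\<in>R. rank1 (\<xi> k))"
      using that fin by (intro sum.mono_neutral_cong_right) auto
    then show ?thesis using ind [OF that, of 1] by (simp add: f_def)
  qed
  have pcard: "p I = 0" if I: "I \<subseteq> S" "card I \<noteq> CARD('n)" for I
  proof (rule expansion_coefficient_degree [OF finite_subset [OF I(1) fin] _ I(2)])
    fix R assume "R \<subseteq> I"
    then have R: "R \<subseteq> S" using I by blast
    have "f (\<lambda>k. if k \<in> R then 2 else 0) = moore_det (2 *\<^sub>R (\<Sum>k\<in>S. (if k \<in> R then 1 else 0) *\<^sub>R rank1 (\<xi> k)))"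
      unfolding f_def scaleR_sum_right by (intro arg_cong [where f = moore_det] sum.cong) auto
    also have "\<dots> = 2 ^ CARD('n) * f (\<lambda>k. if k \<in> R then 1 else 0)"
      unfolding f_def by (rule moore_det_scaleR [OF hh])
    finally show "(\<Sum>U\<in>Pow R. p U * 2 ^ card U) = 2 ^ CARD('n) * (\<Sum>U\<in>Pow R. p U)"
      using ind [OF R] by simp
  qed
  let ?\<theta> = "\<lambda>x k. a k * cos (\<xi> k \<bullet> x) + b k * sin (\<xi> k \<bullet> x)"
  have zero: "p I * (\<integral>x. indicator (cube T) x * (\<Prod>k\<in>I. ?\<theta> x k) \<partial>lborel) = 0" if I: "I \<subseteq> S" for I
  proof (cases "\<forall>J\<subseteq>I. (\<Sum>k\<in>J. \<xi> k) \<noteq> (\<Sum>k\<in>I - J. \<xi> k)")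
    case True
    then have "(\<integral>x. indicator (cube T) x * (\<Prod>k\<in>I. ?\<theta> x k) \<partial>lborel) = 0"
      using I fr by (intro integral_prod_trig_zero T finite_subset [OF I fin]) auto
    then show ?thesis by simp
  next
    case False
    then obtain J where J: "J \<subseteq> I" "(\<Sum>k\<in>J. \<xi> k) = (\<Sum>k\<in>I - J. \<xi> k)" by auto
    have "p I = 0"
    proof (cases "card I = CARD('n)")
      case True
      show ?thesis
      proof (rule expansion_coefficient_zero [OF finite_subset [OF I fin]])
        fix R assume "R \<subseteq> I"
        then show "(\<Sum>U\<in>Pow R. p U) = 0"
          using moore_det_rank1_sum_singular [OF finite_subset [OF I fin] True J] fR I by simp
      qed
    qed (use pcard I in simp)
    then show ?thesis by simp
  qed
  have int: "integrable lborel (\<lambda>x. indicator (cube T) x * (\<Prod>k\<in>I. ?\<theta> x k))" for I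
    using borel_integrable_compact [OF compact_cube, of T "\<lambda>x. \<Prod>k\<in>I. ?\<theta> x k"]
    by (simp add: continuous_intros)
  have "(\<integral>x. indicator (cube T) x * moore_det (\<Sum>k\<in>S. ?\<theta> x k *\<^sub>R rank1 (\<xi> k)) \<partial>lborel) =
      (\<integral>x. (\<Sum>I\<in>Pow S. p I * (indicator (cube T) x * (\<Prod>k\<in>I. ?\<theta> x k))) \<partial>lborel)"
  proof -
    have "moore_det (\<Sum>k\<in>S. ?\<theta> x k *\<^sub>R rank1 (\<xi> k)) = (\<Sum>I\<in>Pow S. p I * (\<Prod>k\<in>I. ?\<theta> x k))" for x
      using fS [of "?\<theta> x"] by (simp only: f_def)
    then show ?thesis by (simp only: sum_distrib_left mult.left_commute)
  qed
  also have "\<dots> = (\<Sum>I\<in>Pow S. p I * (\<integral>x. indicator (cube T) x * (\<Prod>k\<in>I. ?\<theta> x k) \<partial>lborel))"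
    by (subst Bochner_Integration.integral_sum)
       (simp_all only: integral_mult_right_zero integrable_mult_right int)
  also have "\<dots> = 0" using zero by (intro sum.neutral) auto
  finally show ?thesis .
qed

section \<open>Trigonometric kernels\<close>

text \<open>
  A list of amplitudes and frequencies, with repetitions permitted, spares the collection of equal frequencies
  when such functions are multiplied.
\<close>

definition cospoly :: "real \<Rightarrow> ('a::euclidean_space \<Rightarrow> real) \<Rightarrow> bool" where
  "cospoly T f \<longleftrightarrow> (\<exists>xs. (\<forall>(\<alpha>, \<xi>)\<in>set xs. freq T \<xi>) \<and> (\<forall>z. f z = (\<Sum>(\<alpha>, \<xi>)\<leftarrow>xs. \<alpha> * cos (\<xi> \<bullet> z))))"

lemma cospoly_mult_raised_cosine:
  assumes "cospoly T f" "freq T \<eta>"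
  shows "cospoly T (\<lambda>z. f z * ((1 + cos (\<eta> \<bullet> z)) / 2))"
proof -
  obtain xs where xs: "\<And>\<alpha> \<xi>. (\<alpha>, \<xi>) \<in> set xs \<Longrightarrow> freq T \<xi>" and
    f: "\<And>z. f z = (\<Sum>(\<alpha>, \<xi>)\<leftarrow>xs. \<alpha> * cos (\<xi> \<bullet> z))"
    using assms(1) by (auto simp: cospoly_def)
  define ys where "ys = map (\<lambda>(\<alpha>, \<xi>). (\<alpha> / 2, \<xi>)) xs @ map (\<lambda>(\<alpha>, \<xi>). (\<alpha> / 4, \<xi> + \<eta>)) xs
    @ map (\<lambda>(\<alpha>, \<xi>). (\<alpha> / 4, \<xi> - \<eta>)) xs"
  have "(\<Sum>(\<alpha>, \<xi>)\<leftarrow>xs. \<alpha> * cos (\<xi> \<bullet> z)) * ((1 + cos (\<eta> \<bullet> z)) / 2) =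
     (\<Sum>(\<alpha>, \<xi>)\<leftarrow>map (\<lambda>(\<alpha>, \<xi>). (\<alpha> / 2, \<xi>)) xs. \<alpha> * cos (\<xi> \<bullet> z)) +
     (\<Sum>(\<alpha>, \<xi>)\<leftarrow>map (\<lambda>(\<alpha>, \<xi>). (\<alpha> / 4, \<xi> + \<eta>)) xs. \<alpha> * cos (\<xi> \<bullet> z)) +
     (\<Sum>(\<alpha>, \<xi>)\<leftarrow>map (\<lambda>(\<alpha>, \<xi>). (\<alpha> / 4, \<xi> - \<eta>)) xs. \<alpha> * cos (\<xi> \<bullet> z))" for z
    by (induction xs)
       (auto simp: field_simps inner_add_left inner_diff_left cos_add cos_diff)
  then have "\<forall>z. f z * ((1 + cos (\<eta> \<bullet> z)) / 2) = (\<Sum>(\<alpha>, \<xi>)\<leftarrow>ys. \<alpha> * cos (\<xi> \<bullet> z))"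
    by (simp add: f ys_def)
  moreover have "\<forall>(\<alpha>, \<xi>)\<in>set ys. freq T \<xi>"
    using xs assms(2) by (auto simp: ys_def intro: freq_simps)
  ultimately show ?thesis unfolding cospoly_def by blast
qed

text \<open>
  Its powers, suitably normalized, are the de la Vallee Poussin kernels
  \<open>cos\<^bsup>2 N\<^esup> (\<pi> t / (2 T))\<close> in each coordinate. Unlike the partial sums of a
  Fourier series they form a nonnegative approximate identity, so that only continuity of the convolved function
  is required.
\<close>

definition raised_cosine :: "real \<Rightarrow> 'a::euclidean_space \<Rightarrow> real" where
  "raised_cosine T z = (\<Prod>b\<in>Basis. (1 + cos ((pi / T) *\<^sub>R b \<bullet> z)) / 2)"

lemma cospoly_raised_cosine_power: "cospoly T (\<lambda>z. raised_cosine T z ^ N)"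
proof (induction N)
  case 0
  show ?case
    unfolding cospoly_def by (intro exI [of _ "[(1, 0)]"]) (simp add: freq_simps)
next
  case (Suc N)
  have "cospoly T (\<lambda>z. f z * (\<Prod>b\<in>B. (1 + cos ((pi / T) *\<^sub>R b \<bullet> z)) / 2))"
    if "cospoly T f" "B \<subseteq> (Basis :: 'a set)" for f :: "'a \<Rightarrow> real" and B
    using finite_subset [OF that(2) finite_Basis] that
  proof (induction B rule: finite_induct)
    case (insert b B)
    have "freq T ((pi / T) *\<^sub>R b)"
      unfolding freq_def
    proof
      fix b' :: 'a assume "b' \<in> Basis"
      then show "\<exists>j::int. ((pi / T) *\<^sub>R b) \<bullet> b' = pi / T * of_int j"
        using insert.prems by (intro exI [of _ "if b = b' then 1 else 0"]) (auto simp: inner_Basis)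
    qed
    from cospoly_mult_raised_cosine [OF _ this, of "\<lambda>z. f z * (\<Prod>b\<in>B. (1 + cos ((pi / T) *\<^sub>R b \<bullet> z)) / 2)"]
    show ?case using insert by (simp add: mult_ac)
  qed simp
  from this [OF Suc.IH order_refl] show ?case
    by (simp add: raised_cosine_def mult.commute)
qed

lemma raised_cosine_bounds:
  shows "0 \<le> raised_cosine T z" "raised_cosine T 0 = 1"
    and "0 < T \<Longrightarrow> z \<in> cube (5 / 4 * T) \<Longrightarrow> z \<noteq> 0 \<Longrightarrow> raised_cosine T z < 1"
proof -
  let ?c = "\<lambda>b. (1 + cos ((pi / T) *\<^sub>R b \<bullet> z)) / 2"
  have nn: "0 \<le> ?c b" "?c b \<le> 1" for b
  proof -
    show "0 \<le> ?c b"
      using add_left_mono [OF cos_ge_minus_one [of "(pi / T) *\<^sub>R b \<bullet> z"], of 1] by simp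
    show "?c b \<le> 1"
      using add_left_mono [OF cos_le_one [of "(pi / T) *\<^sub>R b \<bullet> z"], of 1] by simp
  qed
  show "0 \<le> raised_cosine T z" unfolding raised_cosine_def by (intro prod_nonneg nn)
  show "raised_cosine T 0 = 1" by (simp add: raised_cosine_def)
  assume T: "0 < T" and z: "z \<in> cube (5 / 4 * T)" "z \<noteq> 0"
  obtain b where b: "b \<in> Basis" "z \<bullet> b \<noteq> 0" using z(2) euclidean_all_zero_iff by blast
  (* Other maxima occur at distance 2 T in some coordinate, outside the cube of half-width 5/4 T. *)
  have "?c b \<noteq> 1"
  proof
    assume "?c b = 1"
    then have "cos (pi / T * (z \<bullet> b)) = 1" by (simp add: inner_commute)
    then obtain n :: int where n: "pi / T * (z \<bullet> b) = of_int n * 2 * pi" by (auto simp: cos_one_2pi_int)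
    then have e: "z \<bullet> b = 2 * of_int n * T" using T by (simp add: field_simps)
    have "\<bar>2 * of_int n * T\<bar> \<le> 5 / 4 * T" using z(1) b(1) unfolding e [symmetric] by (simp add: mem_cube)
    then have "\<bar>of_int n :: real\<bar> \<le> 5 / 8" using T by (simp add: abs_mult)
    then have "n = 0" by linarith
    then show False using e b by simp
  qed
  then have "?c b < 1" using nn(2) [of b] by linarith
  moreover have "raised_cosine T z \<le> ?c b * 1"
    unfolding raised_cosine_def prod.remove [OF finite_Basis b(1)]
    by (intro mult_left_mono prod_le_1 conjI nn)
  ultimately show "raised_cosine T z < 1" by simp
qed

text \<open>
  The powers of a function with a strict maximum at 0 concentrate at 0: near 0 they exceed \<open>c ^ N\<close>
  for any \<open>c < 1\<close>, while away from 0 they are at most \<open>c' ^ N\<close> for some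
  \<open>c' < 1\<close>.
\<close>

lemma approximate_identity:
  fixes k :: "'a::euclidean_space \<Rightarrow> real" and F :: "'a \<Rightarrow> 'b::euclidean_space"
  assumes B: "compact B" and r: "0 < r" "cball 0 r \<subseteq> B"
    and ck: "continuous_on UNIV k" and k0: "k 0 = 1" and kn: "\<And>y. 0 \<le> k y"
    and k1: "\<And>y. y \<in> B \<Longrightarrow> y \<noteq> 0 \<Longrightarrow> k y < 1"
    and cF: "continuous_on UNIV F"
  shows "\<And>N. 0 < (\<integral>y. indicator B y * k y ^ N \<partial>lborel)"
    and "(\<lambda>N. (\<integral>y. indicator B y *\<^sub>R (k y ^ N *\<^sub>R F y) \<partial>lborel) /\<^sub>R (\<integral>y. indicator B y * k y ^ N \<partial>lborel))
      \<longlonglongrightarrow> F 0"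
proof -
  define W where "W N = (\<integral>y. indicator B y * k y ^ N \<partial>lborel)" for N
  have i1: "integrable lborel (\<lambda>y. indicator B y * k y ^ N)" for N
    using borel_integrable_compact [OF B, of "\<lambda>y. k y ^ N"] continuous_on_subset [OF ck subset_UNIV]
    by (simp add: continuous_intros)
  have [measurable]: "B \<in> sets borel" using B by (simp add: compact_imp_closed)
  have fB: "emeasure lborel B < \<infinity>" using B emeasure_compact_finite by blast
  have Wlow: "c ^ N * measure lborel (ball (0::'a) s) \<le> W N"
    if "ball 0 s \<subseteq> B" "\<And>y. y \<in> ball 0 s \<Longrightarrow> c \<le> k y" "0 \<le> c" for c s N
  proof -
    have fs: "emeasure lborel (ball (0::'a) s) < \<infinity>"
      by (rule emeasure_bounded_finite) simp
    then have "c ^ N * measure lborel (ball (0::'a) s) = (\<integral>y. indicator (ball (0::'a) s) y * c ^ N \<partial>lborel)"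
      by (simp add: less_top)
    also have "\<dots> \<le> W N"
      unfolding W_def
    proof (rule integral_mono)
      show "integrable lborel (\<lambda>y. indicator (ball (0::'a) s) y * c ^ N)"
        by (intro integrable_mult_left integrable_real_indicator) (use fs in auto)
      show "indicator (ball 0 s) y * c ^ N \<le> indicator B y * k y ^ N" for y
        using that kn by (auto simp: indicator_def power_mono)
    qed (rule i1)
    finally show ?thesis .
  qed
  have near: "\<exists>s>0. ball 0 s \<subseteq> B \<and> (\<forall>y\<in>ball 0 s. c \<le> k y)" if c1: "c < 1" for c
  proof -
    have "open {y. c < k y}" using ck by (simp add: open_Collect_less)
    then obtain s where "s > 0" "ball 0 s \<subseteq> {y. c < k y}"
      using c1 k0 openE [of "{y. c < k y}" 0] by auto
    then show ?thesis using r by (intro exI [of _ "min s r"]) (auto simp: subset_iff dist_norm)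
  qed
  have Wpos: "0 < W N" for N
  proof -
    obtain s where s: "s > 0" "ball 0 s \<subseteq> B" "\<forall>y\<in>ball 0 s. 1 / 2 \<le> k y" using near [of "1/2"] by auto
    have "0 < measure lborel (ball (0::'a) s)" using s by (simp add: content_ball_pos)
    then have "0 < (1 / 2) ^ N * measure lborel (ball (0::'a) s)" by simp
    also have "\<dots> \<le> W N" using s by (intro Wlow) auto
    finally show ?thesis .
  qed
  then show "\<And>N. 0 < (\<integral>y. indicator B y * k y ^ N \<partial>lborel)" by (simp add: W_def)
  have cFB: "continuous_on A F" for A using continuous_on_subset [OF cF subset_UNIV] .
  have "compact ((\<lambda>y. F y - F 0) ` B)"
    by (intro compact_continuous_image continuous_intros cFB B)
  then obtain M where M: "\<And>y. y \<in> B \<Longrightarrow> norm (F y - F 0) \<le> M" "0 \<le> M"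
    using compact_imp_bounded bounded_pos by (metis (no_types, lifting) imageI less_imp_le)
  have i2: "integrable lborel (\<lambda>y. indicator B y *\<^sub>R (k y ^ N *\<^sub>R F y))" for N
    by (intro borel_integrable_compact B continuous_intros continuous_on_subset [OF ck] cFB) auto
  have "(\<lambda>N. (\<integral>y. indicator B y *\<^sub>R (k y ^ N *\<^sub>R F y) \<partial>lborel) /\<^sub>R W N) \<longlonglongrightarrow> F 0"
  proof (rule metric_LIMSEQ_I)
    fix e :: real assume e: "0 < e"
    obtain d where d: "0 < d" "\<And>y. y \<in> ball 0 d \<Longrightarrow> norm (F y - F 0) \<le> e / 2"
    proof -
      have "isCont F 0" using cF by (simp add: continuous_on_eq_continuous_at)
      then obtain d where "d > 0" "\<forall>y. dist y 0 < d \<longrightarrow> dist (F y) (F 0) < e / 2"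
        using e unfolding continuous_at_eps_delta by (meson half_gt_zero)
      then show ?thesis using that by (force simp: dist_norm)
    qed
    obtain q where q: "0 \<le> q" "q < 1" "\<And>y. y \<in> B - ball 0 d \<Longrightarrow> k y \<le> q"
    proof (cases "B - ball 0 d = {}")
      case True
      then show ?thesis by (intro that [of 0]) auto
    next
      case False
      have "compact (B - ball 0 d)" using B by (simp add: compact_diff)
      from continuous_attains_sup [OF this False continuous_on_subset [OF ck subset_UNIV]]
      obtain x where "x \<in> B - ball 0 d" "\<And>y. y \<in> B - ball 0 d \<Longrightarrow> k y \<le> k x" by blast
      moreover have "x \<noteq> 0" using \<open>x \<in> B - ball 0 d\<close> d(1) by auto
      ultimately show ?thesis using that [of "k x"] kn [of x] k1 [of x] by blast
    qed
    define c where "c = (1 + q) / 2"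
    have c: "q < c" "c < 1" "0 < c" using q by (auto simp: c_def)
    obtain s where s: "s > 0" "ball 0 s \<subseteq> B" "\<And>y. y \<in> ball 0 s \<Longrightarrow> c \<le> k y" using near [OF c(2)] by auto
    define v where "v = measure lborel (ball (0::'a) s)"
    have v: "0 < v" using s(1) by (simp add: v_def content_ball_pos)
    define b where "b = measure lborel B"
    have bound: "dist ((\<integral>y. indicator B y *\<^sub>R (k y ^ N *\<^sub>R F y) \<partial>lborel) /\<^sub>R W N) (F 0)
        \<le> e / 2 + (M * b / v) * (q / c) ^ N" for N
    proof -
      have i3: "integrable lborel (\<lambda>y. (e / 2) * (indicator B y * k y ^ N) + (M * q ^ N) * indicator B y)"
        by (intro Bochner_Integration.integrable_add integrable_mult_right i1 integrable_real_indicator fB) simp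
      have "(\<integral>y. indicator B y *\<^sub>R (k y ^ N *\<^sub>R F y) \<partial>lborel) - W N *\<^sub>R F 0 =
          (\<integral>y. indicator B y *\<^sub>R (k y ^ N *\<^sub>R F y) - (indicator B y * k y ^ N) *\<^sub>R F 0 \<partial>lborel)"
        unfolding W_def by (subst Bochner_Integration.integral_diff) (use i1 i2 in auto)
      also have "norm \<dots> \<le> (\<integral>y. (e / 2) * (indicator B y * k y ^ N) + (M * q ^ N) * indicator B y \<partial>lborel)"
      proof (rule Bochner_Integration.integral_norm_bound_integral [OF _ i3])
        show "integrable lborel (\<lambda>y. indicator B y *\<^sub>R (k y ^ N *\<^sub>R F y) - (indicator B y * k y ^ N) *\<^sub>R F 0)"
          by (intro Bochner_Integration.integrable_diff i2 integrable_scaleR_left i1)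
        fix y
        show "norm (indicator B y *\<^sub>R (k y ^ N *\<^sub>R F y) - (indicator B y * k y ^ N) *\<^sub>R F 0)
            \<le> (e / 2) * (indicator B y * k y ^ N) + (M * q ^ N) * indicator B y"
        proof (cases "y \<in> B")
          case True
          have "norm (k y ^ N *\<^sub>R F y - k y ^ N *\<^sub>R F 0) = k y ^ N * norm (F y - F 0)"
            using kn [of y] by (simp flip: scaleR_diff_right)
          also have "\<dots> \<le> e / 2 * k y ^ N + M * q ^ N"
          proof (cases "y \<in> ball 0 d")
            case True
            have "k y ^ N * norm (F y - F 0) \<le> k y ^ N * (e / 2)"
              using d(2) [OF True] kn [of y] by (intro mult_left_mono) auto
            moreover have "0 \<le> M * q ^ N" using M q by simp
            ultimately show ?thesis by (simp add: mult.commute)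
          next
            case False
            have "k y ^ N * norm (F y - F 0) \<le> q ^ N * M"
              using q(3) [of y] False True kn [of y] M by (intro mult_mono power_mono) (auto simp: q)
            moreover have "0 \<le> e / 2 * k y ^ N" using e kn [of y] by simp
            ultimately show ?thesis by (simp add: mult.commute)
          qed
          finally show ?thesis using True by simp
        qed simp
      qed
      also have "\<dots> = e / 2 * W N + M * q ^ N * b"
      proof -
        have "integrable lborel (indicator B :: 'a \<Rightarrow> real)" using fB by (intro integrable_real_indicator) auto
        then show ?thesis
          unfolding W_def b_def using fB i1
          by (subst Bochner_Integration.integral_add) (auto simp: less_top)
      qed
      finally have n: "norm ((\<integral>y. indicator B y *\<^sub>R (k y ^ N *\<^sub>R F y) \<partial>lborel) - W N *\<^sub>R F 0) \<le> e / 2 * W N + M * q ^ N * b" .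
      have "dist ((\<integral>y. indicator B y *\<^sub>R (k y ^ N *\<^sub>R F y) \<partial>lborel) /\<^sub>R W N) (F 0) =
          norm ((\<integral>y. indicator B y *\<^sub>R (k y ^ N *\<^sub>R F y) \<partial>lborel) - W N *\<^sub>R F 0) / W N"
      proof -
        have "(\<integral>y. indicator B y *\<^sub>R (k y ^ N *\<^sub>R F y) \<partial>lborel) /\<^sub>R W N - F 0 =
          ((\<integral>y. indicator B y *\<^sub>R (k y ^ N *\<^sub>R F y) \<partial>lborel) - W N *\<^sub>R F 0) /\<^sub>R W N"
          using Wpos [of N] by (simp add: scaleR_diff_right)
        then show ?thesis using Wpos [of N] by (simp add: dist_norm divide_inverse mult.commute)
      qed
      also have "\<dots> \<le> (e / 2 * W N + M * q ^ N * b) / W N"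
        using n Wpos [of N] by (intro divide_right_mono) auto
      also have "\<dots> = e / 2 + M * q ^ N * b / W N" using Wpos [of N] by (simp add: add_divide_distrib)
      also have "M * q ^ N * b / W N \<le> M * q ^ N * b / (c ^ N * v)"
        using Wlow [OF s(2,3), of N] c v M q Wpos [of N]
        by (intro divide_left_mono mult_nonneg_nonneg mult_pos_pos) (auto simp: v_def b_def)
      finally show ?thesis by (simp add: power_divide mult_ac)
    qed
    have "(\<lambda>N. (M * b / v) * (q / c) ^ N) \<longlonglongrightarrow> 0"
      using c q by (intro tendsto_mult_right_zero LIMSEQ_power_zero) auto
    then have "\<forall>\<^sub>F N in sequentially. (M * b / v) * (q / c) ^ N < e / 2"
      using e by (intro order_tendstoD(2)) auto
    then obtain N0 where N0: "\<And>N. N \<ge> N0 \<Longrightarrow> (M * b / v) * (q / c) ^ N < e / 2"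
      by (auto simp: eventually_sequentially)
    show "\<exists>no. \<forall>N\<ge>no. dist ((\<integral>y. indicator B y *\<^sub>R (k y ^ N *\<^sub>R F y) \<partial>lborel) /\<^sub>R W N) (F 0) < e"
      using bound N0 by (intro exI [of _ N0]) (smt (verit) field_sum_of_halves)
  qed
  then show "(\<lambda>N. (\<integral>y. indicator B y *\<^sub>R (k y ^ N *\<^sub>R F y) \<partial>lborel) /\<^sub>R (\<integral>y. indicator B y * k y ^ N \<partial>lborel))
      \<longlonglongrightarrow> F 0" by (simp add: W_def)
qed


section \<open>The integral of the determinant of a Hessian\<close>

text \<open>
  The contribution of the second derivative in the real directions \<open>r\<close> and \<open>s\<close> to the
  quaternionic Hessian: \<open>dqbar\<close> multiplies by a unit from the left, \<open>dq\<close> by a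
  conjugate unit from the right.
\<close>

definition unit_matrix :: "'n \<times> 4 \<Rightarrow> 'n \<times> 4 \<Rightarrow> quat^'n^'n" where
  "unit_matrix r s = (\<chi> i j. if i = fst r \<and> j = fst s then quat_unit (snd r) * quat_cnj (quat_unit (snd s)) else 0)"

text \<open>
  The quaternionic Hessian as a linear function of the real second derivative \<open>L\<close>.
\<close>

definition hessmat :: "(quat^'n \<Rightarrow> quat^'n) \<Rightarrow> quat^'n^'n" where
  "hessmat L = (\<Sum>r\<in>UNIV. \<Sum>s\<in>UNIV. (L (qaxis r) \<bullet> qaxis s) *\<^sub>R unit_matrix r s)"

lemma hessmat_nth:
  fixes L :: "quat^'n \<Rightarrow> quat^'n"
  shows "hessmat L $ i $ j =
  (\<Sum>c\<in>UNIV. \<Sum>d\<in>UNIV. (L (qaxis (i, c)) \<bullet> qaxis (j, d)) *\<^sub>R (quat_unit c * quat_cnj (quat_unit d)))"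
proof -
  have A: "(\<Sum>j'\<in>UNIV. \<Sum>d\<in>UNIV. if P \<and> j = j' then X j' d else 0) = (if P then \<Sum>d\<in>UNIV. X j d else 0)"
    for P and j :: 'n and X :: "'n \<Rightarrow> 4 \<Rightarrow> quat"
  proof -
    have "(\<Sum>d\<in>UNIV. \<Sum>j'\<in>UNIV. if j = j' then X j' d else 0) = (\<Sum>d\<in>UNIV. X j d)"
      by (intro sum.cong refl) simp
    then show ?thesis by (subst sum.swap) (cases P, simp_all)
  qed
  let ?X = "\<lambda>i c j d. (L (qaxis (i, c)) \<bullet> qaxis (j, d)) *\<^sub>R (quat_unit c * quat_cnj (quat_unit d))"
  have "hessmat L $ i $ j = (\<Sum>i'\<in>UNIV. \<Sum>c\<in>UNIV. \<Sum>j'\<in>UNIV. \<Sum>d\<in>UNIV.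
      if i = i' \<and> j = j' then ?X i' c j' d else 0)"
    by (simp only: hessmat_def sum_pair4 sum_component vector_scaleR_component unit_matrix_def
        vec_lambda_beta fst_conv snd_conv if_distrib [of "scaleR _"] scaleR_zero_right)
  also have "\<dots> = (\<Sum>i'\<in>UNIV. \<Sum>c\<in>UNIV. if True \<and> i = i' then \<Sum>d\<in>UNIV. ?X i' c j d else 0)"
    by (intro sum.cong refl) (simp only: A simp_thms)
  also have "\<dots> = (\<Sum>c\<in>UNIV. \<Sum>d\<in>UNIV. ?X i c j d)"
    using A [of True i "\<lambda>i' c. \<Sum>d\<in>UNIV. ?X i' c j d"] by (simp only: if_True)
  finally show ?thesis .
qed

lemma hessmat_rank_one: "hessmat (\<lambda>h. (\<xi> \<bullet> h) *\<^sub>R \<xi>) = rank1 \<xi>"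
proof -
  have "hessmat (\<lambda>h. (\<xi> \<bullet> h) *\<^sub>R \<xi>) $ i $ j = rank1 \<xi> $ i $ j" for i j
  proof -
    have q: "\<xi> $ i = (\<Sum>c\<in>UNIV. (qaxis (i, c) \<bullet> \<xi>) *\<^sub>R quat_unit c)" for i
      unfolding qaxis_inner fst_conv snd_conv by (rule quat_sum_units)
    have "rank1 \<xi> $ i $ j = (\<Sum>c\<in>UNIV. (qaxis (i, c) \<bullet> \<xi>) *\<^sub>R quat_unit c) *
        quat_cnj (\<Sum>d\<in>UNIV. (qaxis (j, d) \<bullet> \<xi>) *\<^sub>R quat_unit d)"
      unfolding q [symmetric] by (simp add: rank1_def)
    also have "\<dots> = hessmat (\<lambda>h. (\<xi> \<bullet> h) *\<^sub>R \<xi>) $ i $ j"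
      by (simp add: hessmat_nth quat_cnj_sum quat_cnj_scaleR sum_product inner_commute [of _ \<xi>]
          del: quat_unit_simps) (simp only: mult.commute)
    finally show ?thesis ..
  qed
  then show ?thesis by (simp add: vec_eq_iff)
qed

lemma hyperhermitian_hessmat:
  assumes "\<And>h k. L h \<bullet> k = h \<bullet> L k"
  shows "hyperhermitian (hessmat L)"
proof -
  have sw: "L (qaxis r) \<bullet> qaxis s = L (qaxis s) \<bullet> qaxis r" for r s
    by (rule trans [OF assms inner_commute])
  have "hessmat L $ i $ j = quat_cnj (hessmat L $ j $ i)" for i j
    unfolding hessmat_nth quat_cnj_sum quat_cnj_scaleR quat_cnj_mult quat_cnj_cnj
    by (subst sum.swap, intro sum.cong refl) (rule arg_cong2 [where f = scaleR, OF sw refl])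
  then show ?thesis unfolding hyperhermitian_def by blast
qed

lemma hessmat_zero: "(\<And>h. L h = 0) \<Longrightarrow> hessmat L = 0"
  by (simp add: hessmat_def)

lemma continuous_on_hessmat:
  assumes "\<And>h. continuous_on A (\<lambda>x. H x h)"
  shows "continuous_on A (\<lambda>x. hessmat (H x))"
  unfolding hessmat_def by (intro continuous_intros assms)

lemma moore_det_zero: "moore_det (0 :: quat^'n^'n) = 0"
  using moore_det_scaleR [OF hyperhermitian_mat_1 [where 'n = 'n], of 0] by simp

text \<open>
  By \<open>integral_hessian_cos\<close> a plane wave with frequency \<open>\<xi>\<close> extracts from the
  Hessian a multiple of the matrix \<open>\<xi> \<xi>\<^sup>*\<close>, which is the quaternionic Hessian of the
  form \<open>h \<mapsto> (\<xi> \<bullet> h)\<^sup>2\<close> up to a factor. The convolution is therefore a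
  sine and cosine in \<open>x\<close> times that matrix.
\<close>

lemma integral_cos_hessmat:
  fixes f :: "quat^'n \<Rightarrow> real"
  assumes C: "C2_data f G H" and z: "\<And>x. x \<notin> cball 0 R \<Longrightarrow> f x = 0"
  shows "integrable lborel (\<lambda>y. cos (\<xi> \<bullet> (x - y)) *\<^sub>R hessmat (H y))"
    and "(\<integral>y. cos (\<xi> \<bullet> (x - y)) *\<^sub>R hessmat (H y) \<partial>lborel) =
      (- (\<integral>y. f y * cos (\<xi> \<bullet> y) \<partial>lborel) * cos (\<xi> \<bullet> x) - (\<integral>y. f y * sin (\<xi> \<bullet> y) \<partial>lborel) * sin (\<xi> \<bullet> x)) *\<^sub>R rank1 \<xi>"
proof -
  note cs = C2_data_continuous [OF C]
  have zH: "H y h = 0" if "y \<notin> cball 0 R" for y h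
    using C2_data_locally_zero [OF C, of "- cball 0 R"] z that by auto
  define a where "a = - (\<xi> \<bullet> x)"
  have cosa: "cos (\<xi> \<bullet> (x - y)) = cos (\<xi> \<bullet> y + a)" for y
    using cos_minus [of "\<xi> \<bullet> (x - y)"] by (simp add: a_def inner_diff_right)
  show "integrable lborel (\<lambda>y. cos (\<xi> \<bullet> (x - y)) *\<^sub>R hessmat (H y))"
    by (rule integrable_compact_support [where R = R])
       (auto intro!: continuous_intros continuous_on_hessmat cs simp: zH hessmat_zero)
  have int: "integrable lborel (\<lambda>y. (H y h \<bullet> k) * cos (\<xi> \<bullet> y + a))" for h k
    by (rule integrable_compact_support [where R = R]) (auto intro!: continuous_intros cs simp: zH)
  let ?I = "\<integral>y. f y * cos (\<xi> \<bullet> y + a) \<partial>lborel"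
  have "(\<integral>y. cos (\<xi> \<bullet> (x - y)) *\<^sub>R hessmat (H y) \<partial>lborel) =
     (\<integral>y. (\<Sum>r\<in>UNIV. \<Sum>s\<in>UNIV. ((H y (qaxis r) \<bullet> qaxis s) * cos (\<xi> \<bullet> y + a)) *\<^sub>R unit_matrix r s) \<partial>lborel)"
    by (simp add: cosa hessmat_def scaleR_sum_right mult.commute)
  also have "\<dots> = (\<Sum>r\<in>UNIV. \<Sum>s\<in>UNIV. (\<integral>y. (H y (qaxis r) \<bullet> qaxis s) * cos (\<xi> \<bullet> y + a) \<partial>lborel) *\<^sub>R unit_matrix r s)"
    by (simp only: Bochner_Integration.integral_sum Bochner_Integration.integrable_sum
        integrable_scaleR_left int integral_scaleR_left simp_thms)
  also have "\<dots> = - ?I *\<^sub>R hessmat (\<lambda>h. (\<xi> \<bullet> h) *\<^sub>R \<xi>)"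
  proof -
    have "(\<integral>y. (H y h \<bullet> k) * cos (\<xi> \<bullet> y + a) \<partial>lborel) = - ((\<xi> \<bullet> h) * (\<xi> \<bullet> k)) * ?I" for h k
      by (rule integral_hessian_cos [OF C z])
    then show ?thesis
      unfolding hessmat_def scaleR_sum_right by (intro sum.cong refl) simp
  qed
  also have "?I = (\<integral>y. f y * cos (\<xi> \<bullet> y) \<partial>lborel) * cos (\<xi> \<bullet> x) + (\<integral>y. f y * sin (\<xi> \<bullet> y) \<partial>lborel) * sin (\<xi> \<bullet> x)"
  proof -
    have i: "integrable lborel (\<lambda>y. f y * cos (\<xi> \<bullet> y))" "integrable lborel (\<lambda>y. f y * sin (\<xi> \<bullet> y))"
      by (auto intro!: integrable_compact_support [where R = R] continuous_intros cs simp: z)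
    have "?I = (\<integral>y. (f y * cos (\<xi> \<bullet> y)) * cos (\<xi> \<bullet> x) + (f y * sin (\<xi> \<bullet> y)) * sin (\<xi> \<bullet> x) \<partial>lborel)"
      by (simp add: cos_diff a_def algebra_simps)
    also have "\<dots> = (\<integral>y. f y * cos (\<xi> \<bullet> y) \<partial>lborel) * cos (\<xi> \<bullet> x) + (\<integral>y. f y * sin (\<xi> \<bullet> y) \<partial>lborel) * sin (\<xi> \<bullet> x)"
      using i by simp
    finally show ?thesis .
  qed
  finally show "(\<integral>y. cos (\<xi> \<bullet> (x - y)) *\<^sub>R hessmat (H y) \<partial>lborel) =
      (- (\<integral>y. f y * cos (\<xi> \<bullet> y) \<partial>lborel) * cos (\<xi> \<bullet> x) - (\<integral>y. f y * sin (\<xi> \<bullet> y) \<partial>lborel) * sin (\<xi> \<bullet> x)) *\<^sub>R rank1 \<xi>"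
    by (simp add: hessmat_rank_one)
qed

text \<open>
  The Hessian is convolved with a trigonometric kernel whose period is large compared with the support. The
  result is a finite sum of plane waves times rank-one matrices, whose determinant has integral zero over the
  period cube. As the kernel concentrates, the convolutions converge boundedly to the Hessian on that cube.
\<close>

theorem integral_moore_det_hessian_zero:
  fixes f :: "quat^'n \<Rightarrow> real"
  assumes C: "C2_data f G H" and z0: "\<And>x. x \<notin> cball 0 R0 \<Longrightarrow> f x = 0"
  shows "(\<integral>x. moore_det (hessmat (H x)) \<partial>lborel) = 0"
proof -
  define R where "R = max R0 1"
  have R: "0 < R" by (simp add: R_def)
  have z: "f x = 0" if "x \<notin> cball 0 R" for x using z0 [of x] that by (auto simp: R_def)
  (* For x in cube T and y in the support, x - y lies in the cube of half-width T + R = 5/4 T,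
     where the kernel has no maximum other than 0. *)
  define T where "T = 4 * R"
  have T: "0 < T" using R by (simp add: T_def)
  note cs = C2_data_continuous [OF C]
  define HM where "HM x = hessmat (H x)" for x
  have cHM: "continuous_on A HM" for A unfolding HM_def by (intro continuous_on_hessmat cs)
  have zHM: "HM x = 0" if "x \<notin> cball 0 R" for x
    unfolding HM_def using C2_data_locally_zero(2) [OF C, of "- cball 0 R" x] z that
    by (intro hessmat_zero) auto
  have hHM: "hyperhermitian (HM x)" for x
    unfolding HM_def using C by (intro hyperhermitian_hessmat) (simp add: C2_data_def)
  define B where "B = (cube (5 / 4 * T) :: (quat^'n) set)"
  define k where "k = (raised_cosine T :: quat^'n \<Rightarrow> real)"
  have ck: "continuous_on A k" for A unfolding k_def raised_cosine_def by (intro continuous_intros) auto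
  define W where "W N = (\<integral>y. indicator B y * k y ^ N \<partial>lborel)" for N
  define M where "M N x = (\<integral>y. k (x - y) ^ N *\<^sub>R HM y \<partial>lborel) /\<^sub>R W N" for N x
  have aiB: "compact B" "0 < 5 / 4 * T" "cball 0 (5 / 4 * T) \<subseteq> B" "k 0 = 1" "0 \<le> k y"
     "y \<in> B \<Longrightarrow> y \<noteq> 0 \<Longrightarrow> k y < 1" for y
    using T raised_cosine_bounds [of T] cball_subset_cube by (auto simp: B_def k_def compact_cube)
  have Wpos: "0 < W N" for N
    unfolding W_def by (rule approximate_identity(1) [OF aiB(1-3) ck aiB(4-6) continuous_on_const [of UNIV 0]])
  have conv: "(\<integral>y. k (x - y) ^ N *\<^sub>R HM y \<partial>lborel) = (\<integral>y. indicator B y *\<^sub>R (k y ^ N *\<^sub>R HM (x - y)) \<partial>lborel)"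
    if x: "x \<in> cube T" for x N
  proof -
    have "continuous_on UNIV (\<lambda>y. k y ^ N *\<^sub>R HM (x - y))"
      by (intro continuous_intros ck continuous_on_compose2 [OF cHM]) auto
    then have "(\<integral>y. k (x - y) ^ N *\<^sub>R HM (x - (x - y)) \<partial>lborel) = (\<integral>y. k y ^ N *\<^sub>R HM (x - y) \<partial>lborel)"
      by (intro integral_lborel_reflect [of "\<lambda>y. k y ^ N *\<^sub>R HM (x - y)" x] borel_measurable_continuous_onI)
    also have "\<dots> = (\<integral>y. indicator B y *\<^sub>R (k y ^ N *\<^sub>R HM (x - y)) \<partial>lborel)"
    proof (intro Bochner_Integration.integral_cong refl)
      fix y
      show "k y ^ N *\<^sub>R HM (x - y) = indicator B y *\<^sub>R (k y ^ N *\<^sub>R HM (x - y))"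
      proof (cases "y \<in> B")
        case False
        then obtain b where b: "b \<in> Basis" "5 * R < \<bar>y \<bullet> b\<bar>" by (auto simp: B_def mem_cube T_def not_le)
        have "\<bar>x \<bullet> b\<bar> \<le> 4 * R" using x b(1) by (simp add: mem_cube T_def)
        then have "R < \<bar>(x - y) \<bullet> b\<bar>" using b(2) by (simp add: inner_diff_left)
        also have "\<dots> \<le> norm (x - y)" using b(1) by (rule Basis_le_norm)
        finally show ?thesis using zHM [of "x - y"] by simp
      qed simp
    qed
    finally show ?thesis by simp
  qed
  have lim: "(\<lambda>N. M N x) \<longlonglongrightarrow> HM x" if x: "x \<in> cube T" for x
  proof -
    have "continuous_on UNIV (\<lambda>y. HM (x - y))"
      by (intro continuous_on_compose2 [OF cHM] continuous_intros) auto
    from approximate_identity(2) [OF aiB(1-3) ck aiB(4-6) this]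
    show ?thesis by (simp add: M_def W_def conv [OF x])
  qed
  obtain Cb where Cb: "\<And>x. norm (HM x) \<le> Cb" "0 \<le> Cb"
  proof -
    have "compact (HM ` cball 0 R)" by (intro compact_continuous_image cHM compact_cball)
    then obtain c where c: "c > 0" "\<And>x. x \<in> cball 0 R \<Longrightarrow> norm (HM x) \<le> c"
      using compact_imp_bounded bounded_pos by (metis imageI)
    have "norm (HM x) \<le> c" for x using c zHM [of x] by (cases "x \<in> cball 0 R") auto
    then show ?thesis using that c(1) by (meson less_imp_le)
  qed
  have Mb: "norm (M N x) \<le> Cb" if x: "x \<in> cube T" for x N
  proof -
    have cH: "continuous_on UNIV (\<lambda>y. HM (x - y))"
      by (intro continuous_on_compose2 [OF cHM] continuous_intros) auto
    have iW: "integrable lborel (\<lambda>y. indicator B y * k y ^ N)"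
      using borel_integrable_compact [OF aiB(1), of "\<lambda>y. k y ^ N"] ck by (simp add: continuous_intros)
    have "norm (\<integral>y. indicator B y *\<^sub>R (k y ^ N *\<^sub>R HM (x - y)) \<partial>lborel) \<le> (\<integral>y. (indicator B y * k y ^ N) * Cb \<partial>lborel)"
    proof (rule Bochner_Integration.integral_norm_bound_integral)
      show "integrable lborel (\<lambda>y. indicator B y *\<^sub>R (k y ^ N *\<^sub>R HM (x - y)))"
        by (intro borel_integrable_compact aiB continuous_intros ck continuous_on_subset [OF cH]) auto
      show "norm (indicator B y *\<^sub>R (k y ^ N *\<^sub>R HM (x - y))) \<le> (indicator B y * k y ^ N) * Cb" for y
        using Cb(1) [of "x - y"] aiB(5) [of y] by (auto simp: indicator_def intro: mult_left_mono)
    qed (intro integrable_mult_left iW)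
    also have "\<dots> = W N * Cb" by (simp add: W_def)
    finally show ?thesis
      unfolding M_def conv [OF x] using Wpos [of N] by (simp add: field_simps)
  qed
  have trig: "\<exists>(m::nat) a b \<xi>. (\<forall>i<m. freq T (\<xi> i)) \<and>
      (\<forall>x. M N x = (\<Sum>i<m. (a i * cos (\<xi> i \<bullet> x) + b i * sin (\<xi> i \<bullet> x)) *\<^sub>R rank1 (\<xi> i)))" for N
  proof -
    obtain xs where xs: "\<And>\<alpha> \<xi>. (\<alpha>, \<xi>) \<in> set xs \<Longrightarrow> freq T \<xi>" and
      kx: "\<And>z. k z ^ N = (\<Sum>(\<alpha>, \<xi>)\<leftarrow>xs. \<alpha> * cos (\<xi> \<bullet> z))"
      using cospoly_raised_cosine_power [of T N, where 'a = "quat^'n"] by (auto simp: cospoly_def k_def)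
    define m where "m = length xs"
    define \<alpha> where "\<alpha> i = fst (xs ! i)" for i
    define \<xi> where "\<xi> i = snd (xs ! i)" for i
    have fr: "freq T (\<xi> i)" if "i < m" for i
      using xs [of "\<alpha> i" "\<xi> i"] that by (simp add: \<alpha>_def \<xi>_def m_def)
    have kz: "k z ^ N = (\<Sum>i<m. \<alpha> i * cos (\<xi> i \<bullet> z))" for z
      unfolding kx by (simp add: sum_list_sum_nth m_def \<alpha>_def \<xi>_def split_def atLeast0LessThan)
    let ?c = "\<lambda>i. \<integral>y. f y * cos (\<xi> i \<bullet> y) \<partial>lborel" and ?s = "\<lambda>i. \<integral>y. f y * sin (\<xi> i \<bullet> y) \<partial>lborel"
    have "M N x = (\<Sum>i<m. ((- \<alpha> i * ?c i / W N) * cos (\<xi> i \<bullet> x) + (- \<alpha> i * ?s i / W N) * sin (\<xi> i \<bullet> x)) *\<^sub>R rank1 (\<xi> i))" for x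
    proof -
      have "(\<integral>y. k (x - y) ^ N *\<^sub>R HM y \<partial>lborel) =
          (\<integral>y. (\<Sum>i<m. \<alpha> i *\<^sub>R (cos (\<xi> i \<bullet> (x - y)) *\<^sub>R HM y)) \<partial>lborel)"
        by (simp add: kz scaleR_sum_left)
      also have "\<dots> = (\<Sum>i<m. \<alpha> i *\<^sub>R (\<integral>y. cos (\<xi> i \<bullet> (x - y)) *\<^sub>R HM y \<partial>lborel))"
      proof -
        have "integrable lborel (\<lambda>y. cos (\<xi> i \<bullet> (x - y)) *\<^sub>R HM y)" for i
          unfolding HM_def by (rule integral_cos_hessmat(1) [OF C]) (rule z)
        then show ?thesis
          by (subst Bochner_Integration.integral_sum)
             (simp_all only: integrable_scaleR_right integral_scaleR_right)
      qed
      also have "\<dots> = (\<Sum>i<m. \<alpha> i *\<^sub>R ((- ?c i * cos (\<xi> i \<bullet> x) - ?s i * sin (\<xi> i \<bullet> x)) *\<^sub>R rank1 (\<xi> i)))"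
        unfolding HM_def by (intro sum.cong refl arg_cong2 [where f = scaleR] integral_cos_hessmat(2) [OF C]) (rule z)
      finally have c: "(\<integral>y. k (x - y) ^ N *\<^sub>R HM y \<partial>lborel) = \<dots>" .
      have alg: "inverse w * (a * (- c * C - s * S)) = (- a * c / w) * C + (- a * s / w) * S"
        if "0 < w" for w a c s C S :: real
        using that by (simp add: field_simps)
      show ?thesis
        unfolding M_def c scaleR_sum_right scaleR_scaleR alg [OF Wpos] ..
    qed
    with fr show ?thesis
      by (intro exI [of _ m] exI [of _ "\<lambda>i. - \<alpha> i * ?c i / W N"] exI [of _ "\<lambda>i. - \<alpha> i * ?s i / W N"]
          exI [of _ \<xi>] conjI allI impI) simp_all
  qed
  obtain p where p: "real_polynomial_function p" "\<And>A :: quat^'n^'n. hyperhermitian A \<Longrightarrow> moore_det A = p A"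
    using moore_det_characterization by metis
  have cp: "continuous_on A p" for A
    using p(1) continuous_polymonial_function real_polynomial_function_eq
    by (metis continuous_at_imp_continuous_on)
  have hM: "hyperhermitian (M N x)" and cM: "continuous_on UNIV (M N)" and
    iM: "(\<integral>x. indicator (cube T) x * p (M N x) \<partial>lborel) = 0" for N x
  proof -
    obtain m :: nat and a b \<xi> where fr: "\<And>i. i < m \<Longrightarrow> freq T (\<xi> i)" and
      M: "\<And>x. M N x = (\<Sum>i<m. (a i * cos (\<xi> i \<bullet> x) + b i * sin (\<xi> i \<bullet> x)) *\<^sub>R rank1 (\<xi> i))"
      using trig [of N] by blast
    show h: "hyperhermitian (M N x)" for x
      unfolding M by (intro hyperhermitian_sum hyperhermitian_scaleR hyperhermitian_rank1)
    show "continuous_on UNIV (M N)"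
      unfolding M [abs_def] by (intro continuous_intros)
    show "(\<integral>x. indicator (cube T) x * p (M N x) \<partial>lborel) = 0"
    proof -
      have "p (M N x) = moore_det (\<Sum>i<m. (a i * cos (\<xi> i \<bullet> x) + b i * sin (\<xi> i \<bullet> x)) *\<^sub>R rank1 (\<xi> i))" for x
        unfolding M [symmetric] by (rule p(2) [OF h, symmetric])
      then show ?thesis
        using integral_moore_det_trig_zero [OF T, of "{..<m}" \<xi> a b] fr by simp
    qed
  qed
  obtain D where D: "\<And>A. norm A \<le> Cb \<Longrightarrow> \<bar>p A\<bar> \<le> D"
  proof -
    have "compact (p ` cball 0 Cb)" by (intro compact_continuous_image cp compact_cball)
    then show ?thesis using that compact_imp_bounded bounded_iff
      by (metis imageI mem_cball_0 real_norm_def)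
  qed
  have [measurable]: "cube T \<in> sets (borel :: (quat^'n) measure)" by (simp add: cube_def)
  have "(\<lambda>N. \<integral>x. indicator (cube T) x * p (M N x) \<partial>lborel) \<longlonglongrightarrow> (\<integral>x. indicator (cube T) x * p (HM x) \<partial>lborel)"
  proof (rule integral_dominated_convergence)
    have [measurable]: "(\<lambda>x. p (M N x)) \<in> borel_measurable borel" for N
      by (intro borel_measurable_continuous_onI continuous_on_compose2 [OF cp cM]) auto
    have [measurable]: "(\<lambda>x. p (HM x)) \<in> borel_measurable borel"
      by (intro borel_measurable_continuous_onI continuous_on_compose2 [OF cp cHM]) auto
    show "(\<lambda>x. indicator (cube T) x * p (HM x)) \<in> borel_measurable lborel"
      "\<And>N. (\<lambda>x. indicator (cube T) x * p (M N x)) \<in> borel_measurable lborel" by measurable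
    show "integrable lborel (\<lambda>x. indicator (cube T) x *\<^sub>R D)"
      by (rule borel_integrable_compact) (auto simp: compact_cube)
    have "(\<lambda>N. indicator (cube T) x * p (M N x)) \<longlonglongrightarrow> indicator (cube T) x * p (HM x)" for x
    proof (cases "x \<in> cube T")
      case True
      have "isCont p (HM x)" using cp [of UNIV] by (simp add: continuous_on_eq_continuous_at)
      from isCont_tendsto_compose [OF this lim [OF True]] show ?thesis using True by simp
    qed simp
    then show "AE x in lborel. (\<lambda>N. indicator (cube T) x * p (M N x)) \<longlonglongrightarrow> indicator (cube T) x * p (HM x)" by simp
    show "AE x in lborel. norm (indicator (cube T) x * p (M N x)) \<le> indicator (cube T) x *\<^sub>R D" for N
      using D Mb by (intro AE_I2) (auto simp: indicator_def)
  qed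
  then have "(\<integral>x. indicator (cube T) x * p (HM x) \<partial>lborel) = 0"
    unfolding iM by (simp add: LIMSEQ_const_iff)
  also have "(\<integral>x. indicator (cube T) x * p (HM x) \<partial>lborel) = (\<integral>x. moore_det (hessmat (H x)) \<partial>lborel)"
  proof (intro Bochner_Integration.integral_cong refl)
    fix x
    show "indicator (cube T) x * p (HM x) = moore_det (hessmat (H x))"
    proof (cases "x \<in> cube T")
      case True
      then show ?thesis using p(2) [OF hHM] by (simp add: HM_def)
    next
      case False
      have "x \<notin> cball 0 R"
      proof
        assume "x \<in> cball 0 R"
        then have "x \<in> cball 0 T" using R by (simp add: T_def)
        with False show False using cball_subset_cube by blast
      qed
      then show ?thesis using False zHM [of x] by (simp add: HM_def moore_det_zero)
    qed
  qed
  finally show ?thesis .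
qed

section \<open>The quaternionic Hessian and Laplacians on quaternionic lines\<close>

lemma minus_units: "Quat 0 (- 1) 0 0 = - Quat 0 1 0 0" "Quat 0 0 (- 1) 0 = - Quat 0 0 1 0"
  "Quat 0 0 0 (- 1) = - Quat 0 0 0 1"
  by (simp_all add: uminus_quat_def)

lemma dq_sum: "dq j g z = (\<Sum>d\<in>UNIV. dir_deriv g z (qaxis (j, d)) * quat_cnj (quat_unit d))"
  by (simp add: dq_def sum_4_from_0 qaxis_def quat_units_defs [symmetric])
     (simp add: quat_cnj_def quat_units_defs minus_units flip: one_quat_def)

lemma dqbar_sum: "dqbar i g z = (\<Sum>c\<in>UNIV. quat_unit c * dir_deriv g z (qaxis (i, c)))"
  by (simp add: dqbar_def sum_4_from_0 qaxis_def quat_units_defs [symmetric])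

lemma dir_deriv_eq:
  assumes "(g has_derivative g') (at z)"
  shows "dir_deriv g z e = g' e"
proof -
  have "((\<lambda>s. g (z + s *\<^sub>R e)) has_derivative (\<lambda>s. g' (s *\<^sub>R e))) (at 0)"
    by (rule has_derivative_compose [of "\<lambda>s. z + s *\<^sub>R e" "\<lambda>s. s *\<^sub>R e" 0 UNIV g g'])
       (auto intro!: derivative_eq_intros assms)
  then have "((\<lambda>s. g (z + s *\<^sub>R e)) has_vector_derivative g' e) (at 0)"
    using has_derivative_linear [OF assms] by (simp add: has_vector_derivative_def linear_scale)
  then show ?thesis unfolding dir_deriv_def by (rule vector_derivative_at)
qed

lemma quat_hessian_eq_hessmat:
  assumes C: "C2_data f G H"
  shows "quat_hessian f z = hessmat (H z)"
proof -
  have d: "(f has_derivative (\<lambda>h. G x \<bullet> h)) (at x)" "(G has_derivative H x) (at x)" for x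
    using C by (auto simp: C2_data_def)
  have 1: "dir_deriv (\<lambda>w. of_real (f w) :: quat) x e = of_real (G x \<bullet> e)" for x e
    by (rule dir_deriv_eq) (intro has_derivative_of_real d)
  have 2: "dq j (\<lambda>w. of_real (f w)) = (\<lambda>x. \<Sum>d\<in>UNIV. (G x \<bullet> qaxis (j, d)) *\<^sub>R quat_cnj (quat_unit d))" for j
    unfolding dq_sum 1 by (simp add: of_real_def fun_eq_iff del: quat_unit_simps)
  have 3: "dir_deriv (dq j (\<lambda>w. of_real (f w))) x e = (\<Sum>d\<in>UNIV. (H x e \<bullet> qaxis (j, d)) *\<^sub>R quat_cnj (quat_unit d))" for j x e
    unfolding 2 by (rule dir_deriv_eq) (auto intro!: derivative_eq_intros d)
  have "quat_hessian f z $ i $ j = hessmat (H z) $ i $ j" for i j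
    unfolding quat_hessian_def vec_lambda_beta dqbar_sum 3 hessmat_nth
    by (simp add: sum_distrib_left del: quat_unit_simps)
  then show ?thesis by (simp add: vec_eq_iff)
qed

lemma qaxis_expand: "v = (\<Sum>r\<in>UNIV. (qaxis r \<bullet> v) *\<^sub>R qaxis r)"
proof -
  have "w \<bullet> (v - (\<Sum>r\<in>UNIV. (qaxis r \<bullet> v) *\<^sub>R qaxis r)) = 0" for w
    using qaxis_parseval [of v w] by (simp add: inner_diff_right inner_sum_right inner_commute [of w])
  from this [of "v - (\<Sum>r\<in>UNIV. (qaxis r \<bullet> v) *\<^sub>R qaxis r)"] show ?thesis
    by (simp only: inner_eq_zero_iff right_minus_eq)
qed

text \<open>
  If \<open>L\<close> is the second derivative of \<open>f\<close> at \<open>x\<close>, this is the Laplacian at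
  0 of \<open>c \<mapsto> f (x + v c)\<close>, a function of four real variables.
\<close>

definition line_laplacian :: "(quat^'n \<Rightarrow> quat^'n) \<Rightarrow> quat^'n \<Rightarrow> real" where
  "line_laplacian L v = (\<Sum>a\<in>UNIV. right_mult v (quat_unit a) \<bullet> L (right_mult v (quat_unit a)))"

text \<open>
  The quadratic form of the quaternionic Hessian at \<open>v\<close> sees exactly the Laplacian on the right
  line through \<open>v\<close>. This connects plurisubharmonicity, a condition on Laplacians, with positivity
  of a matrix.
\<close>

lemma hessmat_form:
  assumes L: "linear L"
  shows "v \<bullet> (hessmat L *v v) = line_laplacian L v"
proof -
  define V where "V a = right_mult v (quat_cnj (quat_unit a))" for a
  have u: "v \<bullet> (unit_matrix r s *v v) = (\<Sum>a\<in>UNIV. (qaxis r \<bullet> V a) * (qaxis s \<bullet> V a))" for r s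
  proof -
    have "unit_matrix r s *v v = axis (fst r) (quat_unit (snd r) * quat_cnj (quat_unit (snd s)) * v $ fst s)"
    proof -
      have "(\<Sum>j\<in>UNIV. (if i = fst r \<and> j = fst s then X else 0) * v $ j) = (if i = fst r then X * v $ fst s else 0)" for i X
      proof -
        have "(\<Sum>j\<in>UNIV. (if i = fst r \<and> j = fst s then X else 0) * v $ j) =
          (\<Sum>j\<in>UNIV. if j = fst s then if i = fst r then X * v $ j else 0 else 0)"
          by (intro sum.cong) auto
        then show ?thesis by simp
      qed
      then show ?thesis
        by (simp add: vec_eq_iff matrix_vector_mult_def unit_matrix_def axis_def del: quat_unit_simps)
    qed
    then have "v \<bullet> (unit_matrix r s *v v) =
        v $ fst r \<bullet> (quat_unit (snd r) * (quat_cnj (quat_unit (snd s)) * v $ fst s))"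
      by (simp add: inner_axis mult.assoc del: quat_unit_simps)
    also have "\<dots> = (quat_cnj (quat_unit (snd r)) * v $ fst r) \<bullet> (quat_cnj (quat_unit (snd s)) * v $ fst s)"
      by (simp add: quat_inner_mult_left del: quat_unit_simps)
    also have "\<dots> = (\<Sum>a\<in>UNIV. (quat_unit a \<bullet> (quat_cnj (quat_unit (snd r)) * v $ fst r)) *
        (quat_unit a \<bullet> (quat_cnj (quat_unit (snd s)) * v $ fst s)))"
      by (rule quat_parseval)
    also have "\<dots> = (\<Sum>a\<in>UNIV. (qaxis r \<bullet> V a) * (qaxis s \<bullet> V a))"
    proof -
      have "quat_unit a \<bullet> (quat_cnj (quat_unit (snd r)) * v $ fst r) = qaxis r \<bullet> V a" for a r
        unfolding qaxis_inner V_def right_mult_nth quat_inner_mult_left [symmetric] quat_inner_mult_right [symmetric] ..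
      then show ?thesis by simp
    qed
    finally show ?thesis .
  qed
  have "hessmat L *v v = (\<Sum>r\<in>UNIV. \<Sum>s\<in>UNIV. (L (qaxis r) \<bullet> qaxis s) *\<^sub>R (unit_matrix r s *v v))"
    unfolding hessmat_def
    using matrix_vector_mult_sum [of "\<lambda>_. 1" "\<lambda>r. \<Sum>s\<in>UNIV. (L (qaxis r) \<bullet> qaxis s) *\<^sub>R unit_matrix r s" UNIV v]
    by (simp add: matrix_vector_mult_sum)
  then have "v \<bullet> (hessmat L *v v) =
      (\<Sum>r\<in>UNIV. \<Sum>s\<in>UNIV. (L (qaxis r) \<bullet> qaxis s) * (\<Sum>a\<in>UNIV. (qaxis r \<bullet> V a) * (qaxis s \<bullet> V a)))"
    by (simp add: inner_sum_right u)
  also have "\<dots> = (\<Sum>r\<in>UNIV. \<Sum>s\<in>UNIV. \<Sum>a\<in>UNIV. (qaxis r \<bullet> V a) * (L (qaxis r) \<bullet> qaxis s) * (qaxis s \<bullet> V a))"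
    by (simp add: sum_distrib_left mult_ac)
  also have "\<dots> = (\<Sum>a\<in>UNIV. \<Sum>r\<in>UNIV. \<Sum>s\<in>UNIV. (qaxis r \<bullet> V a) * (L (qaxis r) \<bullet> qaxis s) * (qaxis s \<bullet> V a))"
    by (subst sum.swap, subst sum.swap, intro sum.cong refl)
  also have "\<dots> = (\<Sum>a\<in>UNIV. L (V a) \<bullet> V a)"
  proof (intro sum.cong refl)
    fix a
    have "L (V a) = (\<Sum>r\<in>UNIV. (qaxis r \<bullet> V a) *\<^sub>R L (qaxis r))"
      by (subst (1) qaxis_expand [of "V a"]) (simp add: linear_sum [OF L] linear_scale [OF L])
    then have "L (V a) \<bullet> V a = (\<Sum>r\<in>UNIV. (qaxis r \<bullet> V a) * (L (qaxis r) \<bullet> V a))"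
      by (simp add: inner_sum_left)
    also have "\<dots> = (\<Sum>r\<in>UNIV. (qaxis r \<bullet> V a) * (\<Sum>s\<in>UNIV. (qaxis s \<bullet> L (qaxis r)) * (qaxis s \<bullet> V a)))"
      by (simp only: qaxis_parseval)
    finally show "(\<Sum>r\<in>UNIV. \<Sum>s\<in>UNIV. (qaxis r \<bullet> V a) * (L (qaxis r) \<bullet> qaxis s) * (qaxis s \<bullet> V a)) = L (V a) \<bullet> V a"
      by (simp add: sum_distrib_left mult.assoc inner_commute [of "qaxis _" "L _"])
  qed
  also have "\<dots> = line_laplacian L v"
    unfolding line_laplacian_def
  proof (intro sum.cong refl)
    fix a :: 4
    have "quat_cnj (quat_unit a) = quat_unit a \<or> quat_cnj (quat_unit a) = - quat_unit a"
    proof -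
      have "\<forall>a. quat_cnj (quat_unit a) = quat_unit a \<or> quat_cnj (quat_unit a) = - quat_unit a"
        by (simp add: all_4 quat_cnj_def uminus_quat_def)
      then show ?thesis by blast
    qed
    then have "V a = right_mult v (quat_unit a) \<or> V a = - right_mult v (quat_unit a)"
      unfolding V_def using linear_neg [OF linear_right_mult] by metis
    then show "L (V a) \<bullet> V a = right_mult v (quat_unit a) \<bullet> L (right_mult v (quat_unit a))"
      by (auto simp: linear_neg [OF L] inner_commute)
  qed
  finally show ?thesis .
qed

lemma psd_hessmat:
  assumes "linear L" "\<And>h k. L h \<bullet> k = h \<bullet> L k" "\<And>v. 0 \<le> line_laplacian L v"
  shows "psd (hessmat L)"
  unfolding psd_def using hyperhermitian_hessmat [OF assms(2)] hessmat_form [OF assms(1)] assms(3) by simp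

lemma C2_data_taylor:
  assumes C: "C2_data f G H" and e: "0 < e"
  shows "\<exists>d>0. \<forall>h. norm h \<le> d \<longrightarrow> \<bar>f (x + h) - f x - G x \<bullet> h - (h \<bullet> H x h) / 2\<bar> \<le> e * (norm h)\<^sup>2"
proof -
  have d: "(f has_derivative (\<lambda>h. G x \<bullet> h)) (at x)" "(G has_derivative H x) (at x)"
    "H x h \<bullet> k = h \<bullet> H x k" for x h k
    using C by (auto simp: C2_data_def)
  have lH: "linear (H x)" and bH: "bounded_linear (H x)"
    using d(2) [of x] has_derivative_linear has_derivative_bounded_linear by auto
  obtain \<delta> where \<delta>: "\<delta> > 0" "\<And>h. norm h < \<delta> \<Longrightarrow> norm (G (x + h) - G x - H x h) \<le> e * norm h"
  proof -
    obtain \<delta> where "\<delta> > 0" "\<forall>y. norm (y - x) < \<delta> \<longrightarrow> norm (G y - G x - H x (y - x)) \<le> e * norm (y - x)"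
      using d(2) [of x] e unfolding has_derivative_at_alt by blast
    then show ?thesis using that [of \<delta>] by (metis add_diff_cancel_left')
  qed
  define r where "r h = f (x + h) - f x - G x \<bullet> h - (h \<bullet> H x h) / 2" for h
  have dr: "(r has_derivative (\<lambda>k. (G (x + h) - G x - H x h) \<bullet> k)) (at h)" for h
  proof -
    have "((\<lambda>h. f (x + h)) has_derivative (\<lambda>k. G (x + h) \<bullet> k)) (at h)"
      by (rule has_derivative_compose [of "\<lambda>h. x + h" "\<lambda>k. k" h UNIV f]) (auto intro!: derivative_eq_intros d)
    moreover have "((\<lambda>h. G x \<bullet> h) has_derivative (\<lambda>k. G x \<bullet> k)) (at h)"
      by (intro derivative_intros)
    moreover have "((\<lambda>h. h \<bullet> H x h) has_derivative (\<lambda>k. h \<bullet> H x k + k \<bullet> H x h)) (at h)"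
      by (intro has_derivative_inner has_derivative_ident bounded_linear.has_derivative [OF bH])
    ultimately have "(r has_derivative (\<lambda>k. G (x + h) \<bullet> k - 0 - G x \<bullet> k - (h \<bullet> H x k + k \<bullet> H x h) / 2)) (at h)"
      unfolding r_def [abs_def]
      by (intro has_derivative_diff has_derivative_const bounded_linear.has_derivative [OF bounded_linear_divide])
    moreover have "h \<bullet> H x k = k \<bullet> H x h" for k
      using d(3) [of x h k] by (simp add: inner_commute)
    ultimately show ?thesis by (simp add: inner_diff_left inner_diff_right inner_commute)
  qed
  have "\<bar>r h\<bar> \<le> e * (norm h)\<^sup>2" if h: "norm h < \<delta>" for h
  proof -
    have "norm (r h - r 0) \<le> e * norm h * norm (h - 0)"
    proof (rule differentiable_bound [of "cball 0 (norm h)"])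
      show "(r has_derivative (\<lambda>k. (G (x + y) - G x - H x y) \<bullet> k)) (at y within cball 0 (norm h))" for y
        by (rule has_derivative_at_withinI [OF dr])
      show "onorm (\<lambda>k. (G (x + y) - G x - H x y) \<bullet> k) \<le> e * norm h" if "y \<in> cball 0 (norm h)" for y
      proof (rule onorm_le)
        fix k
        have "norm ((G (x + y) - G x - H x y) \<bullet> k) \<le> norm (G (x + y) - G x - H x y) * norm k"
          by (simp add: Cauchy_Schwarz_ineq2)
        also have "\<dots> \<le> (e * norm h) * norm k"
        proof (rule mult_right_mono)
          have "norm y \<le> norm h" using that by simp
          then show "norm (G (x + y) - G x - H x y) \<le> e * norm h"
            using \<delta>(2) [of y] h e by (meson le_less_trans mult_left_mono order_trans less_imp_le)
        qed simp
        finally show "norm ((G (x + y) - G x - H x y) \<bullet> k) \<le> e * norm h * norm k" .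
      qed
    qed auto
    moreover have "r 0 = 0" by (simp add: r_def linear_0 [OF lH])
    ultimately show ?thesis by (simp add: power2_eq_square mult_ac)
  qed
  then show ?thesis using \<delta>(1) by (intro exI [of _ "\<delta> / 2"]) (auto simp: r_def)
qed

section \<open>Means over spheres in the quaternions\<close>

text \<open>
  Left multiplication by \<open>i\<close>, \<open>j\<close> or \<open>k\<close> permutes the four real
  coordinates up to signs, so it maps boxes to boxes of the same volume.
\<close>

lemma lborel_left_mult:
  assumes "p \<in> {quat_i, quat_j, quat_k}"
  shows "distr lborel borel ((*) p) = lborel"
proof (rule sym, rule lborel_eqI)
  have cont: "continuous_on UNIV ((*) p)" by (intro continuous_intros)
  have [measurable]: "(*) p \<in> borel_measurable borel" by (rule borel_measurable_continuous_onI [OF cont])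
  have mb: "y \<in> box l u \<longleftrightarrow> qRe l < qRe y \<and> qRe y < qRe u \<and> qIm1 l < qIm1 y \<and> qIm1 y < qIm1 u \<and>
      qIm2 l < qIm2 y \<and> qIm2 y < qIm2 u \<and> qIm3 l < qIm3 y \<and> qIm3 y < qIm3 u" for y l u :: quat
    by (auto simp: mem_box Basis_quat_def quat_units_defs inner_quat_def)
  have pb: "(\<Prod>b\<in>Basis. y \<bullet> b) = qRe y * qIm1 y * qIm2 y * qIm3 y" for y :: quat
    by (simp add: Basis_quat_def quat_units_defs inner_quat_def mult.assoc)
  fix l u :: quat
  assume le0: "\<And>b. b \<in> Basis \<Longrightarrow> l \<bullet> b \<le> u \<bullet> b"
  have le: "qRe l \<le> qRe u" "qIm1 l \<le> qIm1 u" "qIm2 l \<le> qIm2 u" "qIm3 l \<le> qIm3 u"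
    using le0 [of 1] le0 [of quat_i] le0 [of quat_j] le0 [of quat_k]
    by (simp_all only: Basis_quat_def insert_iff simp_thms) (simp_all add: inner_quat_def quat_units_defs)
  have *: "emeasure lborel (box l' u') = ennreal (\<Prod>b\<in>Basis. (u - l) \<bullet> b)"
    if "qRe l' \<le> qRe u'" "qIm1 l' \<le> qIm1 u'" "qIm2 l' \<le> qIm2 u'" "qIm3 l' \<le> qIm3 u'"
      "(\<Prod>b\<in>Basis. (u' - l') \<bullet> b) = (\<Prod>b\<in>Basis. (u - l) \<bullet> b)" for l' u' :: quat
  proof -
    have "l' \<bullet> b \<le> u' \<bullet> b" if "b \<in> Basis" for b
      using that \<open>qRe l' \<le> qRe u'\<close> \<open>qIm1 l' \<le> qIm1 u'\<close> \<open>qIm2 l' \<le> qIm2 u'\<close> \<open>qIm3 l' \<le> qIm3 u'\<close>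
      by (auto simp: Basis_quat_def quat_units_defs inner_quat_def)
    then show ?thesis using that(5) by simp
  qed
  have "emeasure (distr lborel borel ((*) p)) (box l u) = emeasure lborel ((*) p -` box l u)"
    by (subst emeasure_distr) auto
  also have "\<dots> = ennreal (\<Prod>b\<in>Basis. (u - l) \<bullet> b)"
    using assms
  proof (elim insertE)
    assume p: "p = quat_i"
    have "(*) p -` box l u = box (Quat (qIm1 l) (- qRe u) (qIm3 l) (- qIm2 u)) (Quat (qIm1 u) (- qRe l) (qIm3 u) (- qIm2 l))"
      by (auto simp: p mb times_quat_def quat_units_defs)
    then show ?thesis
      by (simp only:, intro *) (use le in \<open>simp_all add: pb minus_quat_def mult_ac\<close>)
  next
    assume p: "p = quat_j"
    have "(*) p -` box l u = box (Quat (qIm2 l) (- qIm3 u) (- qRe u) (qIm1 l)) (Quat (qIm2 u) (- qIm3 l) (- qRe l) (qIm1 u))"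
      by (auto simp: p mb times_quat_def quat_units_defs)
    then show ?thesis
      by (simp only:, intro *) (use le in \<open>simp_all add: pb minus_quat_def mult_ac\<close>)
  next
    assume p: "p = quat_k"
    have "(*) p -` box l u = box (Quat (qIm3 l) (qIm2 l) (- qIm1 u) (- qRe u)) (Quat (qIm3 u) (qIm2 u) (- qIm1 l) (- qRe l))"
      by (auto simp: p mb times_quat_def quat_units_defs)
    then show ?thesis
      by (simp only:, intro *) (use le in \<open>simp_all add: pb minus_quat_def mult_ac\<close>)
  qed simp
  finally show "emeasure (distr lborel borel ((*) p)) (box l u) = ennreal (\<Prod>b\<in>Basis. (u - l) \<bullet> b)" .
qed simp

text \<open>
  Means over spheres are integrals with respect to this measure after radial projection.
\<close>

definition unit_ball_prob :: "quat measure" where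
  "unit_ball_prob = uniform_measure lborel (ball 0 1)"

lemma sets_unit_ball_prob [measurable_cong]: "sets unit_ball_prob = sets borel"
  by (simp add: unit_ball_prob_def)

lemma emeasure_unit_ball_prob: "emeasure unit_ball_prob UNIV = 1"
proof -
  have "emeasure lborel (ball (0::quat) 1) \<noteq> 0"
    using content_ball_pos [of 1 "0::quat"] by (auto simp: measure_def)
  moreover have "emeasure lborel (ball (0::quat) 1) < \<infinity>"
    by (rule emeasure_bounded_finite) simp
  ultimately show ?thesis
    unfolding unit_ball_prob_def by (subst emeasure_uniform_measure) (auto simp: ennreal_divide_self)
qed

lemma space_unit_ball_prob: "space unit_ball_prob = UNIV"
  by (simp add: unit_ball_prob_def)

lemma finite_measure_unit_ball_prob: "finite_measure unit_ball_prob"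
  by (rule finite_measureI) (simp add: space_unit_ball_prob emeasure_unit_ball_prob)

lemma unit_ball_prob_left_mult:
  assumes "p \<in> {quat_i, quat_j, quat_k}"
  shows "distr unit_ball_prob borel ((*) p) = unit_ball_prob"
proof (rule measure_eqI)
  have cont: "continuous_on UNIV ((*) p)" by (intro continuous_intros)
  have [measurable]: "(*) p \<in> borel_measurable borel" by (rule borel_measurable_continuous_onI [OF cont])
  have np: "norm p = 1" using assms by (auto simp: norm_quat_def inner_quat_def quat_units_defs)
  fix A assume "A \<in> sets (distr unit_ball_prob borel ((*) p))"
  then have [measurable]: "A \<in> sets borel" by simp
  have [measurable]: "(*) p -` A \<in> sets borel" using measurable_sets [of "(*) p" borel borel A] by simp
  have "emeasure (distr unit_ball_prob borel ((*) p)) A = emeasure unit_ball_prob ((*) p -` A)"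
    by (subst emeasure_distr) (auto simp: unit_ball_prob_def)
  also have "\<dots> = emeasure lborel (ball 0 1 \<inter> (*) p -` A) / emeasure lborel (ball (0::quat) 1)"
    unfolding unit_ball_prob_def by (rule emeasure_uniform_measure) auto
  also have "ball 0 1 \<inter> (*) p -` A = (*) p -` (ball 0 1 \<inter> A)"
    by (auto simp: norm_mult np)
  also have "emeasure lborel ((*) p -` (ball 0 1 \<inter> A)) = emeasure (distr lborel borel ((*) p)) (ball 0 1 \<inter> A)"
    by (subst emeasure_distr) auto
  also have "\<dots> = emeasure lborel (ball 0 1 \<inter> A)" by (simp add: lborel_left_mult [OF assms])
  also have "\<dots> / emeasure lborel (ball (0::quat) 1) = emeasure unit_ball_prob A"
    unfolding unit_ball_prob_def by (rule emeasure_uniform_measure [symmetric]) auto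
  finally show "emeasure (distr unit_ball_prob borel ((*) p)) A = emeasure unit_ball_prob A" .
qed (simp add: unit_ball_prob_def)

lemma borel_measurable_quat_sgn [measurable]: "(sgn :: quat \<Rightarrow> quat) \<in> borel_measurable borel"
  unfolding sgn_div_norm [abs_def] by measurable

lemma integral_unit_ball_left_mult:
  fixes g :: "quat \<Rightarrow> real"
  assumes p: "p \<in> {quat_i, quat_j, quat_k}" and [measurable]: "g \<in> borel_measurable borel"
  shows "(\<integral>y. g (p * sgn y) \<partial>unit_ball_prob) = (\<integral>y. g (sgn y) \<partial>unit_ball_prob)"
proof -
  have cont: "continuous_on UNIV ((*) p)" by (intro continuous_intros)
  have [measurable]: "(*) p \<in> borel_measurable borel" by (rule borel_measurable_continuous_onI [OF cont])
  have "norm p = 1" using p by (auto simp: norm_quat_def inner_quat_def quat_units_defs)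
  then have s: "sgn (p * y) = p * sgn y" for y by (simp add: sgn_div_norm norm_mult)
  have "(\<integral>y. g (sgn y) \<partial>unit_ball_prob) = (\<integral>y. g (sgn y) \<partial>(distr unit_ball_prob borel ((*) p)))"
    by (simp only: unit_ball_prob_left_mult [OF p])
  also have "\<dots> = (\<integral>y. g (sgn (p * y)) \<partial>unit_ball_prob)"
    by (intro integral_distr) measurable
  finally show ?thesis by (simp add: s)
qed

text \<open>
  For \<open>|s| = 1\<close> the vectors \<open>quat_unit c * s\<close> form an orthonormal basis, and the trace
  can be computed in any orthonormal basis.
\<close>

lemma trace_left_mult:
  assumes B: "linear B"
  shows "(\<Sum>c\<in>UNIV. (quat_unit c * s) \<bullet> B (quat_unit c * s)) = (norm s)\<^sup>2 * (\<Sum>c\<in>UNIV. quat_unit c \<bullet> B (quat_unit c))"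
proof -
  define m where "m c d = quat_unit d \<bullet> (quat_unit c * s)" for c d
  have mm: "(\<Sum>c\<in>UNIV. m c d * m c e) = (if d = e then (norm s)\<^sup>2 else 0)" for d e
  proof -
    have "m c d = quat_unit c \<bullet> (quat_unit d * quat_cnj s)" for c d
      unfolding m_def quat_inner_mult_right [symmetric] by (rule inner_commute)
    then have "(\<Sum>c\<in>UNIV. m c d * m c e) = (quat_unit d * quat_cnj s) \<bullet> (quat_unit e * quat_cnj s)"
      by (simp only: quat_parseval [of "quat_unit d * quat_cnj s" "quat_unit e * quat_cnj s"])
    also have "\<dots> = quat_unit d \<bullet> (quat_unit e * (quat_cnj s * s))"
      by (simp only: quat_inner_mult_right quat_cnj_cnj mult.assoc)
    also have "quat_cnj s * s = (norm s)\<^sup>2 *\<^sub>R 1"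
      by (cases s) (simp add: power2_norm_eq_inner inner_quat_def times_quat_def quat_cnj_def
        scaleR_quat_def one_quat_def algebra_simps)
    finally show ?thesis by (simp add: quat_unit_inner del: quat_unit_simps)
  qed
  have ex: "quat_unit c * s = (\<Sum>d\<in>UNIV. m c d *\<^sub>R quat_unit d)" for c
    unfolding m_def by (rule quat_sum_units)
  have "(\<Sum>c\<in>UNIV. (quat_unit c * s) \<bullet> B (quat_unit c * s)) =
    (\<Sum>c\<in>UNIV. \<Sum>d\<in>UNIV. \<Sum>e\<in>UNIV. m c d * m c e * (quat_unit e \<bullet> B (quat_unit d)))"
    unfolding ex linear_sum [OF B] linear_scale [OF B] inner_sum_left inner_sum_right
    by (simp add: sum_distrib_left mult_ac del: quat_unit_simps)
  also have "\<dots> = (\<Sum>d\<in>UNIV. \<Sum>e\<in>UNIV. (\<Sum>c\<in>UNIV. m c d * m c e) * (quat_unit e \<bullet> B (quat_unit d)))"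
    unfolding sum_distrib_right
    by (subst sum.swap) (rule sum.cong [OF refl], rule sum.swap)
  also have "\<dots> = (norm s)\<^sup>2 * (\<Sum>c\<in>UNIV. quat_unit c \<bullet> B (quat_unit c))"
    by (simp add: mm if_distrib [of "\<lambda>x. x * _"] sum_distrib_left del: quat_unit_simps cong: if_cong)
  finally show ?thesis .
qed

lemma AE_unit_ball_nonzero: "AE y in unit_ball_prob. y \<noteq> 0"
proof (rule AE_I [where N = "{0}"])
  have "emeasure unit_ball_prob {0} = emeasure lborel (ball (0::quat) 1 \<inter> {0}) / emeasure lborel (ball (0::quat) 1)"
    unfolding unit_ball_prob_def by (rule emeasure_uniform_measure) auto
  then show "emeasure unit_ball_prob {0} = 0" by simp
qed (auto simp: unit_ball_prob_def)

text \<open>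
  Averaging over left multiplication by the four units replaces invariance under all rotations: the average of a
  quadratic form over the four points \<open>c s\<close> is a quarter of its trace for every unit quaternion
  \<open>s\<close>. The linear term is odd, and \<open>i\<^sup>2 = -1\<close> is the reflection.
\<close>

lemma integral_unit_ball_quadratic:
  fixes B :: "quat \<Rightarrow> quat"
  assumes B: "linear B"
  shows "(\<integral>y. a + l \<bullet> sgn y + sgn y \<bullet> B (sgn y) \<partial>unit_ball_prob) = a + (\<Sum>c\<in>UNIV. quat_unit c \<bullet> B (quat_unit c)) / 4"
proof -
  interpret finite_measure unit_ball_prob by (rule finite_measure_unit_ball_prob)
  have cB: "continuous_on UNIV B" using B linear_conv_bounded_linear linear_continuous_on by blast
  have bB: "\<exists>M. \<forall>y. norm y \<le> 1 \<longrightarrow> \<bar>g y\<bar> \<le> M" if "continuous_on UNIV g" for g :: "quat \<Rightarrow> real"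
  proof -
    have "compact (g ` cball 0 1)" by (intro compact_continuous_image continuous_on_subset [OF that]) auto
    then show ?thesis using compact_imp_bounded bounded_iff by (metis imageI mem_cball_0 real_norm_def)
  qed
  have int: "integrable unit_ball_prob (\<lambda>y. g (sgn y))" if g: "continuous_on UNIV g" for g :: "quat \<Rightarrow> real"
  proof -
    obtain M where M: "\<And>y. norm y \<le> 1 \<Longrightarrow> \<bar>g y\<bar> \<le> M" using bB [OF g] by blast
    have [measurable]: "g \<in> borel_measurable borel" by (rule borel_measurable_continuous_onI [OF g])
    show ?thesis
      by (rule integrable_const_bound [where B = M]) (auto intro!: M simp: norm_sgn)
  qed
  have c1: "continuous_on UNIV (\<lambda>y. y \<bullet> B y)" "continuous_on UNIV (\<lambda>y. l \<bullet> y)" for l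
    by (intro continuous_intros cB)+
  have cp: "continuous_on UNIV (\<lambda>y. (p * y) \<bullet> B (p * y))" for p
    by (intro continuous_intros continuous_on_compose2 [OF cB]) auto
  have lin: "(\<integral>y. l \<bullet> sgn y \<partial>unit_ball_prob) = 0"
  proof -
    have m: "(\<lambda>y. l \<bullet> y) \<in> borel_measurable borel" "(\<lambda>y. l \<bullet> (quat_i * y)) \<in> borel_measurable borel"
      by (intro borel_measurable_continuous_onI continuous_intros)+
    have "(\<integral>y. l \<bullet> sgn y \<partial>unit_ball_prob) = (\<integral>y. l \<bullet> (quat_i * sgn y) \<partial>unit_ball_prob)"
      using integral_unit_ball_left_mult [of quat_i "\<lambda>y. l \<bullet> y"] m by simp
    also have "\<dots> = (\<integral>y. l \<bullet> (quat_i * (quat_i * sgn y)) \<partial>unit_ball_prob)"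
      using integral_unit_ball_left_mult [of quat_i "\<lambda>y. l \<bullet> (quat_i * y)"] m by simp
    also have "\<dots> = - (\<integral>y. l \<bullet> sgn y \<partial>unit_ball_prob)"
      by (simp add: mult.assoc [symmetric] quat_unit_relations)
    finally show ?thesis by simp
  qed
  let ?q = "\<lambda>y. y \<bullet> B y"
  have inv: "(\<integral>y. ?q (quat_unit c * sgn y) \<partial>unit_ball_prob) = (\<integral>y. ?q (sgn y) \<partial>unit_ball_prob)" for c
  proof (cases "c = 0")
    case True
    then show ?thesis by (simp flip: one_quat_def)
  next
    case False
    then have "quat_unit c \<in> {quat_i, quat_j, quat_k}" by (simp add: quat_unit_def)
    from integral_unit_ball_left_mult [OF this borel_measurable_continuous_onI [OF c1(1)]] show ?thesis .
  qed
  have "4 * (\<integral>y. ?q (sgn y) \<partial>unit_ball_prob) = (\<Sum>c\<in>(UNIV::4 set). \<integral>y. ?q (quat_unit c * sgn y) \<partial>unit_ball_prob)"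
    by (simp add: inv del: quat_unit_simps)
  also have "\<dots> = (\<integral>y. (\<Sum>c\<in>UNIV. ?q (quat_unit c * sgn y)) \<partial>unit_ball_prob)"
    by (subst Bochner_Integration.integral_sum) (rule int [OF cp], rule refl)
  also have "\<dots> = (\<integral>y. (\<Sum>c\<in>UNIV. ?q (quat_unit c)) \<partial>unit_ball_prob)"
  proof (rule integral_cong_AE)
    show "AE y in unit_ball_prob. (\<Sum>c\<in>UNIV. ?q (quat_unit c * sgn y)) = (\<Sum>c\<in>UNIV. ?q (quat_unit c))"
      using AE_unit_ball_nonzero by eventually_elim (simp add: trace_left_mult [OF B] norm_sgn del: quat_unit_simps)
    show "(\<lambda>y. \<Sum>c\<in>UNIV. ?q (quat_unit c * sgn y)) \<in> borel_measurable unit_ball_prob"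
      by (intro borel_measurable_sum borel_measurable_integrable int [OF cp])
  qed simp
  also have "\<dots> = (\<Sum>c\<in>UNIV. ?q (quat_unit c))"
    by (simp add: measure_def space_unit_ball_prob emeasure_unit_ball_prob del: quat_unit_simps)
  finally have q: "(\<integral>y. ?q (sgn y) \<partial>unit_ball_prob) = (\<Sum>c\<in>UNIV. ?q (quat_unit c)) / 4" by (simp del: quat_unit_simps)
  have "(\<integral>y. a + l \<bullet> sgn y + sgn y \<bullet> B (sgn y) \<partial>unit_ball_prob) =
      (\<integral>y. a \<partial>unit_ball_prob) + (\<integral>y. l \<bullet> sgn y \<partial>unit_ball_prob) + (\<integral>y. ?q (sgn y) \<partial>unit_ball_prob)"
    using int [OF c1(1)] int [OF c1(2)] by simp
  then show ?thesis
    by (simp add: lin q measure_def space_unit_ball_prob emeasure_unit_ball_prob del: quat_unit_simps)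
qed

lemma sphere_measure_alt: "sphere_measure x r = distr unit_ball_prob borel (\<lambda>y. x + r *\<^sub>R sgn y)" for x :: quat
  by (simp add: sphere_measure_def unit_ball_prob_def)

lemma sets_sphere_measure [measurable_cong]: "sets (sphere_measure x r) = sets borel" for x :: quat
  by (simp add: sphere_measure_alt)

lemma finite_measure_sphere_measure: "finite_measure (sphere_measure x r)" for x :: quat
proof -
  have [measurable]: "(\<lambda>y. x + r *\<^sub>R sgn y) \<in> measurable unit_ball_prob borel" by measurable
  show ?thesis
    unfolding sphere_measure_alt
    by (rule finite_measure.finite_measure_distr [OF finite_measure_unit_ball_prob]) measurable
qed

lemma set_integrable_sphere_continuous:
  fixes f :: "quat \<Rightarrow> real"
  assumes "continuous_on (sphere x r) f"
  shows "set_integrable (sphere_measure x r) (sphere x r) f"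
proof -
  interpret finite_measure "sphere_measure x r" by (rule finite_measure_sphere_measure)
  have "compact (f ` sphere x r)" by (intro compact_continuous_image assms) auto
  then obtain M where M: "\<And>y. y \<in> sphere x r \<Longrightarrow> \<bar>f y\<bar> \<le> M" "0 \<le> M"
    using compact_imp_bounded bounded_pos by (metis imageI real_norm_def less_imp_le)
  have "(\<lambda>y. indicator (sphere x r) y *\<^sub>R f y) \<in> borel_measurable borel"
    by (rule borel_measurable_continuous_on_indicator) (use assms in auto)
  then have m: "(\<lambda>y. indicator (sphere x r) y *\<^sub>R f y) \<in> borel_measurable (sphere_measure x r)"
    using measurable_cong_sets [OF sets_sphere_measure refl] by blast
  show ?thesis
    unfolding set_integrable_def
    by (rule integrable_const_bound [where B = M, OF _ m]) (use M in \<open>auto simp: indicator_def\<close>)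
qed

lemma sphere_mean_quadratic:
  fixes B :: "quat \<Rightarrow> quat"
  assumes r: "0 < r" and B: "linear B"
  shows "(LINT y:sphere x r|sphere_measure x r. a + l \<bullet> (y - x) + (y - x) \<bullet> B (y - x)) =
    a + r\<^sup>2 / 4 * (\<Sum>c\<in>UNIV. quat_unit c \<bullet> B (quat_unit c))"
proof -
  let ?g = "\<lambda>y. a + l \<bullet> (y - x) + (y - x) \<bullet> B (y - x)"
  have cB: "continuous_on UNIV B" using B linear_conv_bounded_linear linear_continuous_on by blast
  have cg: "continuous_on UNIV ?g" by (intro continuous_intros continuous_on_compose2 [OF cB]) auto
  have mg: "?g \<in> borel_measurable borel" by (rule borel_measurable_continuous_onI [OF cg])
  define g where "g y = indicator (sphere x r) y *\<^sub>R ?g y" for y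
  have [measurable]: "g \<in> borel_measurable borel"
    unfolding g_def by (intro borel_measurable_scaleR mg borel_measurable_indicator) simp
  have lB: "linear (\<lambda>y. r\<^sup>2 *\<^sub>R B y)" by (rule linear_compose_scale_right [OF B])
  have "(LINT y:sphere x r|sphere_measure x r. ?g y) =
      (\<integral>y. g (x + r *\<^sub>R sgn y) \<partial>unit_ball_prob)"
    unfolding set_lebesgue_integral_def sphere_measure_alt g_def [symmetric]
    by (rule integral_distr) measurable
  also have "\<dots> = (\<integral>y. a + (r *\<^sub>R l) \<bullet> sgn y + sgn y \<bullet> (r\<^sup>2 *\<^sub>R B (sgn y)) \<partial>unit_ball_prob)"
  proof (rule integral_cong_AE)
    have cq: "continuous_on UNIV (\<lambda>y. a + (r *\<^sub>R l) \<bullet> y + y \<bullet> (r\<^sup>2 *\<^sub>R B y))"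
      by (intro continuous_intros cB)
    have [measurable]: "(\<lambda>y. a + (r *\<^sub>R l) \<bullet> y + y \<bullet> (r\<^sup>2 *\<^sub>R B y)) \<in> borel_measurable borel"
      by (rule borel_measurable_continuous_onI [OF cq])
    have "(\<lambda>y. (\<lambda>y. a + (r *\<^sub>R l) \<bullet> y + y \<bullet> (r\<^sup>2 *\<^sub>R B y)) (sgn y)) \<in> borel_measurable unit_ball_prob"
      by measurable
    then show "(\<lambda>y. a + (r *\<^sub>R l) \<bullet> sgn y + sgn y \<bullet> (r\<^sup>2 *\<^sub>R B (sgn y))) \<in> borel_measurable unit_ball_prob" .
    show "(\<lambda>y. g (x + r *\<^sub>R sgn y)) \<in> borel_measurable unit_ball_prob"
      by measurable
    show "AE y in unit_ball_prob. g (x + r *\<^sub>R sgn y) = a + (r *\<^sub>R l) \<bullet> sgn y + sgn y \<bullet> (r\<^sup>2 *\<^sub>R B (sgn y))"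
      using AE_unit_ball_nonzero
    proof eventually_elim
      case (elim y)
      then have "x + r *\<^sub>R sgn y \<in> sphere x r" using r by (simp add: dist_norm norm_sgn)
      then show ?case by (simp add: g_def linear_scale [OF B] power2_eq_square)
    qed
  qed
  also have "\<dots> = a + r\<^sup>2 / 4 * (\<Sum>c\<in>UNIV. quat_unit c \<bullet> B (quat_unit c))"
    unfolding integral_unit_ball_quadratic [OF lB]
    by (simp add: sum_distrib_left [symmetric] del: quat_unit_simps)
  finally show ?thesis .
qed

section \<open>Plurisubharmonicity and nonnegative Hessians\<close>

text \<open>
  The second derivative of \<open>c \<mapsto> f (x + v c)\<close> as an operator on the quaternions; its trace
  is the Laplacian on the line.
\<close>

definition pullback_form :: "(quat^'n \<Rightarrow> quat^'n) \<Rightarrow> quat^'n \<Rightarrow> quat \<Rightarrow> quat" where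
  "pullback_form L v c = (\<Sum>d\<in>UNIV. (right_mult v (quat_unit d) \<bullet> L (right_mult v c)) *\<^sub>R quat_unit d)"

lemma pullback_form:
  assumes L: "linear L"
  shows "linear (pullback_form L v)" "c \<bullet> pullback_form L v c' = right_mult v c \<bullet> L (right_mult v c')"
    "(\<Sum>c\<in>UNIV. quat_unit c \<bullet> pullback_form L v (quat_unit c)) = line_laplacian L v"
proof -
  show "linear (pullback_form L v)"
    by (rule linearI)
       (simp_all add: pullback_form_def linear_add [OF linear_right_mult] linear_scale [OF linear_right_mult]
        linear_add [OF L] linear_scale [OF L] inner_add_right scaleR_add_left sum.distrib scaleR_sum_right
        del: quat_unit_simps)
  show *: "c \<bullet> pullback_form L v c' = right_mult v c \<bullet> L (right_mult v c')" for c c'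
    by (subst right_mult_units [of v c])
       (simp add: pullback_form_def inner_sum_left inner_sum_right inner_commute [of c] mult.commute del: quat_unit_simps)
  show "(\<Sum>c\<in>UNIV. quat_unit c \<bullet> pullback_form L v (quat_unit c)) = line_laplacian L v"
    by (simp only: * line_laplacian_def)
qed

lemma pullback_linear: "\<exists>l. \<forall>c. l \<bullet> c = G \<bullet> right_mult v c"
proof (intro exI allI)
  fix c
  show "(\<Sum>d\<in>UNIV. (G \<bullet> right_mult v (quat_unit d)) *\<^sub>R quat_unit d) \<bullet> c = G \<bullet> right_mult v c"
    by (subst right_mult_units [of v c]) (simp add: inner_sum_left inner_sum_right mult.commute del: quat_unit_simps)
qed

lemma trace_identity: "(\<Sum>c\<in>UNIV. quat_unit c \<bullet> (e *\<^sub>R quat_unit c)) = 4 * e"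
  by (simp add: quat_unit_inner del: quat_unit_simps)

text \<open>
  A maximum principle that survives uniform limits without convergence of derivatives. If the Laplacian were
  negative, a quadratic polynomial \<open>q\<close> with negative Laplacian would touch \<open>F\<close> on the
  line from above at 0, strictly away from 0. A function \<open>g\<close> uniformly close to \<open>F\<close>
  then still has a shifted copy of \<open>q\<close> touching it from above at an interior point, where the
  sub-mean inequality of \<open>g\<close> contradicts the negative Laplacian of \<open>q\<close>.
\<close>

lemma line_laplacian_nonneg_of_approximation:
  fixes F :: "quat^'n \<Rightarrow> real"
  assumes C: "C2_data F G H" and \<delta>0: "0 < \<delta>0"
    and approx: "\<And>\<tau>. 0 < \<tau> \<Longrightarrow> \<exists>g. continuous_on (cball 0 \<delta>0) g \<and>
      (\<forall>c\<in>cball 0 \<delta>0. \<bar>g c - F (x + right_mult v c)\<bar> \<le> \<tau>) \<and>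
      (\<forall>c\<in>ball 0 \<delta>0. \<forall>\<^sub>F r in at_right 0. g c \<le> (LINT y:sphere c r|sphere_measure c r. g y))"
  shows "0 \<le> line_laplacian (H x) v"
proof (rule ccontr)
  assume "\<not> ?thesis"
  then have neg: "line_laplacian (H x) v < 0" by simp
  (* One eta bounds the Taylor remainder, a second one makes the contact strict. Together they add 8 eta to the
     trace of the form of q, a quarter of the absolute value of the Laplacian; half of it is available. *)
  define \<eta> where "\<eta> = - line_laplacian (H x) v / 32"
  have \<eta>: "0 < \<eta>" using neg by (simp add: \<eta>_def)
  have lH: "linear (H x)" and sH: "H x h \<bullet> k = h \<bullet> H x k" for h k
    using C C2_data_continuous(4) by (auto simp: C2_data_def)
  define P where "P = pullback_form (H x) v"
  note Pf = pullback_form [OF lH, where v = v, folded P_def]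
  have sP: "c \<bullet> P c' = c' \<bullet> P c" for c c'
    unfolding Pf(2) using sH [of "right_mult v c'" "right_mult v c"] by (simp add: inner_commute)
  obtain l where l: "\<And>c. l \<bullet> c = G x \<bullet> right_mult v c" using pullback_linear by blast
  obtain \<delta>1 where \<delta>1: "0 < \<delta>1" "\<And>h. norm h \<le> \<delta>1 \<Longrightarrow>
      \<bar>F (x + h) - F x - G x \<bullet> h - (h \<bullet> H x h) / 2\<bar> \<le> \<eta> / ((norm v)\<^sup>2 + 1) * (norm h)\<^sup>2"
    using C2_data_taylor [OF C, of "\<eta> / ((norm v)\<^sup>2 + 1)" x] \<eta> by (auto simp: add_nonneg_pos)
  define \<delta> where "\<delta> = min \<delta>0 (\<delta>1 / (norm v + 1))"
  have \<delta>: "0 < \<delta>" "\<delta> \<le> \<delta>0" using \<delta>0 \<delta>1(1) by (auto simp: \<delta>_def add_nonneg_pos)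
  have taylor: "F (x + right_mult v c) \<le> F x + l \<bullet> c + (c \<bullet> P c) / 2 + \<eta> * (norm c)\<^sup>2" if "norm c \<le> \<delta>" for c
  proof -
    have "norm v * norm c \<le> (norm v + 1) * (\<delta>1 / (norm v + 1))"
      using that by (intro mult_mono) (auto simp: \<delta>_def)
    also have "\<dots> = \<delta>1" by (metis add.commute add_pos_nonneg less_irrefl norm_ge_zero nonzero_mult_div_cancel_left times_divide_eq_right zero_less_one)
    finally have "norm (right_mult v c) \<le> \<delta>1" by (simp add: norm_right_mult)
    then have "F (x + right_mult v c) \<le> F x + G x \<bullet> right_mult v c + (right_mult v c \<bullet> H x (right_mult v c)) / 2 +
        \<eta> / ((norm v)\<^sup>2 + 1) * (norm (right_mult v c))\<^sup>2"
      using \<delta>1(2) [of "right_mult v c"] by linarith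
    also have "\<eta> / ((norm v)\<^sup>2 + 1) * (norm (right_mult v c))\<^sup>2 \<le> \<eta> * (norm c)\<^sup>2"
    proof -
      have "(norm v)\<^sup>2 / ((norm v)\<^sup>2 + 1) \<le> 1" by (simp add: divide_le_eq_1 add_nonneg_pos)
      then have "\<eta> * (norm c)\<^sup>2 * ((norm v)\<^sup>2 / ((norm v)\<^sup>2 + 1)) \<le> \<eta> * (norm c)\<^sup>2 * 1"
        using \<eta> by (intro mult_left_mono) auto
      then show ?thesis by (simp add: norm_right_mult power_mult_distrib mult_ac)
    qed
    finally show ?thesis by (simp add: l Pf(2))
  qed
  define Q where "Q c = (1 / 2) *\<^sub>R P c + (2 * \<eta>) *\<^sub>R c" for c
  have lQ: "linear Q" unfolding Q_def
    by (intro linear_compose_add linear_compose_scale_right Pf(1)) (rule linear_ident)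
  have sQ: "c \<bullet> Q c' = c' \<bullet> Q c" for c c'
    using sP [of c c'] by (simp add: Q_def inner_add_right inner_commute)
  have trQ: "(\<Sum>c\<in>UNIV. quat_unit c \<bullet> Q (quat_unit c)) < 0"
  proof -
    have "(\<Sum>c\<in>UNIV. quat_unit c \<bullet> Q (quat_unit c)) = line_laplacian (H x) v / 2 + 8 * \<eta>"
      using trace_identity [of "2 * \<eta>"]
      by (simp add: Q_def inner_add_right sum.distrib Pf(3) [symmetric] sum_divide_distrib del: quat_unit_simps)
    then show ?thesis using neg by (simp add: \<eta>_def)
  qed
  define q where "q c = l \<bullet> c + c \<bullet> Q c" for c
  have cQ: "continuous_on A Q" for A
    using lQ linear_conv_bounded_linear linear_continuous_on by blast
  have cq: "continuous_on A q" for A unfolding q_def by (intro continuous_intros cQ)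
  have Fq: "F (x + right_mult v c) - q c \<le> F x - \<eta> * (norm c)\<^sup>2" if "norm c \<le> \<delta>" for c
    using taylor [OF that] by (simp add: q_def Q_def inner_add_right power2_norm_eq_inner)
  obtain g where cg: "continuous_on (cball 0 \<delta>0) g"
    and gF: "\<And>c. c \<in> cball 0 \<delta>0 \<Longrightarrow> \<bar>g c - F (x + right_mult v c)\<bar> \<le> \<eta> * \<delta>\<^sup>2 / 4"
    and gm: "\<And>c. c \<in> ball 0 \<delta>0 \<Longrightarrow> \<forall>\<^sub>F r in at_right 0. g c \<le> (LINT y:sphere c r|sphere_measure c r. g y)"
    using approx [of "\<eta> * \<delta>\<^sup>2 / 4"] \<eta> \<delta>(1) by auto
  have cg': "continuous_on A g" if "A \<subseteq> cball 0 \<delta>" for A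
    by (rule continuous_on_subset [OF cg]) (use that \<delta> in auto)
  obtain c where c: "c \<in> cball 0 \<delta>" and cmax: "\<And>y. y \<in> cball 0 \<delta> \<Longrightarrow> g y - q y \<le> g c - q c"
    using continuous_attains_sup [of "cball 0 \<delta>" "\<lambda>y. g y - q y"] \<delta>(1) cg' cq
    by (force intro!: continuous_intros)
  have "norm c < \<delta>"
  proof (rule ccontr)
    assume "\<not> norm c < \<delta>"
    then have nc: "norm c = \<delta>" using c by simp
    have "\<bar>g 0 - F x\<bar> \<le> \<eta> * \<delta>\<^sup>2 / 4" "q 0 = 0"
      using gF [of 0] \<delta>0 by (simp_all add: q_def linear_0 [OF linear_right_mult])
    then have "F x - \<eta> * \<delta>\<^sup>2 / 4 \<le> g 0 - q 0" by linarith
    also have "\<dots> \<le> g c - q c" using cmax [of 0] \<delta>(1) by simp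
    also have "\<dots> \<le> F (x + right_mult v c) + \<eta> * \<delta>\<^sup>2 / 4 - q c"
    proof -
      have "c \<in> cball 0 \<delta>0" using c \<delta>(2) by simp
      from gF [OF this] show ?thesis by linarith
    qed
    also have "\<dots> \<le> F x - \<eta> * \<delta>\<^sup>2 + \<eta> * \<delta>\<^sup>2 / 4" using Fq [of c] nc by simp
    finally have "\<eta> * \<delta>\<^sup>2 \<le> 0" by simp
    then show False using \<eta> \<delta>(1) by (simp add: mult_le_0_iff)
  qed
  then have "c \<in> ball 0 \<delta>0" using \<delta>(2) by simp
  have "\<forall>\<^sub>F r in at_right 0. r < \<delta> - norm c \<and> 0 < r"
    using \<open>norm c < \<delta>\<close> eventually_at_right_less [of 0] eventually_at_rightI [of 0 "\<delta> - norm c"]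
    by (auto simp: eventually_conj_iff)
  from eventually_happens' [OF _ eventually_conj [OF this gm [OF \<open>c \<in> ball 0 \<delta>0\<close>]]]
  obtain r where r: "0 < r" "r < \<delta> - norm c" and gr: "g c \<le> (LINT y:sphere c r|sphere_measure c r. g y)"
    by auto
  have sub: "sphere c r \<subseteq> cball 0 \<delta>"
  proof
    fix y assume "y \<in> sphere c r"
    then have "norm (y - c) = r" by (simp add: dist_norm norm_minus_commute)
    then show "y \<in> cball 0 \<delta>" using norm_triangle_ineq [of "y - c" c] r by simp
  qed
  define M where "M = g c - q c"
  have "(LINT y:sphere c r|sphere_measure c r. g y) \<le> (LINT y:sphere c r|sphere_measure c r. M + q y)"
  proof (rule set_integral_mono)
    show "set_integrable (sphere_measure c r) (sphere c r) g"
      by (intro set_integrable_sphere_continuous cg' sub)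
    show "set_integrable (sphere_measure c r) (sphere c r) (\<lambda>y. M + q y)"
      by (intro set_integrable_sphere_continuous continuous_intros cq)
    show "g y \<le> M + q y" if "y \<in> sphere c r" for y
      using cmax [of y] sub that by (auto simp: M_def)
  qed
  also have "(\<lambda>y. M + q y) = (\<lambda>y. g c + (l + 2 *\<^sub>R Q c) \<bullet> (y - c) + (y - c) \<bullet> Q (y - c))"
  proof
    fix y
    have "q y = q c + (l + 2 *\<^sub>R Q c) \<bullet> (y - c) + (y - c) \<bullet> Q (y - c)"
      using sQ [of y c] by (simp add: q_def linear_diff [OF lQ] inner_add_left inner_diff_left inner_diff_right inner_commute algebra_simps)
    then show "M + q y = g c + (l + 2 *\<^sub>R Q c) \<bullet> (y - c) + (y - c) \<bullet> Q (y - c)" by (simp add: M_def)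
  qed
  also have "(LINT y:sphere c r|sphere_measure c r. g c + (l + 2 *\<^sub>R Q c) \<bullet> (y - c) + (y - c) \<bullet> Q (y - c)) < g c"
    unfolding sphere_mean_quadratic [OF r(1) lQ] using trQ r(1) by (simp add: mult_pos_neg del: quat_unit_simps)
  finally show False using gr by simp
qed

text \<open>
  A positive Laplacian dominates the Taylor remainder, so on small spheres \<open>f\<close> lies above a
  quadratic polynomial with trace zero and the same value at the centre, whose mean is that value.
\<close>

lemma quat_psh_on_strict:
  fixes f :: "quat^'n \<Rightarrow> real"
  assumes C: "C2_data f G H" and pos: "\<And>x v. x \<in> \<Omega> \<Longrightarrow> v \<noteq> 0 \<Longrightarrow> 0 < line_laplacian (H x) v"
  shows "quat_psh_on \<Omega> f"
proof -
  have cf: "continuous_on A f" for A using C2_data_continuous(1) [OF C] .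
  have usc: "upper_semicontinuous_on U g" if "continuous_on U g" for U and g :: "'x::topological_space \<Rightarrow> real"
    unfolding upper_semicontinuous_on_def
  proof (intro ballI allI impI)
    fix x a assume "x \<in> U" "g x < a"
    have "(g \<longlongrightarrow> g x) (at x within U)" using that \<open>x \<in> U\<close> unfolding continuous_on_def by blast
    then show "\<forall>\<^sub>F y in at x within U. g y < a" by (rule order_tendstoD(2)) fact
  qed
  show ?thesis
    unfolding quat_psh_on_def subharmonic_on_def
  proof (intro conjI allI impI ballI)
    show "upper_semicontinuous_on \<Omega> f" by (intro usc cf)
    fix a v :: "quat^'n" assume v: "v \<noteq> 0"
    have cr: "continuous_on A (right_mult v)" for A
      using linear_right_mult linear_conv_bounded_linear linear_continuous_on by blast
    have cg: "continuous_on A (\<lambda>c. f (a + right_mult v c))" for A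
      by (intro continuous_on_compose2 [OF cf [of UNIV]] continuous_intros cr) auto
    show "upper_semicontinuous_on {c. a + right_mult v c \<in> \<Omega>} (\<lambda>c. f (a + right_mult v c))"
      by (intro usc cg)
    fix c assume "c \<in> {c. a + right_mult v c \<in> \<Omega>}"
    define x where "x = a + right_mult v c"
    have x: "x \<in> \<Omega>" using \<open>c \<in> _\<close> by (simp add: x_def)
    (* The largest slack for which the trace of Q below is not negative; it is then zero. *)
    define e where "e = line_laplacian (H x) v / 8"
    have e: "0 < e" using pos [OF x v] by (simp add: e_def)
    have lH: "linear (H x)" using C2_data_continuous(4) [OF C] .
    define P where "P = pullback_form (H x) v"
    note Pf = pullback_form [OF lH, where v = v, folded P_def]
    obtain l where l: "\<And>c. l \<bullet> c = G x \<bullet> right_mult v c" using pullback_linear by blast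
    have nv: "0 < (norm v)\<^sup>2" using v by simp
    obtain \<delta> where \<delta>: "0 < \<delta>" "\<And>h. norm h \<le> \<delta> \<Longrightarrow>
        \<bar>f (x + h) - f x - G x \<bullet> h - (h \<bullet> H x h) / 2\<bar> \<le> e / (norm v)\<^sup>2 * (norm h)\<^sup>2"
      using C2_data_taylor [OF C, of "e / (norm v)\<^sup>2" x] e nv by auto
    define Q where "Q y = (1 / 2) *\<^sub>R P y + (- e) *\<^sub>R y" for y
    have lQ: "linear Q" unfolding Q_def
      by (intro linear_compose_add linear_compose_scale_right Pf(1)) (rule linear_ident)
    have trQ: "(\<Sum>c\<in>UNIV. quat_unit c \<bullet> Q (quat_unit c)) = 0"
    proof -
      have "(\<Sum>c\<in>UNIV. quat_unit c \<bullet> Q (quat_unit c)) = line_laplacian (H x) v / 2 - 4 * e"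
        using trace_identity [of "- e"]
        by (simp add: Q_def inner_add_right inner_diff_right sum.distrib sum_subtractf sum_negf Pf(3) [symmetric]
            sum_divide_distrib del: quat_unit_simps)
      then show ?thesis by (simp add: e_def)
    qed
    have low: "f x + l \<bullet> y + y \<bullet> Q y \<le> f (x + right_mult v y)" if "norm v * norm y \<le> \<delta>" for y
    proof -
      have "norm (right_mult v y) \<le> \<delta>" using that by (simp add: norm_right_mult)
      from \<delta>(2) [OF this] have "f x + G x \<bullet> right_mult v y + (right_mult v y \<bullet> H x (right_mult v y)) / 2
          - e / (norm v)\<^sup>2 * (norm (right_mult v y))\<^sup>2 \<le> f (x + right_mult v y)" by linarith
      also have "e / (norm v)\<^sup>2 * (norm (right_mult v y))\<^sup>2 = e * (norm y)\<^sup>2"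
        using v by (simp add: norm_right_mult power_mult_distrib)
      finally show ?thesis by (simp add: l [symmetric] Pf(2) [symmetric] Q_def inner_diff_right inner_add_right power2_norm_eq_inner)
    qed
    have "\<forall>\<^sub>F r in at_right 0. 0 < r \<and> r < \<delta> / norm v"
      using \<delta>(1) v eventually_at_rightI [of 0 "\<delta> / norm v"] by auto
    then show "\<forall>\<^sub>F r in at_right 0. set_integrable (sphere_measure c r) (sphere c r) (\<lambda>c. f (a + right_mult v c)) \<and>
        f (a + right_mult v c) \<le> (LINT y:sphere c r|sphere_measure c r. f (a + right_mult v y))"
    proof eventually_elim
      case (elim r)
      have int: "set_integrable (sphere_measure c r) (sphere c r) (\<lambda>c. f (a + right_mult v c))"
        by (intro set_integrable_sphere_continuous cg)
      have cQ: "continuous_on UNIV Q" using lQ linear_conv_bounded_linear linear_continuous_on by blast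
      have "f x = (LINT y:sphere c r|sphere_measure c r. f x + l \<bullet> (y - c) + (y - c) \<bullet> Q (y - c))"
        using sphere_mean_quadratic [of r Q c "f x" l] elim lQ trQ by simp
      also have "\<dots> \<le> (LINT y:sphere c r|sphere_measure c r. f (a + right_mult v y))"
      proof (rule set_integral_mono [OF _ int])
        show "set_integrable (sphere_measure c r) (sphere c r) (\<lambda>y. f x + l \<bullet> (y - c) + (y - c) \<bullet> Q (y - c))"
          by (intro set_integrable_sphere_continuous continuous_intros continuous_on_compose2 [OF cQ]) auto
        fix y assume "y \<in> sphere c r"
        then have "norm (y - c) = r" by (simp add: dist_norm norm_minus_commute)
        then have "norm v * norm (y - c) \<le> \<delta>" using elim v by (simp add: field_simps)
        moreover have "x + right_mult v (y - c) = a + right_mult v y"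
          by (simp add: x_def linear_diff [OF linear_right_mult])
        ultimately show "f x + l \<bullet> (y - c) + (y - c) \<bullet> Q (y - c) \<le> f (a + right_mult v y)"
          using low [of "y - c"] by simp
      qed
      finally show ?case using int by (simp add: x_def)
    qed
  qed
qed

text \<open>
  A convolution is a uniform limit of finite nonnegative combinations of translates of \<open>f\<close>. Such
  combinations inherit the sub-mean inequality for small radii directly, because only finitely many radii have
  to be respected; for the integral itself no common radius need exist.
\<close>

lemma riemann_sum_translates:
  fixes f \<rho> :: "'a::euclidean_space \<Rightarrow> real"
  assumes cf: "continuous_on UNIV f" and c\<rho>: "continuous_on UNIV \<rho>" and \<rho>: "\<And>y. 0 \<le> \<rho> y"
    and z: "\<And>y. y \<notin> cball 0 d \<Longrightarrow> \<rho> y = 0" and one: "(\<integral>y. \<rho> y \<partial>lborel) = 1"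
    and K: "compact K" and \<tau>: "0 < \<tau>"
  shows "\<exists>(m::nat) w Y. (\<forall>i<m. 0 \<le> w i \<and> Y i \<in> cball 0 d) \<and>
    (\<forall>x\<in>K. \<bar>(\<integral>y. f (x - y) * \<rho> y \<partial>lborel) - (\<Sum>i<m. w i * f (x - Y i))\<bar> \<le> \<tau>)"
proof -
  have "compact {x - y |x y. x \<in> K \<and> y \<in> cball 0 d}" by (intro compact_differences K compact_cball)
  then have "uniformly_continuous_on {x - y |x y. x \<in> K \<and> y \<in> cball 0 d} f"
    by (intro compact_uniformly_continuous continuous_on_subset [OF cf]) auto
  then obtain \<eta> where \<eta>: "0 < \<eta>" and uc: "\<And>x y y'. x \<in> K \<Longrightarrow> y \<in> cball 0 d \<Longrightarrow> y' \<in> cball 0 d \<Longrightarrow>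
      dist y y' < \<eta> \<Longrightarrow> \<bar>f (x - y) - f (x - y')\<bar> \<le> \<tau>"
  proof -
    assume uc: "uniformly_continuous_on {x - y |x y. x \<in> K \<and> y \<in> cball 0 d} f"
    then obtain \<eta> where \<eta>: "0 < \<eta>" "\<And>p q. p \<in> {x - y |x y. x \<in> K \<and> y \<in> cball 0 d} \<Longrightarrow>
        q \<in> {x - y |x y. x \<in> K \<and> y \<in> cball 0 d} \<Longrightarrow> dist q p < \<eta> \<Longrightarrow> dist (f q) (f p) < \<tau>"
      unfolding uniformly_continuous_on_def using \<tau> by meson
    have "\<bar>f (x - y) - f (x - y')\<bar> \<le> \<tau>" if "x \<in> K" "y \<in> cball 0 d" "y' \<in> cball 0 d" "dist y y' < \<eta>" for x y y'
    proof -
      have "dist (f (x - y)) (f (x - y')) < \<tau>"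
        by (rule \<eta>(2)) (use that in \<open>auto simp: dist_norm norm_minus_commute\<close>)
      then show ?thesis by (simp add: dist_real_def)
    qed
    then show ?thesis using that \<eta>(1) by blast
  qed
  have cover: "cball (0::'a) d \<subseteq> (\<Union>c\<in>cball 0 d. ball c \<eta>)"
    using \<eta> by (auto intro: centre_in_ball [THEN iffD2])
  obtain C where C: "C \<subseteq> cball (0::'a) d" "finite C" "cball 0 d \<subseteq> (\<Union>c\<in>C. ball c \<eta>)"
    by (rule compactE_image [OF compact_cball _ cover]) auto
  define m where "m = card C"
  obtain Y where Y: "bij_betw Y {0..<m} C" using ex_bij_betw_nat_finite [OF C(2)] by (auto simp: m_def)
  have Y1: "Y i \<in> cball 0 d" if "i < m" for i using bij_betwE [OF Y] C(1) that by (auto simp del: mem_cball mem_cball_0)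
  define A where "A i = (if i < m then ball (Y i) \<eta> else {})" for i
  define E where "E = disjointed A"
  have [measurable]: "E i \<in> sets borel" for i
    unfolding E_def disjointed_def A_def by (intro sets.Diff sets.finite_UN) auto
  have E1: "(\<Sum>i<m. indicator (E i) y) = (1::real)" if yd: "y \<in> cball 0 d" for y
  proof -
    have "(\<Sum>i<m. indicator (E i) y) = (indicator (\<Union>i<m. E i) y :: real)"
      by (rule indicator_UN_disjoint [symmetric])
         (use disjoint_family_disjointed [of A] in \<open>auto simp: E_def disjoint_family_on_def\<close>)
    moreover have "(\<Union>i<m. E i) = (\<Union>i<m. A i)"
      using finite_UN_disjointed_eq [of A m] by (simp add: E_def atLeast0LessThan)
    moreover have "y \<in> (\<Union>i<m. A i)"
    proof -
      obtain c where "c \<in> C" "y \<in> ball c \<eta>" using subsetD [OF C(3) yd] by blast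
      moreover then obtain i where "i < m" "c = Y i" using Y by (auto simp: bij_betw_def)
      ultimately show ?thesis by (auto simp: A_def)
    qed
    ultimately show ?thesis by simp
  qed
  have E2: "dist y (Y i) < \<eta>" if "y \<in> E i" for y i
    using that disjointed_subset [of A i] by (auto simp: E_def A_def dist_commute split: if_splits)
  define w where "w i = (\<integral>y. indicator (E i) y * \<rho> y \<partial>lborel)" for i
  have i\<rho>: "integrable lborel \<rho>" by (rule integrable_compact_support [OF c\<rho> z])
  have iE: "integrable lborel (\<lambda>y. indicator (E i) y * \<rho> y)" for i
    using integrable_mult_indicator [OF _ i\<rho>, of "E i"] by simp
  have "\<bar>(\<integral>y. f (x - y) * \<rho> y \<partial>lborel) - (\<Sum>i<m. w i * f (x - Y i))\<bar> \<le> \<tau>" if x: "x \<in> K" for x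
  proof -
    have i1: "integrable lborel (\<lambda>y. f (x - y) * \<rho> y)"
      by (rule integrable_compact_support [where R = d])
         (auto intro!: continuous_intros c\<rho> continuous_on_compose2 [OF cf] simp: z)
    have i2: "integrable lborel (\<lambda>y. \<Sum>i<m. (indicator (E i) y * \<rho> y) * f (x - Y i))"
      by (intro Bochner_Integration.integrable_sum integrable_mult_left iE)
    have "(\<integral>y. f (x - y) * \<rho> y \<partial>lborel) - (\<Sum>i<m. w i * f (x - Y i)) =
        (\<integral>y. f (x - y) * \<rho> y - (\<Sum>i<m. (indicator (E i) y * \<rho> y) * f (x - Y i)) \<partial>lborel)"
      unfolding w_def using i1 i2 iE by simp
    also have "norm \<dots> \<le> (\<integral>y. \<tau> * \<rho> y \<partial>lborel)"
    proof (rule Bochner_Integration.integral_norm_bound_integral)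
      show "integrable lborel (\<lambda>y. f (x - y) * \<rho> y - (\<Sum>i<m. (indicator (E i) y * \<rho> y) * f (x - Y i)))"
        by (intro Bochner_Integration.integrable_diff i1 i2)
      show "integrable lborel (\<lambda>y. \<tau> * \<rho> y)" by (intro integrable_mult_right i\<rho>)
      fix y
      show "norm (f (x - y) * \<rho> y - (\<Sum>i<m. (indicator (E i) y * \<rho> y) * f (x - Y i))) \<le> \<tau> * \<rho> y"
      proof (cases "y \<in> cball 0 d")
        case True
        have "f (x - y) * \<rho> y - (\<Sum>i<m. (indicator (E i) y * \<rho> y) * f (x - Y i)) =
            (\<Sum>i<m. indicator (E i) y) * (f (x - y) * \<rho> y) - (\<Sum>i<m. (indicator (E i) y * \<rho> y) * f (x - Y i))"
          by (simp only: E1 [OF True] mult_1)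
        also have "\<dots> = (\<Sum>i<m. indicator (E i) y * (\<rho> y * (f (x - y) - f (x - Y i))))"
          unfolding sum_distrib_right sum_subtractf [symmetric]
          by (intro sum.cong refl) (simp add: algebra_simps)
        also have "norm \<dots> \<le> (\<Sum>i<m. indicator (E i) y * (\<rho> y * \<tau>))"
        proof (rule sum_norm_le)
          fix i assume "i \<in> {..<m}"
          show "norm (indicator (E i) y * (\<rho> y * (f (x - y) - f (x - Y i)))) \<le> indicator (E i) y * (\<rho> y * \<tau>)"
          proof (cases "y \<in> E i")
            case yE: True
            have "\<bar>f (x - y) - f (x - Y i)\<bar> \<le> \<tau>"
              using uc [OF x True Y1 E2 [OF yE]] \<open>i \<in> {..<m}\<close> by simp
            then show ?thesis using yE \<rho> [of y] by (simp add: abs_mult mult_left_mono)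
          qed simp
        qed
        also have "\<dots> = \<tau> * \<rho> y" by (simp add: sum_distrib_right [symmetric] E1 [OF True])
        finally show ?thesis .
      qed (simp add: z)
    qed
    also have "\<dots> = \<tau>" by (simp add: one)
    finally show ?thesis by simp
  qed
  moreover have "0 \<le> w i" for i unfolding w_def by (intro integral_nonneg_AE) (simp add: \<rho>)
  ultimately show ?thesis using Y1 by (intro exI [of _ m] exI [of _ w] exI [of _ Y]) simp
qed

text \<open>
  The Riemann sums of the convolution satisfy the local sub-mean inequality on the line and converge uniformly,
  so \<open>line_laplacian_nonneg_of_approximation\<close> applies.
\<close>

lemma mollified_line_laplacian_nonneg:
  fixes u f :: "quat^'n \<Rightarrow> real"
  assumes psh: "quat_psh_on \<Omega> u" and \<Omega>: "open \<Omega>" and cf: "continuous_on UNIV f" and fu: "\<And>x. x \<in> \<Omega> \<Longrightarrow> f x = u x"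
    and c\<rho>: "continuous_on UNIV \<rho>" and \<rho>: "\<And>y. 0 \<le> \<rho> y"
    and z: "\<And>y. y \<notin> cball 0 d \<Longrightarrow> \<rho> y = 0" and one: "(\<integral>y. \<rho> y \<partial>lborel) = 1"
    and C: "C2_data (\<lambda>x. \<integral>y. f (x - y) * \<rho> y \<partial>lborel) G H" and x: "cball x d \<subseteq> \<Omega>"
  shows "0 \<le> line_laplacian (H x) v"
proof (cases "v = 0")
  case True
  have "linear (H x)" using C2_data_continuous(4) [OF C] .
  then show ?thesis
    using True by (simp add: line_laplacian_def linear_0 linear_0 [OF linear_right_mult_left])
next
  case v: False
  obtain e where e0: "0 < e" "(\<Union>y\<in>cball x d. ball y e) \<subseteq> \<Omega>"
    by (rule compact_subset_open_imp_ball_epsilon_subset [OF compact_cball \<Omega> x])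
  then have e: "0 < e" "\<And>y. y \<in> cball x d \<Longrightarrow> ball y e \<subseteq> \<Omega>" by blast+
  define \<delta> where "\<delta> = e / (2 * norm v)"
  have \<delta>: "0 < \<delta>" using e v by (simp add: \<delta>_def)
  have in\<Omega>: "x - y + right_mult v c \<in> \<Omega>" if "y \<in> cball 0 d" "c \<in> cball 0 \<delta>" for y c
  proof -
    have "norm (right_mult v c) \<le> e / 2" using that(2) v by (simp add: \<delta>_def norm_right_mult field_simps)
    then have "x - y + right_mult v c \<in> ball (x - y) e" using e(1) by (simp add: dist_norm)
    moreover have "x - y \<in> cball x d" using that(1) by (simp add: dist_norm)
    ultimately show ?thesis using e(2) by blast
  qed
  have cr: "continuous_on A (right_mult v)" for A
    using linear_right_mult linear_conv_bounded_linear linear_continuous_on by blast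
  show ?thesis
  proof (rule line_laplacian_nonneg_of_approximation [OF C \<delta>])
    fix \<tau> :: real assume \<tau>: "0 < \<tau>"
    have K: "compact ((\<lambda>c. x + right_mult v c) ` cball 0 \<delta>)"
      by (intro compact_continuous_image continuous_intros cr compact_cball)
    have "\<exists>(m::nat) w Y. (\<forall>i<m. 0 \<le> w i \<and> Y i \<in> cball 0 d) \<and>
        (\<forall>p\<in>(\<lambda>c. x + right_mult v c) ` cball 0 \<delta>.
          \<bar>(\<integral>y. f (p - y) * \<rho> y \<partial>lborel) - (\<Sum>i<m. w i * f (p - Y i))\<bar> \<le> \<tau>)"
      by (rule riemann_sum_translates [OF cf c\<rho> \<rho> _ one K \<tau>]) (rule z)
    then obtain m :: nat and w Y where mwY: "(\<forall>i<m. 0 \<le> w i \<and> Y i \<in> cball 0 d) \<and>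
        (\<forall>p\<in>(\<lambda>c. x + right_mult v c) ` cball 0 \<delta>.
          \<bar>(\<integral>y. f (p - y) * \<rho> y \<partial>lborel) - (\<Sum>i<m. w i * f (p - Y i))\<bar> \<le> \<tau>)"
      by (elim exE) (rule that)
    from mwY have w: "\<And>i. i < m \<Longrightarrow> 0 \<le> w i" and Y: "\<And>i. i < m \<Longrightarrow> Y i \<in> cball 0 d"
      by (simp_all only:)
    from mwY have app: "\<bar>(\<integral>y. f (x + right_mult v c - y) * \<rho> y \<partial>lborel) - (\<Sum>i<m. w i * f (x + right_mult v c - Y i))\<bar> \<le> \<tau>"
      if "c \<in> cball 0 \<delta>" for c
      using imageI [OF that, of "\<lambda>c. x + right_mult v c"] by (elim conjE) (erule (1) bspec)
    define h where "h i c = u ((x - Y i) + right_mult v c)" for i c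
    define g where "g c = (\<Sum>i<m. w i * h i c)" for c
    have fh: "f (x + right_mult v c - Y i) = h i c" if "i < m" "c \<in> cball 0 \<delta>" for i c
      using fu [OF in\<Omega> [OF Y [OF that(1)] that(2)]] by (simp add: h_def algebra_simps)
    have gf: "g c = (\<Sum>i<m. w i * f (x + right_mult v c - Y i))" if "c \<in> cball 0 \<delta>" for c
      using fh that by (simp add: g_def)
    have "continuous_on (cball 0 \<delta>) (\<lambda>c. \<Sum>i<m. w i * f (x + right_mult v c - Y i))"
      by (intro continuous_intros continuous_on_compose2 [OF cf] cr) auto
    then have 1: "continuous_on (cball 0 \<delta>) g" by (rule continuous_on_eq) (simp add: gf)
    have 2: "\<bar>g c - (\<integral>y. f (x + right_mult v c - y) * \<rho> y \<partial>lborel)\<bar> \<le> \<tau>" if "c \<in> cball 0 \<delta>" for c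
      using app [OF that] gf [OF that] by (simp add: abs_minus_commute)
    have 3: "\<forall>\<^sub>F r in at_right 0. g c \<le> (LINT y:sphere c r|sphere_measure c r. g y)" if c: "c \<in> ball 0 \<delta>" for c
    proof -
      have "\<forall>\<^sub>F r in at_right 0. set_integrable (sphere_measure c r) (sphere c r) (h i) \<and>
          h i c \<le> (LINT y:sphere c r|sphere_measure c r. h i y)" if "i \<in> {..<m}" for i
      proof -
        have "c \<in> {c. (x - Y i) + right_mult v c \<in> \<Omega>}" using in\<Omega> [OF Y, of i c] that c by simp
        then show ?thesis
          using psh v unfolding quat_psh_on_def subharmonic_on_def h_def by blast
      qed
      then have "\<forall>\<^sub>F r in at_right 0. \<forall>i\<in>{..<m}. set_integrable (sphere_measure c r) (sphere c r) (h i) \<and>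
          h i c \<le> (LINT y:sphere c r|sphere_measure c r. h i y)"
        by (intro eventually_ball_finite) auto
      then show ?thesis
      proof eventually_elim
        case (elim r)
        have "g c \<le> (\<Sum>i<m. w i * (LINT y:sphere c r|sphere_measure c r. h i y))"
          unfolding g_def
      proof (rule sum_mono)
        fix i assume "i \<in> {..<m}"
        then show "w i * h i c \<le> w i * (LINT y:sphere c r|sphere_measure c r. h i y)"
          using elim w by (intro mult_left_mono) blast+
      qed
        also have "\<dots> = (LINT y:sphere c r|sphere_measure c r. g y)"
        proof -
          have "(LINT y:sphere c r|sphere_measure c r. g y) =
              (\<integral>y. (\<Sum>i<m. w i * (indicator (sphere c r) y *\<^sub>R h i y)) \<partial>sphere_measure c r)"
            unfolding set_lebesgue_integral_def g_def by (simp add: sum_distrib_left mult_ac)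
          also have "\<dots> = (\<Sum>i<m. w i * (LINT y:sphere c r|sphere_measure c r. h i y))"
            unfolding set_lebesgue_integral_def
          proof (subst Bochner_Integration.integral_sum)
            show "integrable (sphere_measure c r) (\<lambda>y. w i * (indicator (sphere c r) y *\<^sub>R h i y))" if "i \<in> {..<m}" for i
              using elim that unfolding set_integrable_def by (intro integrable_mult_right) blast
          qed simp
          finally show ?thesis ..
        qed
        finally show ?case .
      qed
    qed
    show "\<exists>g. continuous_on (cball 0 \<delta>) g \<and>
      (\<forall>c\<in>cball 0 \<delta>. \<bar>g c - (\<integral>y. f (x + right_mult v c - y) * \<rho> y \<partial>lborel)\<bar> \<le> \<tau>) \<and>
      (\<forall>c\<in>ball 0 \<delta>. \<forall>\<^sub>F r in at_right 0. g c \<le> (LINT y:sphere c r|sphere_measure c r. g y))"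
      using 1 2 3 by blast
  qed
qed

section \<open>Mollifiers and smooth ramps\<close>

lemma C2_data_add:
  assumes "C2_data f G H" "C2_data f' G' H'"
  shows "C2_data (\<lambda>x. f x + f' x) (\<lambda>x. G x + G' x) (\<lambda>x h. H x h + H' x h)"
  using assms unfolding C2_data_def
  by (auto intro!: derivative_eq_intros continuous_intros simp: inner_add_left inner_add_right)

lemma C2_data_scale:
  assumes "C2_data f G H"
  shows "C2_data (\<lambda>x. c * f x) (\<lambda>x. c *\<^sub>R G x) (\<lambda>x h. c *\<^sub>R H x h)"
  using assms unfolding C2_data_def
  by (auto intro!: derivative_eq_intros continuous_intros)

lemma C2_data_const: "C2_data (\<lambda>x. c) (\<lambda>x. 0) (\<lambda>x h. 0)"
  unfolding C2_data_def by (auto intro!: derivative_eq_intros)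

lemma C2_data_norm_square: "C2_data (\<lambda>x. x \<bullet> x) (\<lambda>x. 2 *\<^sub>R x) (\<lambda>x h. 2 *\<^sub>R h)"
  unfolding C2_data_def by (auto intro!: derivative_eq_intros simp: inner_commute)

lemma C2_data_compose:
  fixes f :: "'a::euclidean_space \<Rightarrow> real"
  assumes C: "C2_data f G H" and p1: "\<And>t. (p has_real_derivative p' t) (at t)"
    and p2: "\<And>t. (p' has_real_derivative p'' t) (at t)" and p3: "continuous_on UNIV p''"
  shows "C2_data (\<lambda>x. p (f x)) (\<lambda>x. p' (f x) *\<^sub>R G x) (\<lambda>x h. (p'' (f x) * (G x \<bullet> h)) *\<^sub>R G x + p' (f x) *\<^sub>R H x h)"
proof -
  have d: "(f has_derivative (\<lambda>h. G x \<bullet> h)) (at x)" "(G has_derivative H x) (at x)" "H x h \<bullet> k = h \<bullet> H x k" for x h k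
    using C by (auto simp: C2_data_def)
  note cs = C2_data_continuous [OF C]
  have c: "continuous_on UNIV p'" "continuous_on UNIV p"
    by (intro continuous_at_imp_continuous_on ballI DERIV_isCont, rule p2)
       (intro continuous_at_imp_continuous_on ballI DERIV_isCont, rule p1)
  have cc: "continuous_on UNIV (\<lambda>x. p'' (f x))" "continuous_on UNIV (\<lambda>x. p' (f x))"
    by (auto intro!: continuous_on_compose2 [OF p3] continuous_on_compose2 [OF c(1)] cs)
  have comp: "((\<lambda>x. q (f x)) has_derivative (\<lambda>h. q' * (G x \<bullet> h))) (at x)" if "(q has_real_derivative q') (at (f x))" for q q' x
    using has_derivative_compose [OF d(1) [of x], of q "(*) q'"] that by (simp add: has_field_derivative_def)
  show ?thesis
    unfolding C2_data_def
  proof (intro conjI allI)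
    show "((\<lambda>x. p (f x)) has_derivative (\<lambda>h. (p' (f x) *\<^sub>R G x) \<bullet> h)) (at x)" for x
      using comp [OF p1] by simp
    show "((\<lambda>x. p' (f x) *\<^sub>R G x) has_derivative (\<lambda>h. (p'' (f x) * (G x \<bullet> h)) *\<^sub>R G x + p' (f x) *\<^sub>R H x h)) (at x)" for x
      using has_derivative_scaleR [OF comp [OF p2] d(2)] by (simp add: add.commute)
    show "continuous_on UNIV (\<lambda>x. (p'' (f x) * (G x \<bullet> h)) *\<^sub>R G x + p' (f x) *\<^sub>R H x h)" for h
      by (intro continuous_intros cs cc)
    show "((p'' (f x) * (G x \<bullet> h)) *\<^sub>R G x + p' (f x) *\<^sub>R H x h) \<bullet> k =
       h \<bullet> ((p'' (f x) * (G x \<bullet> k)) *\<^sub>R G x + p' (f x) *\<^sub>R H x k)" for x h k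
      by (simp add: inner_add_left inner_add_right d(3) inner_commute [of h "G x"])
  qed
qed

text \<open>
  Powers of the positive part are the building blocks of compactly supported functions of class
  \<open>C\<^sup>2\<close>.
\<close>

lemma DERIV_max_power:
  assumes "1 \<le> n"
  shows "((\<lambda>t. max 0 t ^ Suc n) has_real_derivative (real (Suc n) * max 0 t ^ n)) (at t)"
proof (cases t "0::real" rule: linorder_cases)
  case less
  have "((\<lambda>t. 0) has_real_derivative 0) (at t)" by simp
  then have "((\<lambda>t. max 0 t ^ Suc n) has_real_derivative 0) (at t)"
    by (rule has_field_derivative_transform_within_open [where S = "{..<0}"]) (use less in auto)
  moreover have "real (Suc n) * max 0 t ^ n = 0" using less assms by (simp add: max_def power_0_left)
  ultimately show ?thesis by (simp only:)
next
  case greater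
  have "((\<lambda>t. t ^ Suc n) has_real_derivative (real (Suc n) * t ^ n)) (at t)"
    using DERIV_pow [of "Suc n" t UNIV] by simp
  then have "((\<lambda>t. max 0 t ^ Suc n) has_real_derivative (real (Suc n) * t ^ n)) (at t)"
    by (rule has_field_derivative_transform_within_open [where S = "{0<..}"]) (use greater in auto)
  then show ?thesis using greater by (simp add: max_def)
next
  case equal
  have "((\<lambda>h. max 0 h ^ Suc n / h) \<longlongrightarrow> 0) (at (0::real))"
  proof (rule Lim_null_comparison)
    have "norm (max 0 h ^ Suc n / h) \<le> \<bar>h\<bar> ^ n" for h :: real
      by (cases "h > 0") (auto simp: max_def)
    then show "\<forall>\<^sub>F h in at 0. norm (max 0 h ^ Suc n / h) \<le> \<bar>h\<bar> ^ n" by simp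
    have "((\<lambda>h. \<bar>h\<bar> ^ n) \<longlongrightarrow> \<bar>0::real\<bar> ^ n) (at 0)" by (intro tendsto_intros)
    then show "((\<lambda>h. \<bar>h\<bar> ^ n) \<longlongrightarrow> 0) (at (0::real))" using assms by (simp add: power_0_left)
  qed
  then show ?thesis using equal assms by (simp add: DERIV_def power_0_left)
qed

lemma DERIV_max_cube: "((\<lambda>t. max 0 t ^ 3) has_real_derivative 3 * (max 0 t)\<^sup>2) (at t)"
  using DERIV_max_power [of 2 t] by (simp add: numeral_eq_Suc)

lemma DERIV_max_square: "((\<lambda>t. (max 0 t)\<^sup>2) has_real_derivative 2 * max 0 t) (at t)"
  using DERIV_max_power [of 1 t] by (simp add: numeral_eq_Suc)

text \<open>
  Differentiation under the integral in the factor \<open>r\<close>; stated for vector-valued \<open>r\<close>,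
  it applies to the function and again to its gradient.
\<close>

lemma leibniz_convolution:
  fixes f :: "'a::euclidean_space \<Rightarrow> real" and r :: "'a \<Rightarrow> 'c::euclidean_space"
  assumes cf: "continuous_on UNIV f" and d: "\<And>y. (r has_derivative D y) (at y)" and cD: "\<And>h. continuous_on UNIV (\<lambda>y. D y h)"
  shows "((\<lambda>x. integral (cbox a b) (\<lambda>t. f t *\<^sub>R r (x - t))) has_derivative
      (\<lambda>h. integral (cbox a b) (\<lambda>t. f t *\<^sub>R D (x - t) h))) (at x)"
    and "continuous_on UNIV (\<lambda>x. integral (cbox a b) (\<lambda>t. f t *\<^sub>R D (x - t) h))"
proof -
  have cr: "continuous_on UNIV r" using d by (blast intro: continuous_at_imp_continuous_on has_derivative_continuous)
  have bl: "bounded_linear (\<lambda>h. f t *\<^sub>R D y h)" for t y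
    by (rule bounded_linear_compose [OF bounded_linear_scaleR_right has_derivative_bounded_linear [OF d]])
  define F where "F x t = Blinfun (\<lambda>h. f t *\<^sub>R D (x - t) h)" for x t
  have F: "blinfun_apply (F x t) = (\<lambda>h. f t *\<^sub>R D (x - t) h)" for x t
    unfolding F_def by (rule bounded_linear_Blinfun_apply [OF bl])
  have c2: "continuous_on S (\<lambda>p. f (snd p) *\<^sub>R D (fst p - snd p) h)" for S h
    by (intro continuous_intros continuous_on_compose2 [OF cf] continuous_on_compose2 [OF cD]) auto
  have cF: "continuous_on S (\<lambda>(x, t). F x t)" for S
    by (rule continuous_on_blinfun_componentwise) (simp add: split_def F c2)
  have intF: "F x integrable_on cbox a b" for x
  proof (rule integrable_continuous)
    show "continuous_on (cbox a b) (F x)"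
      by (rule continuous_on_blinfun_componentwise)
         (auto simp: F intro!: continuous_intros continuous_on_compose2 [OF cf] continuous_on_compose2 [OF cD])
  qed
  have "((\<lambda>x. integral (cbox a b) (\<lambda>t. f t *\<^sub>R r (x - t))) has_derivative integral (cbox a b) (F x)) (at x within UNIV)"
  proof (rule leibniz_rule)
    show "((\<lambda>x. f t *\<^sub>R r (x - t)) has_derivative blinfun_apply (F x t)) (at x within UNIV)" for x t
    proof -
      have "((\<lambda>x. r (x - t)) has_derivative (\<lambda>h. D (x - t) h)) (at x)"
        by (rule has_derivative_compose [of "\<lambda>x. x - t" "\<lambda>h. h" x UNIV r]) (auto intro!: derivative_eq_intros d)
      from has_derivative_scaleR_right [OF this, of "f t"] show ?thesis by (simp add: F)
    qed
    show "(\<lambda>t. f t *\<^sub>R r (x - t)) integrable_on cbox a b" for x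
      by (intro integrable_continuous continuous_intros continuous_on_compose2 [OF cf] continuous_on_compose2 [OF cr]) auto
    show "continuous_on (UNIV \<times> cbox a b) (\<lambda>(x, t). F x t)" by (rule cF)
  qed auto
  moreover have "blinfun_apply (integral (cbox a b) (F x)) = (\<lambda>h. integral (cbox a b) (\<lambda>t. f t *\<^sub>R D (x - t) h))"
    by (simp add: fun_eq_iff blinfun_apply_integral [OF intF] F)
  ultimately show "((\<lambda>x. integral (cbox a b) (\<lambda>t. f t *\<^sub>R r (x - t))) has_derivative
      (\<lambda>h. integral (cbox a b) (\<lambda>t. f t *\<^sub>R D (x - t) h))) (at x)" by simp
  show "continuous_on UNIV (\<lambda>x. integral (cbox a b) (\<lambda>t. f t *\<^sub>R D (x - t) h))"
    by (rule integral_continuous_on_param) (simp add: split_def c2)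
qed

text \<open>
  All derivatives fall on \<open>\<rho>\<close> after the substitution \<open>y \<mapsto> x - y\<close>, so
  \<open>f\<close> need only be continuous. The compact support of \<open>f\<close> confines the integral to a
  fixed box.
\<close>

lemma convolution_C2_data:
  fixes f :: "'a::euclidean_space \<Rightarrow> real"
  assumes cf: "continuous_on UNIV f" and z: "\<And>x. x \<notin> cball 0 R \<Longrightarrow> f x = 0" and C: "C2_data \<rho> G H"
  shows "\<exists>G' H'. C2_data (\<lambda>x. \<integral>y. f (x - y) * \<rho> y \<partial>lborel) G' H'"
proof -
  have d: "(\<rho> has_derivative (\<lambda>h. G x \<bullet> h)) (at x)" "(G has_derivative H x) (at x)" "H x h \<bullet> k = h \<bullet> H x k" for x h k
    using C by (auto simp: C2_data_def)
  note cs = C2_data_continuous [OF C]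
  obtain a b :: 'a where ab: "cball 0 R \<subseteq> cbox a b" using bounded_subset_cbox_symmetric [OF bounded_cball] by metis
  have eq: "(\<integral>y. f (x - y) * \<rho> y \<partial>lborel) = integral (cbox a b) (\<lambda>t. f t *\<^sub>R \<rho> (x - t))" for x
  proof -
    have c1: "continuous_on UNIV (\<lambda>t. f t * \<rho> (x - t))"
      by (intro continuous_intros cf continuous_on_compose2 [OF cs(1) [of UNIV]]) auto
    have "(\<integral>y. f (x - y) * \<rho> (x - (x - y)) \<partial>lborel) = (\<integral>t. f t * \<rho> (x - t) \<partial>lborel)"
      by (rule integral_lborel_reflect [OF borel_measurable_continuous_onI [OF c1]])
    also have "\<dots> = (\<integral>t. indicator (cbox a b) t *\<^sub>R (f t * \<rho> (x - t)) \<partial>lborel)"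
    proof (intro Bochner_Integration.integral_cong refl)
      show "f t * \<rho> (x - t) = indicator (cbox a b) t *\<^sub>R (f t * \<rho> (x - t))" for t
        using subsetD [OF ab, of t] z [of t] by (cases "t \<in> cbox a b") auto
    qed
    also have "\<dots> = integral (cbox a b) (\<lambda>t. f t * \<rho> (x - t))"
    proof -
      have "set_integrable lborel (cbox a b) (\<lambda>t. f t * \<rho> (x - t))"
        unfolding set_integrable_def by (intro borel_integrable_compact compact_cbox continuous_on_subset [OF c1]) auto
      from set_borel_integral_eq_integral(2) [OF this] show ?thesis by (simp add: set_lebesgue_integral_def)
    qed
    finally show ?thesis by simp
  qed
  define G' where "G' x = integral (cbox a b) (\<lambda>t. f t *\<^sub>R G (x - t))" for x
  define H' where "H' x h = integral (cbox a b) (\<lambda>t. f t *\<^sub>R H (x - t) h)" for x h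
  have iG: "(\<lambda>t. f t *\<^sub>R G (x - t)) integrable_on cbox a b" for x
    by (intro integrable_continuous continuous_intros continuous_on_compose2 [OF cf] continuous_on_compose2 [OF cs(2) [of UNIV]]) auto
  have iH: "(\<lambda>t. f t *\<^sub>R H (x - t) h) integrable_on cbox a b" for x h
    by (intro integrable_continuous continuous_intros continuous_on_compose2 [OF cf] continuous_on_compose2 [OF cs(3) [of UNIV]]) auto
  have "C2_data (\<lambda>x. \<integral>y. f (x - y) * \<rho> y \<partial>lborel) G' H'"
    unfolding C2_data_def eq
  proof (intro conjI allI)
    show "((\<lambda>x. integral (cbox a b) (\<lambda>t. f t *\<^sub>R \<rho> (x - t))) has_derivative (\<lambda>h. G' x \<bullet> h)) (at x)" for x
    proof -
      have "integral (cbox a b) (\<lambda>t. f t *\<^sub>R (G (x - t) \<bullet> h)) = G' x \<bullet> h" for h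
        using integral_linear [OF iG [of x] bounded_linear_inner_left [of h]] by (simp add: G'_def o_def)
      then show ?thesis
        using leibniz_convolution(1) [OF cf d(1), of a b x] by (simp add: continuous_intros cs)
    qed
    show "(G' has_derivative H' x) (at x)" for x
      unfolding G'_def [abs_def] H'_def [abs_def]
      by (rule leibniz_convolution(1) [OF cf d(2)]) (rule cs)
    show "continuous_on UNIV (\<lambda>x. H' x h)" for h
      unfolding H'_def by (rule leibniz_convolution(2) [OF cf d(2)]) (rule cs)
    show "H' x h \<bullet> k = h \<bullet> H' x k" for x h k
      using integral_linear [OF iH [of x h] bounded_linear_inner_left [of k]]
        integral_linear [OF iH [of x k] bounded_linear_inner_right [of h]]
      by (simp add: H'_def o_def d(3))
  qed
  then show ?thesis by blast
qed

text \<open>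
  The cube of the positive part of \<open>d\<^sup>2 - |y|\<^sup>2\<close> vanishes to third order on the sphere
  of radius \<open>d\<close> and is therefore of class \<open>C\<^sup>2\<close>.
\<close>

lemma mollifier_exists:
  assumes d: "0 < d"
  shows "\<exists>(\<rho> :: 'a::euclidean_space \<Rightarrow> real) G H. C2_data \<rho> G H \<and> (\<forall>y. 0 \<le> \<rho> y) \<and>
    (\<forall>y. y \<notin> cball 0 d \<longrightarrow> \<rho> y = 0) \<and> (\<integral>y. \<rho> y \<partial>lborel) = 1"
proof -
  define p where "p t = max 0 t ^ 3" for t :: real
  have p1: "(p has_real_derivative 3 * max 0 t ^ 2) (at t)" for t
    unfolding p_def [abs_def] by (rule DERIV_max_cube)
  have p2: "((\<lambda>t. 3 * max 0 t ^ 2) has_real_derivative 6 * max 0 t) (at t)" for t :: real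
    using DERIV_cmult [OF DERIV_max_square [of t], of 3] by simp
  have p3: "continuous_on UNIV (\<lambda>t::real. 6 * max 0 t)" by (intro continuous_intros)
  define \<rho>0 where "\<rho>0 y = p (d\<^sup>2 + (- 1) * (y \<bullet> y))" for y :: 'a
  obtain G0 H0 where C0: "C2_data \<rho>0 G0 H0"
    using C2_data_compose [OF C2_data_add [OF C2_data_const [of "d\<^sup>2"] C2_data_scale [OF C2_data_norm_square, of "- 1"]] p1 p2 p3]
    unfolding \<rho>0_def [abs_def] by blast
  have nn: "0 \<le> \<rho>0 y" for y by (simp add: \<rho>0_def p_def)
  have z: "\<rho>0 y = 0" if "y \<notin> cball 0 d" for y
  proof -
    have "d\<^sup>2 \<le> (norm y)\<^sup>2" using that d by (intro power_mono) auto
    then show ?thesis by (simp add: \<rho>0_def p_def power2_norm_eq_inner)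
  qed
  have c0: "continuous_on UNIV \<rho>0" by (rule C2_data_continuous(1) [OF C0])
  have i0: "integrable lborel \<rho>0" by (rule integrable_compact_support [OF c0 z])
  define c where "c = (\<integral>y. \<rho>0 y \<partial>lborel)"
  have "0 < c"
  proof -
    let ?k = "(3 / 4 * d\<^sup>2) ^ 3"
    have fs: "emeasure lborel (ball (0::'a) (d / 2)) < \<infinity>" by (rule emeasure_bounded_finite) simp
    have "0 < ?k * measure lborel (ball (0::'a) (d / 2))" using d by (simp add: content_ball_pos)
    also have "\<dots> = (\<integral>y. indicator (ball (0::'a) (d / 2)) y * ?k \<partial>lborel)"
      using fs by (simp add: less_top)
    also have "\<dots> \<le> c"
      unfolding c_def
    proof (rule integral_mono [OF _ i0])
      show "integrable lborel (\<lambda>y. indicator (ball (0::'a) (d / 2)) y * ?k)"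
        by (intro integrable_mult_left integrable_real_indicator) (use fs in auto)
      show "indicator (ball 0 (d / 2)) y * ?k \<le> \<rho>0 y" for y :: 'a
      proof (cases "y \<in> ball 0 (d / 2)")
        case True
        then have "(norm y)\<^sup>2 \<le> (d / 2)\<^sup>2" by (intro power_mono) auto
        then have "3 / 4 * d\<^sup>2 \<le> d\<^sup>2 + (- 1) * (y \<bullet> y)" by (simp add: power2_norm_eq_inner power_divide)
        then have "?k \<le> max 0 (d\<^sup>2 + (- 1) * (y \<bullet> y)) ^ 3" by (intro power_mono max.coboundedI2) auto
        then show ?thesis using True by (simp add: \<rho>0_def p_def)
      qed (simp add: nn)
    qed
    finally show ?thesis .
  qed
  have "C2_data (\<lambda>y. (1 / c) * \<rho>0 y) (\<lambda>y. (1 / c) *\<^sub>R G0 y) (\<lambda>y h. (1 / c) *\<^sub>R H0 y h)" by (rule C2_data_scale [OF C0])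
  moreover have "(\<integral>y. (1 / c) * \<rho>0 y \<partial>lborel) = 1" using \<open>0 < c\<close> by (simp add: c_def)
  ultimately show ?thesis using nn z \<open>0 < c\<close>
    by (intro exI [of _ "\<lambda>y. (1 / c) * \<rho>0 y"] exI [of _ "\<lambda>y. (1 / c) *\<^sub>R G0 y"] exI [of _ "\<lambda>y h. (1 / c) *\<^sub>R H0 y h"]) auto
qed

lemma mollification_error:
  fixes f \<rho> :: "'a::euclidean_space \<Rightarrow> real"
  assumes cf: "continuous_on UNIV f" and c\<rho>: "continuous_on UNIV \<rho>" and \<rho>: "\<And>y. 0 \<le> \<rho> y"
    and z: "\<And>y. y \<notin> cball 0 d \<Longrightarrow> \<rho> y = 0" and one: "(\<integral>y. \<rho> y \<partial>lborel) = 1"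
    and e: "\<And>y. y \<in> cball 0 d \<Longrightarrow> \<bar>f (x - y) - f x\<bar> \<le> e"
  shows "\<bar>(\<integral>y. f (x - y) * \<rho> y \<partial>lborel) - f x\<bar> \<le> e"
proof -
  have i\<rho>: "integrable lborel \<rho>" by (rule integrable_compact_support [OF c\<rho> z])
  have i1: "integrable lborel (\<lambda>y. f (x - y) * \<rho> y)"
    by (rule integrable_compact_support [where R = d])
       (auto intro!: continuous_intros c\<rho> continuous_on_compose2 [OF cf] simp: z)
  have "(\<integral>y. f (x - y) * \<rho> y \<partial>lborel) - f x = (\<integral>y. f (x - y) * \<rho> y - f x * \<rho> y \<partial>lborel)"
    using i1 i\<rho> one by simp
  also have "norm \<dots> \<le> (\<integral>y. e * \<rho> y \<partial>lborel)"
  proof (rule Bochner_Integration.integral_norm_bound_integral)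
    show "norm (f (x - y) * \<rho> y - f x * \<rho> y) \<le> e * \<rho> y" for y
    proof (cases "y \<in> cball 0 d")
      case True
      have "norm (f (x - y) * \<rho> y - f x * \<rho> y) = \<bar>f (x - y) - f x\<bar> * \<rho> y"
        using \<rho> [of y] by (simp add: abs_mult flip: left_diff_distrib)
      also have "\<dots> \<le> e * \<rho> y" using e [OF True] \<rho> [of y] by (intro mult_right_mono) auto
      finally show ?thesis .
    qed (simp add: z)
  qed (use i1 i\<rho> in auto)
  finally show ?thesis using one by simp
qed

text \<open>
  The second difference of cubes of positive parts, a cubic spline: its second derivative is the hat function
  supported on \<open>[a, b]\<close> with integral 1.
\<close>

lemma smooth_ramp_exists:
  fixes a b :: real
  assumes "a < b"
  shows "\<exists>p p' p'' :: real \<Rightarrow> real. (\<forall>t. (p has_real_derivative p' t) (at t)) \<and> (\<forall>t. (p' has_real_derivative p'' t) (at t)) \<and>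
    continuous_on UNIV p'' \<and> (\<forall>t. 0 \<le> p'' t \<and> 0 \<le> p' t \<and> p' t \<le> 1) \<and> (\<forall>t\<le>a. p t = 0) \<and> (\<forall>t\<ge>b. p' t = 1 \<and> p'' t = 0)"
proof -
  define h where "h = (b - a) / 2"
  define m where "m = (a + b) / 2"
  have h: "0 < h" using assms by (simp add: h_def)
  have am: "a = m - h" "b = m + h" by (simp_all add: h_def m_def field_simps)
  define p where "p t = (max 0 (t - a) ^ 3 - 2 * max 0 (t - m) ^ 3 + max 0 (t - b) ^ 3) / (6 * h\<^sup>2)" for t
  define p' where "p' t = (max 0 (t - a) ^ 2 - 2 * max 0 (t - m) ^ 2 + max 0 (t - b) ^ 2) / (2 * h\<^sup>2)" for t
  define p'' where "p'' t = (max 0 (t - a) - 2 * max 0 (t - m) + max 0 (t - b)) / h\<^sup>2" for t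
  have q1: "((\<lambda>t. max 0 (t - c) ^ 3) has_real_derivative 3 * max 0 (t - c) ^ 2) (at t)" for c t :: real
  proof -
    have "((\<lambda>t. t - c) has_real_derivative 1) (at t)" by (auto intro!: derivative_eq_intros)
    from DERIV_chain2 [of "\<lambda>t. max 0 t ^ 3" _ "\<lambda>t. t - c", OF DERIV_max_cube this] show ?thesis by simp
  qed
  have q2: "((\<lambda>t. max 0 (t - c) ^ 2) has_real_derivative 2 * max 0 (t - c)) (at t)" for c t :: real
  proof -
    have "((\<lambda>t. t - c) has_real_derivative 1) (at t)" by (auto intro!: derivative_eq_intros)
    from DERIV_chain2 [of "\<lambda>t. max 0 t ^ 2" _ "\<lambda>t. t - c", OF DERIV_max_square this] show ?thesis by simp
  qed
  have d1: "(p has_real_derivative p' t) (at t)" for t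
  proof -
    have "(p has_real_derivative (3 * max 0 (t - a) ^ 2 - 2 * (3 * max 0 (t - m) ^ 2) + 3 * max 0 (t - b) ^ 2) / (6 * h\<^sup>2)) (at t)"
      unfolding p_def [abs_def] by (intro DERIV_cdivide DERIV_add DERIV_diff DERIV_cmult q1)
    moreover have "(3 * A - 2 * (3 * B) + 3 * C) / (6 * h\<^sup>2) = (A - 2 * B + C) / (2 * h\<^sup>2)" for A B C :: real
      using h by (simp add: field_simps)
    ultimately show ?thesis by (simp only: p'_def)
  qed
  have d2: "(p' has_real_derivative p'' t) (at t)" for t
  proof -
    have "(p' has_real_derivative (2 * max 0 (t - a) - 2 * (2 * max 0 (t - m)) + 2 * max 0 (t - b)) / (2 * h\<^sup>2)) (at t)"
      unfolding p'_def [abs_def] by (intro DERIV_cdivide DERIV_add DERIV_diff DERIV_cmult q2)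
    moreover have "(2 * A - 2 * (2 * B) + 2 * C) / (2 * h\<^sup>2) = (A - 2 * B + C) / h\<^sup>2" for A B C :: real
      using h by (simp add: field_simps)
    ultimately show ?thesis by (simp only: p''_def)
  qed
  have c: "continuous_on UNIV p''" unfolding p''_def by (intro continuous_intros) (use h in auto)
  have pos: "0 \<le> p'' t" for t
    unfolding p''_def using h by (intro divide_nonneg_nonneg) (auto simp: am max_def)
  have pb: "p' t = 1 \<and> p'' t = 0" if "b \<le> t" for t
  proof -
    have "(t - (m - h))\<^sup>2 - 2 * (t - m)\<^sup>2 + (t - (m + h))\<^sup>2 = 2 * h\<^sup>2" by (simp add: power2_eq_square algebra_simps)
    then show ?thesis using that h by (simp add: p'_def p''_def am max_def)
  qed
  have pa: "p t = 0 \<and> p' t = 0" if "t \<le> a" for t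
    using that h by (simp add: p_def p'_def am max_def)
  have mono: "p' s \<le> p' t" if "s \<le> t" for s t
    using DERIV_nonneg_imp_nondecreasing [OF that, of p'] d2 pos by blast
  have "0 \<le> p' t" "p' t \<le> 1" for t
    using mono [of "min a t" t] mono [of t "max b t"] pa [of "min a t"] pb [of "max b t"] by auto
  then show ?thesis
    using d1 d2 c pos pa pb by (intro exI [of _ p] exI [of _ p'] exI [of _ p'']) blast
qed

section \<open>Smooth approximation of plurisubharmonic functions\<close>

text \<open>
  The factor 4 is \<open>\<Sum> e \<cdot> cnj e\<close> over the four units \<open>e\<close>.
\<close>

lemma hessmat_add_id:
  fixes L :: "quat^'n \<Rightarrow> quat^'n"
  shows "hessmat (\<lambda>h. L h + t *\<^sub>R h) = hessmat L + (4 * t) *\<^sub>R mat 1"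
proof -
  have "hessmat (\<lambda>h. L h + t *\<^sub>R h) $ i $ j = (hessmat L + (4 * t) *\<^sub>R mat 1) $ i $ j" for i j
  proof -
    have u: "quat_unit c * quat_cnj (quat_unit c) = 1" for c
    proof -
      have "\<forall>c. quat_unit c * quat_cnj (quat_unit c) = 1"
        by (simp add: all_4 times_quat_def quat_cnj_def one_quat_def)
      then show ?thesis by blast
    qed
    have "(\<Sum>c\<in>UNIV. \<Sum>d\<in>UNIV. (t * (qaxis (i, c) \<bullet> qaxis (j, d))) *\<^sub>R (quat_unit c * quat_cnj (quat_unit d))) =
        (\<Sum>c\<in>UNIV. \<Sum>d\<in>UNIV. if c = d then if i = j then t *\<^sub>R (quat_unit c * quat_cnj (quat_unit d)) else 0 else 0)"
      by (intro sum.cong refl) (simp add: qaxis_orthonormal del: quat_unit_simps)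
    also have "\<dots> = (if i = j then (4 * t) *\<^sub>R 1 else 0)"
      by (cases "i = j") (simp_all add: u sum_constant_scaleR del: quat_unit_simps sum_constant)
    finally have "(\<Sum>c\<in>UNIV. \<Sum>d\<in>UNIV. (t * (qaxis (i, c) \<bullet> qaxis (j, d))) *\<^sub>R (quat_unit c * quat_cnj (quat_unit d))) =
        ((4 * t) *\<^sub>R mat 1 :: quat^'n^'n) $ i $ j" by (simp add: mat_def)
    then show ?thesis
      by (simp add: hessmat_nth inner_add_left scaleR_add_left sum.distrib del: quat_unit_simps)
  qed
  then show ?thesis by (simp add: vec_eq_iff)
qed

lemma line_laplacian_add: "line_laplacian (\<lambda>h. L h + L' h) v = line_laplacian L v + line_laplacian L' v"
  by (simp add: line_laplacian_def inner_add_right sum.distrib del: quat_unit_simps)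

lemma line_laplacian_scaleR: "line_laplacian (\<lambda>h. c *\<^sub>R L h) v = c * line_laplacian L v"
  by (simp add: line_laplacian_def sum_distrib_left del: quat_unit_simps)

lemma line_laplacian_id: "line_laplacian (\<lambda>h. c *\<^sub>R h) v = 4 * c * (v \<bullet> v)"
  by (simp add: line_laplacian_def right_mult_orthonormal del: quat_unit_simps)

lemma line_laplacian_rank_one: "0 \<le> line_laplacian (\<lambda>h. (G \<bullet> h) *\<^sub>R G) v"
  by (simp add: line_laplacian_def inner_commute [of _ G] sum_nonneg del: quat_unit_simps)

lemma continuous_moore_det_hessmat:
  fixes f :: "quat^'n \<Rightarrow> real"
  assumes C: "C2_data f G H"
  shows "continuous_on UNIV (\<lambda>x. moore_det (hessmat (H x)))"
proof -
  obtain p where p: "real_polynomial_function p" "\<And>A :: quat^'n^'n. hyperhermitian A \<Longrightarrow> moore_det A = p A"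
    using moore_det_characterization by metis
  have cp: "continuous_on UNIV p"
    using p(1) continuous_polymonial_function real_polynomial_function_eq
    by (metis continuous_at_imp_continuous_on)
  have "moore_det (hessmat (H x)) = p (hessmat (H x))" for x
    using C by (intro p(2) hyperhermitian_hessmat) (simp add: C2_data_def)
  then show ?thesis
    using continuous_on_compose2 [OF cp continuous_on_hessmat [OF C2_data_continuous(3) [OF C]]] by simp
qed

text \<open>
  The correction term of the regularized maximum is controlled only on an open set \<open>U\<close>, where it
  vanishes near the edge; beyond it is cut off.
\<close>

lemma C2_data_extend_by_zero:
  assumes C: "C2_data f G H" and U: "open U" and K: "closed K" "K \<subseteq> U" and z: "\<And>x. x \<in> U - K \<Longrightarrow> f x = 0"
  shows "C2_data (\<lambda>x. if x \<in> U then f x else 0) (\<lambda>x. if x \<in> U then G x else 0) (\<lambda>x h. if x \<in> U then H x h else 0)"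
proof -
  have d: "(f has_derivative (\<lambda>h. G x \<bullet> h)) (at x)" "(G has_derivative H x) (at x)" "H x h \<bullet> k = h \<bullet> H x k" for x h k
    using C by (auto simp: C2_data_def)
  have oUK: "open (U - K)" and oK: "open (- K)" using U K by auto
  have zG: "G x = 0" "H x h = 0" if "x \<in> U - K" for x h
    using C2_data_locally_zero [OF C oUK z that] by auto
  have cases: "x \<in> U \<or> x \<in> - K" for x using K by auto
  have glue: "((\<lambda>x. if x \<in> U then g x else 0) has_derivative (\<lambda>h. if x \<in> U then g' h else 0)) (at x)"
    if g: "(g has_derivative g') (at x)" "\<And>x. x \<in> U - K \<Longrightarrow> g x = 0"
    for g :: "'a \<Rightarrow> 'b::real_normed_vector" and g' x
  proof (cases "x \<in> U")
    case True
    then show ?thesis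
      using has_derivative_transform_within_open [OF g(1) U True, of "\<lambda>x. if x \<in> U then g x else 0"] by simp
  next
    case False
    then have "x \<in> - K" using K by auto
    have "((\<lambda>x. if x \<in> U then g x else 0) has_derivative (\<lambda>h. 0)) (at x)"
      by (rule has_derivative_transform_within_open [OF has_derivative_const [of 0] oK \<open>x \<in> - K\<close>]) (use g(2) in auto)
    then show ?thesis using False by simp
  qed
  show ?thesis
    unfolding C2_data_def
  proof (intro conjI allI)
    fix x h k
    show "((\<lambda>x. if x \<in> U then f x else 0) has_derivative (\<lambda>h. (if x \<in> U then G x else 0) \<bullet> h)) (at x)"
      using glue [OF d(1) z] by (simp add: if_distrib [of "\<lambda>y. y \<bullet> _"] cong: if_cong)
    show "((\<lambda>x. if x \<in> U then G x else 0) has_derivative (\<lambda>h. if x \<in> U then H x h else 0)) (at x)"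
      by (rule glue [OF d(2) zG(1)])
    show "(if x \<in> U then H x h else 0) \<bullet> k = h \<bullet> (if x \<in> U then H x k else 0)" by (simp add: d(3))
    have "continuous_on (U \<union> - K) (\<lambda>x. if x \<in> U then H x h else 0)"
    proof (rule continuous_on_open_Un [OF U oK])
      show "continuous_on U (\<lambda>x. if x \<in> U then H x h else 0)"
        using C2_data_continuous(3) [OF C, of U h] by (simp cong: continuous_on_cong)
      have "continuous_on (- K) (\<lambda>x. 0 :: 'a)" by simp
      then show "continuous_on (- K) (\<lambda>x. if x \<in> U then H x h else 0)"
        by (rule continuous_on_eq) (use zG in auto)
    qed
    moreover have "U \<union> - K = UNIV" using K by auto
    ultimately show "continuous_on UNIV (\<lambda>x. if x \<in> U then H x h else 0)" by simp
  qed
qed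

lemma C2_data_C2_on:
  assumes C: "C2_data f G H"
  shows "C2_on U f"
proof -
  have d: "(f has_derivative (\<lambda>h. G x \<bullet> h)) (at x)" "(G has_derivative H x) (at x)" for x
    using C by (auto simp: C2_data_def)
  note cs = C2_data_continuous [OF C]
  have bl: "bounded_linear (\<lambda>h. blinfun_inner_right (H x h))" for x
    by (rule bounded_linear_compose [OF bounded_linear_blinfun_inner_right has_derivative_bounded_linear [OF d(2)]])
  define f'' where "f'' x = Blinfun (\<lambda>h. blinfun_inner_right (H x h))" for x
  have f'': "blinfun_apply (f'' x) = (\<lambda>h. blinfun_inner_right (H x h))" for x
    unfolding f''_def by (rule bounded_linear_Blinfun_apply [OF bl])
  show ?thesis
    unfolding C2_on_def
  proof (intro exI [of _ "\<lambda>x. blinfun_inner_right (G x)"] exI [of _ f''] conjI ballI)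
    show "(f has_derivative blinfun_apply (blinfun_inner_right (G x))) (at x)" for x
      using d(1) [of x] by simp
    show "((\<lambda>x. blinfun_inner_right (G x)) has_derivative blinfun_apply (f'' x)) (at x)" for x
      unfolding f'' by (rule bounded_linear.has_derivative [OF bounded_linear_blinfun_inner_right d(2)])
    show "continuous_on U f''"
      by (intro continuous_on_blinfun_componentwise)
         (simp_all add: f'' inner_commute continuous_intros cs)
  qed
qed

text \<open>
  Convolution and the vanishing of the integral of the determinant are available for functions of compact
  support on the whole space. Well inside \<open>K\<close> the convolutions with small kernels see only
  \<open>u\<close>.
\<close>

lemma continuous_extension_compact_support:
  fixes u :: "'a::euclidean_space \<Rightarrow> real"
  assumes K: "compact K" and cu: "continuous_on K u"
  shows "\<exists>f R. continuous_on UNIV f \<and> (\<forall>x\<in>K. f x = u x) \<and> (\<forall>x. x \<notin> cball 0 R \<longrightarrow> f x = 0)"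
proof -
  obtain R where R: "\<And>x. x \<in> K \<Longrightarrow> norm x < R"
    using compact_imp_bounded [OF K] bounded_pos_less by metis
  have cl: "closed (- ball (0::'a) R)" by (intro closed_Compl open_ball)
  have "continuous_on (K \<union> - ball 0 R) (\<lambda>x. if x \<in> K then u x else 0)"
    by (rule continuous_on_cases) (use K cl cu R compact_imp_closed in \<open>auto simp: not_less [symmetric]\<close>)
  moreover have "closed (K \<union> - ball 0 R)" using K cl compact_imp_closed by blast
  ultimately obtain f where f: "continuous_on UNIV f" "\<And>x. x \<in> K \<union> - ball 0 R \<Longrightarrow> f x = (if x \<in> K then u x else 0)"
    using Tietze_unbounded [of "K \<union> - ball 0 R" "\<lambda>x. if x \<in> K then u x else 0" UNIV] by auto
  have "f x = 0" if "x \<notin> cball 0 R" for x using f(2) [of x] R [of x] that by (auto simp: not_le)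
  then show ?thesis using f by (intro exI [of _ f] exI [of _ R]) auto
qed

text \<open>
  The function is extended continuously with compact support and convolved with mollifiers of radius tending to
  0, smaller than the distance of \<open>L\<close> to the complement of \<open>\<Omega>\<close>. The Hessian is
  claimed to be nonnegative on \<open>L\<close> only, but the approximations are defined and compactly supported
  on the whole space.
\<close>

lemma psh_smooth_approximation:
  fixes u :: "quat^'n \<Rightarrow> real"
  assumes \<Omega>: "bounded \<Omega>" "open \<Omega>" and cu: "continuous_on (closure \<Omega>) u" and psh: "quat_psh_on \<Omega> u"
    and L: "compact L" "L \<subseteq> \<Omega>"
  shows "\<exists>w G H R. (\<forall>N::nat. C2_data (w N) (G N) (H N)) \<and> (\<forall>N x. x \<notin> cball 0 R \<longrightarrow> w N x = 0) \<and>
    (\<forall>N. \<forall>x\<in>L. \<forall>v. 0 \<le> line_laplacian (H N x) v) \<and> uniform_limit L w u sequentially"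
proof -
  have "compact (closure \<Omega>)" using \<Omega>(1) by (simp add: compact_closure)
  from continuous_extension_compact_support [OF this cu] obtain f R0 where cf: "continuous_on UNIV f" and
    fu: "\<And>x. x \<in> closure \<Omega> \<Longrightarrow> f x = u x" and z: "\<And>x. x \<notin> cball 0 R0 \<Longrightarrow> f x = 0" by auto
  obtain e where e: "0 < e" "(\<Union>x\<in>L. ball x e) \<subseteq> \<Omega>"
    by (rule compact_subset_open_imp_ball_epsilon_subset [OF L(1) \<Omega>(2) L(2)])
  (* Radii below e keep the translates of L in the domain; radii at most 1 keep all supports in one
     ball and all translates of L in one compact set. *)
  define d where "d N = min 1 (e / 2) * inverse (real (Suc N))" for N
  have d: "0 < d N" "d N \<le> 1" "d N < e" for N
  proof -
    have i: "0 < inverse (real (Suc N))" "inverse (real (Suc N)) \<le> 1" by (auto simp: divide_simps)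
    show "0 < d N" using e i by (simp add: d_def)
    have "d N \<le> min 1 (e / 2) * 1" unfolding d_def using e i by (intro mult_left_mono) auto
    then show "d N \<le> 1" "d N < e" using e by auto
  qed
  have d0: "d \<longlonglongrightarrow> 0"
    unfolding d_def by (intro tendsto_mult_right_zero LIMSEQ_inverse_real_of_nat)
  have "\<forall>N. \<exists>(\<rho> :: quat^'n \<Rightarrow> real) G H. C2_data \<rho> G H \<and> (\<forall>y. 0 \<le> \<rho> y) \<and>
    (\<forall>y. y \<notin> cball 0 (d N) \<longrightarrow> \<rho> y = 0) \<and> (\<integral>y. \<rho> y \<partial>lborel) = 1"
    using mollifier_exists d(1) by blast
  then obtain \<rho> :: "nat \<Rightarrow> quat^'n \<Rightarrow> real" and G\<rho> H\<rho> where \<rho>: "\<And>N. C2_data (\<rho> N) (G\<rho> N) (H\<rho> N)" "\<And>N y. 0 \<le> \<rho> N y"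
    "\<And>N y. y \<notin> cball 0 (d N) \<Longrightarrow> \<rho> N y = 0" "\<And>N. (\<integral>y. \<rho> N y \<partial>lborel) = 1" by metis
  define w where "w N x = (\<integral>y. f (x - y) * \<rho> N y \<partial>lborel)" for N x
  have "\<forall>N. \<exists>G H. C2_data (w N) G H"
    unfolding w_def using convolution_C2_data [OF cf _ \<rho>(1)] z by blast
  then obtain G H where C: "\<And>N. C2_data (w N) (G N) (H N)" by metis
  have c\<rho>: "continuous_on UNIV (\<rho> N)" for N by (rule C2_data_continuous(1) [OF \<rho>(1)])
  have "w N x = 0" if "x \<notin> cball 0 (R0 + 1)" for N x
  proof -
    have "f (x - y) * \<rho> N y = 0" for y
    proof (cases "y \<in> cball 0 (d N)")
      case True
      then have "norm y \<le> 1" using d(2) [of N] by simp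
      then have "x - y \<notin> cball 0 R0" using that norm_triangle_ineq4 [of "x - y" "- y"] by simp
      then show ?thesis using z by simp
    qed (simp add: \<rho>(3))
    then show ?thesis unfolding w_def by (simp only: integral_zero)
  qed
  moreover have "0 \<le> line_laplacian (H N x) v" if "x \<in> L" for N x v
  proof (rule mollified_line_laplacian_nonneg [OF psh \<Omega>(2) cf _ c\<rho> \<rho>(2,3,4)])
    show "f x = u x" if "x \<in> \<Omega>" for x using fu that closure_subset by blast
    show "C2_data (\<lambda>x. \<integral>y. f (x - y) * \<rho> N y \<partial>lborel) (G N) (H N)"
      using C [of N] by (simp add: w_def [abs_def])
    have "cball x (d N) \<subseteq> ball x e" using d(3) [of N] by (auto intro: le_less_trans)
    then show "cball x (d N) \<subseteq> \<Omega>" using e(2) that by blast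
  qed
  moreover have "uniform_limit L w u sequentially"
    unfolding uniform_limit_sequentially_iff
  proof (intro allI impI)
    fix \<tau> :: real assume \<tau>: "0 < \<tau>"
    let ?S = "{x - y |x y. x \<in> L \<and> y \<in> cball 0 1}"
    have "compact ?S" by (intro compact_differences L compact_cball)
    then have "uniformly_continuous_on ?S f"
      by (intro compact_uniformly_continuous continuous_on_subset [OF cf]) auto
    then obtain \<eta> where \<eta>: "0 < \<eta>" "\<And>p q. p \<in> ?S \<Longrightarrow> q \<in> ?S \<Longrightarrow> dist q p < \<eta> \<Longrightarrow> dist (f q) (f p) < \<tau> / 2"
      unfolding uniformly_continuous_on_def using \<tau> by (meson half_gt_zero)
    from order_tendstoD(2) [OF d0 \<eta>(1)] obtain N0 where N0: "\<And>N. N \<ge> N0 \<Longrightarrow> d N < \<eta>"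
      by (auto simp: eventually_sequentially)
    show "\<exists>N. \<forall>n\<ge>N. \<forall>x\<in>L. dist (w n x) (u x) < \<tau>"
    proof (intro exI [of _ N0] allI impI ballI)
      fix N x assume N: "N0 \<le> N" and x: "x \<in> L"
      have "\<bar>w N x - f x\<bar> \<le> \<tau> / 2"
        unfolding w_def
      proof (rule mollification_error [OF cf c\<rho> \<rho>(2,3,4)])
        fix y :: "quat^'n" assume y: "y \<in> cball 0 (d N)"
        have "norm y \<le> 1" using y d(2) [of N] by simp
        then have "x - y \<in> ?S" using x by (intro CollectI exI [of _ x] exI [of _ y]) simp
        moreover have "x \<in> ?S" using x by (intro CollectI exI [of _ x] exI [of _ "0 :: quat^'n"]) simp
        moreover have "dist (x - y) x < \<eta>" using y N0 [OF N] by (simp add: dist_norm)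
        ultimately have "dist (f (x - y)) (f x) < \<tau> / 2" using \<eta>(2) by blast
        then show "\<bar>f (x - y) - f x\<bar> \<le> \<tau> / 2" by (simp add: dist_real_def)
      qed
      moreover have "f x = u x" using fu x L(2) closure_subset by blast
      ultimately show "dist (w N x) (u x) < \<tau>" using \<tau> by (simp add: dist_real_def)
    qed
  qed
  ultimately show ?thesis using C
    by (intro exI [of _ w] exI [of _ G] exI [of _ H] exI [of _ "R0 + 1"]) blast
qed

text \<open>
  Adding \<open>|x|\<^sup>2 / (N + 1)\<close> makes the Laplacians on lines strictly positive, so that
  \<open>quat_psh_on_strict\<close> provides plurisubharmonicity, while the limit stays the same. The term adds
  twice the factor to the second derivative.
\<close>

lemma MA_measure_limit:
  fixes u :: "quat^'n \<Rightarrow> real" and w :: "nat \<Rightarrow> quat^'n \<Rightarrow> real"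
  assumes MA: "is_MA_measure \<Omega> u \<mu>" and U: "open U" "U \<subseteq> L" and L: "compact L" "L \<subseteq> \<Omega>"
    and C: "\<And>N. C2_data (w N) (G N) (H N)" and pos: "\<And>N x v. x \<in> L \<Longrightarrow> 0 \<le> line_laplacian (H N x) v"
    and lim: "uniform_limit L w u sequentially"
    and \<psi>: "continuous_on UNIV \<psi>" "closure {x. \<psi> x \<noteq> 0} \<subseteq> U"
  shows "(\<lambda>N. \<integral>x. \<psi> x * moore_det (hessmat (\<lambda>h. H N x h + (2 * inverse (real (Suc N))) *\<^sub>R h)) \<partial>lborel)
    \<longlonglongrightarrow> (\<integral>x. \<psi> x \<partial>\<mu>)"
proof -
  define t where "t N = inverse (real (Suc N))" for N
  have t: "0 < t N" for N by (simp add: t_def)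
  define g where "g N x = w N x + t N * (x \<bullet> x)" for N x
  have Cg: "C2_data (g N) (\<lambda>x. G N x + t N *\<^sub>R (2 *\<^sub>R x)) (\<lambda>x h. H N x h + t N *\<^sub>R (2 *\<^sub>R h))" for N
    unfolding g_def [abs_def] by (intro C2_data_add C C2_data_scale C2_data_norm_square)
  have qh: "quat_hessian (g N) x = hessmat (\<lambda>h. H N x h + (2 * inverse (real (Suc N))) *\<^sub>R h)" for N x
    unfolding quat_hessian_eq_hessmat [OF Cg] by (simp add: t_def mult.commute)
  have psh: "quat_psh_on U (g N)" for N
  proof (rule quat_psh_on_strict [OF Cg])
    fix x v :: "quat^'n" assume "x \<in> U" "v \<noteq> 0"
    then have "0 \<le> line_laplacian (H N x) v" "0 < v \<bullet> v" using pos U(2) by auto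
    then show "0 < line_laplacian (\<lambda>h. H N x h + t N *\<^sub>R 2 *\<^sub>R h) v"
      using t [of N] by (simp add: line_laplacian_add line_laplacian_id add_nonneg_pos)
  qed
  have ul: "uniform_limit K g u sequentially" if K: "K \<subseteq> U" for K
  proof -
    obtain B where B: "\<And>x. x \<in> L \<Longrightarrow> norm x \<le> B" using compact_imp_bounded [OF L(1)] bounded_iff by metis
    have "uniform_limit L (\<lambda>N x. t N * (x \<bullet> x)) (\<lambda>x. 0) sequentially"
      unfolding uniform_limit_sequentially_iff
    proof (intro allI impI)
      fix e :: real assume e: "0 < e"
      have "(\<lambda>N. t N * B\<^sup>2) \<longlonglongrightarrow> 0" unfolding t_def by (intro tendsto_mult_left_zero LIMSEQ_inverse_real_of_nat)
      from order_tendstoD(2) [OF this e] obtain N0 where N0: "\<And>N. N \<ge> N0 \<Longrightarrow> t N * B\<^sup>2 < e"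
        by (auto simp: eventually_sequentially)
      show "\<exists>N. \<forall>n\<ge>N. \<forall>x\<in>L. dist (t n * (x \<bullet> x)) 0 < e"
      proof (intro exI [of _ N0] allI impI ballI)
        fix N x assume N: "N0 \<le> N" and x: "x \<in> L"
        have "t N * (x \<bullet> x) \<le> t N * B\<^sup>2"
          using B [OF x] t [of N] by (intro mult_left_mono) (simp_all add: power2_norm_eq_inner [symmetric] power_mono)
        then have "t N * (x \<bullet> x) < e" using N0 [OF N] by linarith
        then show "dist (t N * (x \<bullet> x)) 0 < e" using t [of N] by (simp add: dist_real_def abs_mult)
      qed
    qed
    from uniform_limit_add [OF lim this] have "uniform_limit L g u sequentially" by (simp add: g_def [abs_def])
    then show ?thesis by (rule uniform_limit_on_subset) (use K U in auto)
  qed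
  have cmp: "compact (closure {x. \<psi> x \<noteq> 0})"
  proof -
    have "bounded (closure {x. \<psi> x \<noteq> 0})"
      by (rule bounded_subset [OF compact_imp_bounded [OF L(1)]]) (use \<psi>(2) U in blast)
    then show ?thesis by (simp add: compact_eq_bounded_closed)
  qed
  have "(\<lambda>N. \<integral>x. \<psi> x * moore_det (quat_hessian (g N) x) \<partial>lborel) \<longlonglongrightarrow> (\<integral>x. \<psi> x \<partial>\<mu>)"
  proof -
    have "open U \<and> U \<subseteq> \<Omega> \<and> (\<forall>N::nat. C2_on U (g N) \<and> quat_psh_on U (g N)) \<and>
        (\<forall>K. compact K \<and> K \<subseteq> U \<longrightarrow> uniform_limit K g u sequentially) \<and>
        continuous_on UNIV \<psi> \<and> compact (closure {x. \<psi> x \<noteq> 0}) \<and> closure {x. \<psi> x \<noteq> 0} \<subseteq> U"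
      using U L \<psi> cmp C2_data_C2_on [OF Cg] psh ul by auto
    then show ?thesis using MA unfolding is_MA_measure_def by blast
  qed
  then show ?thesis unfolding qh .
qed

section \<open>Comparison of masses\<close>

lemma measure_integral_sandwich:
  fixes M :: "'a::euclidean_space measure" and \<phi> :: "'a \<Rightarrow> real"
  assumes M: "sets M = sets (restrict_space borel \<Omega>)" and \<Omega>: "open \<Omega>" and fin: "emeasure M B < \<infinity>"
    and c: "continuous_on UNIV \<phi>" and A: "compact A" and B: "compact B" "A \<subseteq> B" "B \<subseteq> \<Omega>"
    and AB: "\<And>x. indicator A x \<le> \<phi> x" "\<And>x. \<phi> x \<le> indicator B x"
  shows "measure M A \<le> (\<integral>x. \<phi> x \<partial>M)" "(\<integral>x. \<phi> x \<partial>M) \<le> measure M B"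
proof -
  have [measurable]: "A \<in> sets M" "B \<in> sets M"
    using A B \<Omega> by (auto simp: M sets_restrict_space_iff compact_imp_closed)
  have finA: "emeasure M A < \<infinity>" using emeasure_mono [OF B(2), of M] fin by (simp add: le_less_trans)
  have "\<phi> \<in> borel_measurable borel" by (rule borel_measurable_continuous_onI [OF c])
  then have "\<phi> \<in> borel_measurable (restrict_space borel \<Omega>)" by (rule measurable_restrict_space1)
  then have [measurable]: "\<phi> \<in> borel_measurable M"
    using measurable_cong_sets [OF M refl] by blast
  have iA: "integrable M (indicator A :: 'a \<Rightarrow> real)" and iB: "integrable M (indicator B :: 'a \<Rightarrow> real)"
    using fin finA by (auto intro!: integrable_real_indicator)
  have n: "0 \<le> \<phi> x" for x by (rule order_trans [OF indicator_pos_le AB(1)])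
  have i\<phi>: "integrable M \<phi>"
    by (rule Bochner_Integration.integrable_bound [OF iB]) (use AB(2) n in \<open>auto intro!: AE_I2\<close>)
  have "measure M A = (\<integral>x. indicator A x \<partial>M)" using finA by (simp add: less_top)
  also have "\<dots> \<le> (\<integral>x. \<phi> x \<partial>M)" by (rule integral_mono [OF iA i\<phi>]) (rule AB)
  finally show "measure M A \<le> (\<integral>x. \<phi> x \<partial>M)" .
  have "(\<integral>x. \<phi> x \<partial>M) \<le> (\<integral>x. indicator B x \<partial>M)" by (rule integral_mono [OF i\<phi> iB]) (rule AB)
  also have "\<dots> = measure M B" using fin by (simp add: less_top)
  finally show "(\<integral>x. \<phi> x \<partial>M) \<le> measure M B" .
qed

text \<open>
  The regularized maximum \<open>w = u\<^sub>N + p(d\<^sub>N)\<close> agrees with \<open>u\<^sub>N\<close>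
  outside \<open>{d \<ge> a + h}\<close>, and both have total mass zero, so they have the same mass on that set.
  There the Hessian of \<open>w\<close> is nonnegative, and where \<open>d \<ge> b - h\<close> it is the Hessian
  of \<open>v\<^sub>N + \<epsilon> |x|\<^sup>2\<close>. Continuous cutoff functions \<open>\<psi>\<close> of the
  levels of \<open>d\<close> carry the resulting inequality of integrals to the weak limits.
\<close>

lemma moore_det_mass_inequality:
  fixes u v d :: "quat^'n \<Rightarrow> real"
  assumes \<Omega>: "bounded \<Omega>" "open \<Omega>"
    and cu: "continuous_on (closure \<Omega>) u" and cv: "continuous_on (closure \<Omega>) v"
    and psh: "quat_psh_on \<Omega> u" "quat_psh_on \<Omega> v"
    and MA: "is_MA_measure \<Omega> u \<mu>" "is_MA_measure \<Omega> v \<nu>"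
    and \<epsilon>: "0 < \<epsilon>" and d: "\<And>x. d x = v x + \<epsilon> * (x \<bullet> x) + c - u x"
    and fr: "\<And>x. x \<in> frontier \<Omega> \<Longrightarrow> d x < 0" and ab: "0 < a" "a < b"
  shows "measure \<nu> {x\<in>\<Omega>. b \<le> d x} + (4 * \<epsilon>) ^ CARD('n) * measure lborel {x\<in>\<Omega>. b \<le> d x} \<le> measure \<mu> {x\<in>\<Omega>. a \<le> d x}"
    and "\<And>s. 0 < s \<Longrightarrow> compact {x\<in>\<Omega>. s \<le> d x}"
    and "\<And>s. 0 \<le> s \<Longrightarrow> open {x\<in>\<Omega>. s < d x}"
proof -
  (* The positive part of d, extended by zero, is continuous on the whole space because d < 0 on the frontier. *)
  define D where "D x = (if x \<in> \<Omega> then max (d x) 0 else 0)" for x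
  have cD: "continuous_on UNIV D"
  proof -
    have "continuous_on (closure \<Omega> \<union> - \<Omega>) D"
      unfolding D_def
    proof (rule continuous_on_cases)
      show "continuous_on (closure \<Omega>) (\<lambda>x. max (d x) 0)"
        unfolding d by (intro continuous_intros cu cv)
      show "\<forall>x. x \<in> closure \<Omega> \<and> x \<notin> \<Omega> \<or> x \<in> - \<Omega> \<and> x \<in> \<Omega> \<longrightarrow> max (d x) 0 = 0"
      proof (intro allI impI)
        fix x assume "x \<in> closure \<Omega> \<and> x \<notin> \<Omega> \<or> x \<in> - \<Omega> \<and> x \<in> \<Omega>"
        then have "x \<in> frontier \<Omega>" using \<Omega>(2) by (auto simp: frontier_def interior_open)
        from fr [OF this] show "max (d x) 0 = 0" by simp
      qed
    qed (use \<Omega> in auto)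
    moreover have "closure \<Omega> \<union> - \<Omega> = UNIV" using closure_subset by blast
    ultimately show ?thesis by simp
  qed
  define K where "K s = {x. s \<le> D x}" for s
  have K_eq: "K s = {x\<in>\<Omega>. s \<le> d x}" if "0 < s" for s
    using that by (auto simp: K_def D_def max_def split: if_splits)
  have K\<Omega>: "K s \<subseteq> \<Omega>" if "0 < s" for s using K_eq [OF that] by blast
  have compK: "compact (K s)" if "0 < s" for s
  proof -
    have "closed (K s)" unfolding K_def by (intro closed_Collect_le cD continuous_on_const)
    then show ?thesis using bounded_subset [OF \<Omega>(1) K\<Omega> [OF that]] by (simp add: compact_eq_bounded_closed)
  qed
  then show "\<And>s. 0 < s \<Longrightarrow> compact {x\<in>\<Omega>. s \<le> d x}" using K_eq by simp
  show "open {x\<in>\<Omega>. s < d x}" if "0 \<le> s" for s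
  proof -
    have "{x\<in>\<Omega>. s < d x} = {x. s < D x}" using that by (auto simp: D_def max_def split: if_splits)
    moreover have "open {x. s < D x}" by (intro open_Collect_less cD continuous_on_const)
    ultimately show ?thesis by simp
  qed
  have Kmono: "K t \<subseteq> K s" if "s \<le> t" for s t using that by (auto simp: K_def)
  have Dd: "D x = d x" if "0 < D x" for x using that by (auto simp: D_def max_def split: if_splits)
  (* Five steps between a and b: the cutoff at a is 1 from a + h on, the ramp p rises between
     a + 2h and a + 3h, and the cutoff at b - h = a + 4h is 1 from b on. The spare steps absorb the error h of d_N. *)
  define h where "h = (b - a) / 5"
  have h: "0 < h" "b = a + 5 * h" using ab by (auto simp: h_def field_simps)
  define U where "U = {x. a / 2 < D x}"
  define L where "L = K (a / 2)"
  have "open U" unfolding U_def by (intro open_Collect_less cD continuous_on_const)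
  then have U: "open U" "U \<subseteq> L" by (auto simp: U_def L_def K_def)
  have L: "compact L" "L \<subseteq> \<Omega>" using ab compK K\<Omega> by (auto simp: L_def)
  have KU: "K s \<subseteq> U" if "a \<le> s" for s using that ab by (auto simp: K_def U_def)
  define \<psi> where "\<psi> s x = max 0 (min 1 ((D x - s) / h))" for s x
  have c\<psi>: "continuous_on UNIV (\<psi> s)" for s
    unfolding \<psi>_def by (intro continuous_intros cD) (use h in auto)
  have \<psi>1: "\<psi> s x = 1" if "s + h \<le> D x" for s x
    using that h by (simp add: \<psi>_def min_def field_simps)
  have \<psi>0: "\<psi> s x = 0" if "D x \<le> s" for s x
  proof -
    have "(D x - s) / h \<le> 0" using that h by (simp add: divide_nonpos_pos)
    then show ?thesis by (auto simp: \<psi>_def max_def min_def)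
  qed
  have \<psi>b: "0 \<le> \<psi> s x" "\<psi> s x \<le> 1" for s x by (auto simp: \<psi>_def)
  have sand: "indicator (K (s + h)) x \<le> \<psi> s x" "\<psi> s x \<le> indicator (K s) x" for s x
    using \<psi>1 [of s x] \<psi>0 [of x s] \<psi>b [of s x] by (auto simp: indicator_def K_def not_le)
  have supp: "closure {x. \<psi> s x \<noteq> 0} \<subseteq> U" if "a \<le> s" for s
  proof -
    have "{x. \<psi> s x \<noteq> 0} \<subseteq> K s"
    proof
      fix x assume "x \<in> {x. \<psi> s x \<noteq> 0}"
      then have "\<not> D x \<le> s" using \<psi>0 [of x s] by blast
      then show "x \<in> K s" by (simp add: K_def)
    qed
    then have "closure {x. \<psi> s x \<noteq> 0} \<subseteq> K s"
      using compK [of s] that ab by (intro closure_minimal) (auto intro: compact_imp_closed)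
    then show ?thesis using KU [OF that] by blast
  qed
  have finM: "emeasure M (K s) < \<infinity>" if "is_MA_measure \<Omega> f M" "0 < s" for M f s
    using that compK [OF that(2)] K\<Omega> [OF that(2)] unfolding is_MA_measure_def by blast
  have setsM: "sets M = sets (restrict_space borel \<Omega>)" if "is_MA_measure \<Omega> f M" for M f
    using that unfolding is_MA_measure_def by blast
  obtain wu Gu Hu Ru where Cu: "\<And>N. C2_data (wu N) (Gu N) (Hu N)" and zu: "\<And>N x. x \<notin> cball 0 Ru \<Longrightarrow> wu N x = 0"
    and pu: "\<And>N x v. x \<in> L \<Longrightarrow> 0 \<le> line_laplacian (Hu N x) v" and lu: "uniform_limit L wu u sequentially"
    using psh_smooth_approximation [OF \<Omega> cu psh(1) L] by metis
  obtain wv Gv Hv Rv where Cv: "\<And>N. C2_data (wv N) (Gv N) (Hv N)"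
    and pv: "\<And>N x v. x \<in> L \<Longrightarrow> 0 \<le> line_laplacian (Hv N x) v" and lv: "uniform_limit L wv v sequentially"
    using psh_smooth_approximation [OF \<Omega> cv psh(2) L] by metis
  define t where "t N = inverse (real (Suc N))" for N
  have t: "0 < t N" for N by (simp add: t_def)
  define mu where "mu N x = moore_det (hessmat (\<lambda>h. Hu N x h + (2 * t N) *\<^sub>R h))" for N x
  define mv where "mv N x = moore_det (hessmat (\<lambda>h. Hv N x h + (2 * t N) *\<^sub>R h))" for N x
  have lim_u: "(\<lambda>N. \<integral>x. \<psi> a x * mu N x \<partial>lborel) \<longlonglongrightarrow> (\<integral>x. \<psi> a x \<partial>\<mu>)"
    unfolding mu_def t_def by (rule MA_measure_limit [OF MA(1) U L Cu pu lu c\<psi> supp]) simp_all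
  have lim_v: "(\<lambda>N. \<integral>x. \<psi> (b - h) x * mv N x \<partial>lborel) \<longlonglongrightarrow> (\<integral>x. \<psi> (b - h) x \<partial>\<nu>)"
    unfolding mv_def t_def by (rule MA_measure_limit [OF MA(2) U L Cv pv lv c\<psi> supp]) (use h in simp_all)
  have symu: "Hu N x y \<bullet> k = y \<bullet> Hu N x k" and linu: "linear (Hu N x)" for N x y k
    using Cu C2_data_continuous(4) [OF Cu] by (auto simp: C2_data_def)
  have symv: "Hv N x y \<bullet> k = y \<bullet> Hv N x k" and linv: "linear (Hv N x)" for N x y k
    using Cv C2_data_continuous(4) [OF Cv] by (auto simp: C2_data_def)
  have psdu: "psd (hessmat (Hu N x))" if "x \<in> L" for N x using psd_hessmat [OF linu symu pu [OF that]] .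
  have psdv: "psd (hessmat (Hv N x))" if "x \<in> L" for N x using psd_hessmat [OF linv symv pv [OF that]] .
  have Cu': "C2_data (\<lambda>x. wu N x + t N * (x \<bullet> x)) (\<lambda>x. Gu N x + t N *\<^sub>R (2 *\<^sub>R x)) (\<lambda>x h. Hu N x h + t N *\<^sub>R (2 *\<^sub>R h))" for N
    by (intro C2_data_add Cu C2_data_scale C2_data_norm_square)
  have Cv': "C2_data (\<lambda>x. wv N x + t N * (x \<bullet> x)) (\<lambda>x. Gv N x + t N *\<^sub>R (2 *\<^sub>R x)) (\<lambda>x h. Hv N x h + t N *\<^sub>R (2 *\<^sub>R h))" for N
    by (intro C2_data_add Cv C2_data_scale C2_data_norm_square)
  have cmu: "continuous_on UNIV (mu N)" and cmv: "continuous_on UNIV (mv N)" for N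
    using continuous_moore_det_hessmat [OF Cu' [of N]] continuous_moore_det_hessmat [OF Cv' [of N]]
    by (simp_all add: mu_def [abs_def] mv_def [abs_def] mult.commute)
  obtain R where "\<And>x. x \<in> \<Omega> \<Longrightarrow> norm x \<le> R" using \<Omega>(1) bounded_iff by metis
  then have R: "\<Omega> \<subseteq> cball 0 R" by auto
  have \<psi>z: "\<psi> s x = 0" if "x \<notin> cball 0 R" "0 \<le> s" for s x
  proof -
    have "x \<notin> \<Omega>" using that R by blast
    then show ?thesis using \<psi>0 [of x s] that by (simp add: D_def)
  qed
  have i\<psi>: "integrable lborel (\<psi> s)" "continuous_on UNIV g \<Longrightarrow> integrable lborel (\<lambda>x. \<psi> s x * g x)" if "0 \<le> s" for s and g :: "quat^'n \<Rightarrow> real"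
    using \<psi>z [OF _ that] by (auto intro!: integrable_compact_support [where R = R] continuous_intros c\<psi>)
  obtain p p' p'' :: "real \<Rightarrow> real" where P: "(\<forall>t. (p has_real_derivative p' t) (at t)) \<and>
      (\<forall>t. (p' has_real_derivative p'' t) (at t)) \<and> continuous_on UNIV p'' \<and>
      (\<forall>t. 0 \<le> p'' t \<and> 0 \<le> p' t \<and> p' t \<le> 1) \<and> (\<forall>t\<le>a + 2 * h. p t = 0) \<and> (\<forall>t\<ge>a + 3 * h. p' t = 1 \<and> p'' t = 0)"
  proof -
    have "a + 2 * h < a + 3 * h" using h by simp
    from smooth_ramp_exists [OF this] show thesis by (elim exE) (rule that)
  qed
  then have p1: "\<And>s. (p has_real_derivative p' s) (at s)"
    and p2: "\<And>s. (p' has_real_derivative p'' s) (at s)" and p3: "continuous_on UNIV p''"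
    and pp: "\<And>s. 0 \<le> p'' s" "\<And>s. 0 \<le> p' s" "\<And>s. p' s \<le> 1" and p0: "\<And>s. s \<le> a + 2 * h \<Longrightarrow> p s = 0"
    and pe: "\<And>s. a + 3 * h \<le> s \<Longrightarrow> p' s = 1" "\<And>s. a + 3 * h \<le> s \<Longrightarrow> p'' s = 0"
    by blast+
  have key: "\<forall>\<^sub>F N in sequentially. (\<integral>x. \<psi> (b - h) x * mv N x \<partial>lborel) + (4 * \<epsilon>) ^ CARD('n) * (\<integral>x. \<psi> (b - h) x \<partial>lborel)
      \<le> (\<integral>x. \<psi> a x * mu N x \<partial>lborel)"
  proof -
    have "\<forall>\<^sub>F N in sequentially. \<forall>x\<in>L. dist (wu N x) (u x) < h / 2"
      by (rule uniform_limitD [OF lu]) (use h in simp)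
    moreover have "\<forall>\<^sub>F N in sequentially. \<forall>x\<in>L. dist (wv N x) (v x) < h / 2"
      by (rule uniform_limitD [OF lv]) (use h in simp)
    moreover have "\<forall>\<^sub>F N in sequentially. t N < \<epsilon> / 2"
      using order_tendstoD(2) [OF LIMSEQ_inverse_real_of_nat, of "\<epsilon> / 2"] \<epsilon> by (simp add: t_def)
    ultimately show ?thesis
    proof eventually_elim
      case (elim N)
      define dN where "dN x = wv N x + (\<epsilon> * (x \<bullet> x) + (c + (- 1) * wu N x))" for x
      define GN where "GN x = Gv N x + (\<epsilon> *\<^sub>R (2 *\<^sub>R x) + (0 + (- 1) *\<^sub>R Gu N x))" for x
      define HN where "HN x y = Hv N x y + (\<epsilon> *\<^sub>R (2 *\<^sub>R y) + (0 + (- 1) *\<^sub>R Hu N x y))" for x y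
      have CN: "C2_data dN GN HN"
        unfolding dN_def [abs_def] GN_def [abs_def] HN_def [abs_def]
        by (intro C2_data_add Cv Cu C2_data_scale C2_data_norm_square C2_data_const)
      have near: "\<bar>dN x - d x\<bar> \<le> h" if "x \<in> L" for x
      proof -
        have "\<bar>wu N x - u x\<bar> < h / 2" "\<bar>wv N x - v x\<bar> < h / 2"
          using elim(1,2) that by (auto simp: dist_real_def)
        moreover have "dN x - d x = (wv N x - v x) - (wu N x - u x)" by (simp add: dN_def d)
        ultimately show ?thesis by linarith
      qed
      define KK where "KK = K (a + h)"
      have KK: "closed KK" "KK \<subseteq> U" "KK \<subseteq> L"
      proof -
        have ah: "0 < a + h" "a \<le> a + h" using ab h by auto
        show "closed KK" unfolding KK_def by (rule compact_imp_closed [OF compK [OF ah(1)]])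
        show "KK \<subseteq> U" unfolding KK_def by (rule KU [OF ah(2)])
        then show "KK \<subseteq> L" using U(2) by (rule subset_trans)
      qed
      have pz: "p (dN x) = 0" if x: "x \<in> U - KK" for x
      proof (rule p0)
        have "x \<in> L" "D x < a + h" "0 < D x" using x U(2) ab by (auto simp: KK_def K_def U_def)
        then show "dN x \<le> a + 2 * h" using near [of x] Dd [of x] by auto
      qed
      define kk where "kk x = (if x \<in> U then p (dN x) else 0)" for x
      define Hk where "Hk x y = (if x \<in> U then (p'' (dN x) * (GN x \<bullet> y)) *\<^sub>R GN x + p' (dN x) *\<^sub>R HN x y else 0)" for x y
      obtain Gk where Ck: "C2_data kk Gk Hk"
        using C2_data_extend_by_zero [OF C2_data_compose [OF CN p1 p2 p3] U(1) KK(1,2) pz]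
        unfolding kk_def [abs_def] Hk_def [abs_def] by blast
      define Hw where "Hw x y = Hu N x y + Hk x y" for x y
      have Cw: "C2_data (\<lambda>x. wu N x + kk x) (\<lambda>x. Gu N x + Gk x) Hw"
        unfolding Hw_def [abs_def] by (rule C2_data_add [OF Cu Ck])
      have Hk0: "Hk x y = 0" if "x \<notin> KK" for x y
      proof -
        have "kk x = 0" if "x \<in> - KK" for x using pz [of x] that by (auto simp: kk_def)
        then show ?thesis
          using C2_data_locally_zero(2) [OF Ck, of "- KK" x y] KK(1) that by auto
      qed
      have kkR: "kk x = 0" if "x \<notin> cball 0 R" for x
      proof -
        have "x \<notin> U" using that R U(2) L(2) by blast
        then show ?thesis by (simp add: kk_def)
      qed
      define R' where "R' = max R Ru"
      have z': "wu N x = 0" "wu N x + kk x = 0" if "x \<notin> cball 0 R'" for x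
        using zu [of x N] kkR [of x] that by (auto simp: R'_def)
      have Iw: "(\<integral>x. moore_det (hessmat (Hw x)) \<partial>lborel) = 0"
        by (rule integral_moore_det_hessian_zero [OF Cw]) (rule z'(2))
      have Iu: "(\<integral>x. moore_det (hessmat (Hu N x)) \<partial>lborel) = 0"
        by (rule integral_moore_det_hessian_zero [OF Cu]) (rule z'(1))
      have zH: "moore_det (hessmat (H x)) = 0"
        if C: "C2_data f G H" "\<And>x. x \<notin> cball 0 R' \<Longrightarrow> f x = 0" "x \<notin> cball 0 R'" for f G H and x :: "quat^'n"
      proof -
        have "H x y = 0" for y using C2_data_locally_zero(2) [OF C(1), of "- cball 0 R'" x y] C(2,3) by auto
        then show ?thesis by (simp add: hessmat_zero moore_det_zero)
      qed
      have iw: "integrable lborel (\<lambda>x. moore_det (hessmat (Hw x)))"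
        by (rule integrable_compact_support [OF continuous_moore_det_hessmat [OF Cw]]) (rule zH [OF Cw z'(2)])
      have iu: "integrable lborel (\<lambda>x. moore_det (hessmat (Hu N x)))"
        by (rule integrable_compact_support [OF continuous_moore_det_hessmat [OF Cu]]) (rule zH [OF Cu z'(1)])
      have KKs [measurable]: "KK \<in> sets borel" using KK(1) by simp
      have iwK: "integrable lborel (\<lambda>x. indicator KK x * moore_det (hessmat (Hw x)))"
        using integrable_mult_indicator [OF _ iw, of KK] by simp
      have iuK: "integrable lborel (\<lambda>x. indicator KK x * moore_det (hessmat (Hu N x)))"
        using integrable_mult_indicator [OF _ iu, of KK] by simp
      have "(\<integral>x. indicator KK x * moore_det (hessmat (Hw x)) \<partial>lborel) - (\<integral>x. indicator KK x * moore_det (hessmat (Hu N x)) \<partial>lborel)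
          = (\<integral>x. moore_det (hessmat (Hw x)) - moore_det (hessmat (Hu N x)) \<partial>lborel)"
      proof -
        have "indicator KK x * moore_det (hessmat (Hw x)) - indicator KK x * moore_det (hessmat (Hu N x)) =
            moore_det (hessmat (Hw x)) - moore_det (hessmat (Hu N x))" for x
        proof (cases "x \<in> KK")
          case False
          then have "Hw x = Hu N x" using Hk0 [OF False] by (simp add: Hw_def fun_eq_iff)
          then show ?thesis by simp
        qed simp
        then show ?thesis using iwK iuK by (simp flip: Bochner_Integration.integral_diff)
      qed
      (* The null Lagrangian property for both functions. *)
      also have "\<dots> = 0" using iw iu Iw Iu by simp
      finally have mass: "(\<integral>x. indicator KK x * moore_det (hessmat (Hw x)) \<partial>lborel) = (\<integral>x. indicator KK x * moore_det (hessmat (Hu N x)) \<partial>lborel)"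
        by simp
      have psdw: "psd (hessmat (Hw x))" if "x \<in> KK" for x
      proof (rule psd_hessmat)
        have xU: "x \<in> U" "x \<in> L" using that KK by auto
        show "linear (Hw x)" using C2_data_continuous(4) [OF Cw] .
        show "Hw x y \<bullet> k = y \<bullet> Hw x k" for y k using Cw by (auto simp: C2_data_def)
        fix w
        have "line_laplacian (Hw x) w = line_laplacian (Hu N x) w +
            (p'' (dN x) * line_laplacian (\<lambda>y. (GN x \<bullet> y) *\<^sub>R GN x) w + p' (dN x) * line_laplacian (HN x) w)"
          using xU by (simp add: Hw_def [abs_def] Hk_def line_laplacian_add flip: line_laplacian_scaleR)
        also have "line_laplacian (HN x) w = line_laplacian (Hv N x) w + 8 * \<epsilon> * (w \<bullet> w) - line_laplacian (Hu N x) w"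
        proof -
          have "HN x = (\<lambda>y. Hv N x y + ((2 * \<epsilon>) *\<^sub>R y + (- 1) *\<^sub>R Hu N x y))"
            by (simp add: fun_eq_iff HN_def)
          then show ?thesis
            by (simp only: line_laplacian_add line_laplacian_scaleR [of "- 1" "Hu N x"] line_laplacian_id)
        qed
        (* A convex combination of the Laplacians of both functions plus a nonnegative rank-one term. *)
        finally have e: "line_laplacian (Hw x) w = (1 - p' (dN x)) * line_laplacian (Hu N x) w +
            p' (dN x) * (line_laplacian (Hv N x) w + 8 * \<epsilon> * (w \<bullet> w)) +
            p'' (dN x) * line_laplacian (\<lambda>y. (GN x \<bullet> y) *\<^sub>R GN x) w"
          by (simp add: algebra_simps)
        show "0 \<le> line_laplacian (Hw x) w"
          unfolding e using pp pu [OF xU(2)] pv [OF xU(2)] \<epsilon> line_laplacian_rank_one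
          by (intro add_nonneg_nonneg mult_nonneg_nonneg) auto
      qed
      have low: "\<psi> (b - h) x * mv N x + \<psi> (b - h) x * (4 * \<epsilon>) ^ CARD('n) \<le> indicator KK x * moore_det (hessmat (Hw x))" for x
      proof (cases "b - h < D x")
        case False
        then show ?thesis using \<psi>0 [of x "b - h"] moore_det_nonneg [OF psdw, of x] by (simp add: indicator_def)
      next
        case True
        then have xK: "x \<in> KK" "0 < D x" using h ab by (auto simp: KK_def K_def)
        then have xU: "x \<in> U" "x \<in> L" using KK by auto
        have "a + 3 * h \<le> dN x" using near [OF xU(2)] Dd [OF xK(2)] True h by linarith
        then have e1: "Hw x = (\<lambda>y. Hv N x y + (2 * \<epsilon>) *\<^sub>R y)"
          using xU by (simp add: fun_eq_iff Hw_def Hk_def HN_def pe)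
        (* The measure of v is approximated by v_N + t_N |x|^2, hence part of eps |x|^2 is spent on t_N.
           Since t_N < eps / 2, the rest still contributes at least 4 eps to every eigenvalue. *)
        have Hw: "hessmat (Hw x) = hessmat (\<lambda>y. Hv N x y + (2 * t N) *\<^sub>R y) + (8 * (\<epsilon> - t N)) *\<^sub>R mat 1"
          unfolding e1 hessmat_add_id by (simp add: algebra_simps flip: scaleR_add_left)
        have ps: "psd (hessmat (\<lambda>y. Hv N x y + (2 * t N) *\<^sub>R y))"
        proof (rule psd_hessmat)
          show "linear (\<lambda>y. Hv N x y + (2 * t N) *\<^sub>R y)"
            by (intro linear_compose_add linv linear_scale_self)
          show "(Hv N x y + (2 * t N) *\<^sub>R y) \<bullet> k = y \<bullet> (Hv N x k + (2 * t N) *\<^sub>R k)" for y k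
            by (simp add: inner_add_left inner_add_right symv)
          show "0 \<le> line_laplacian (\<lambda>y. Hv N x y + (2 * t N) *\<^sub>R y) w" for w
            using pv [OF xU(2)] t [of N] by (simp add: line_laplacian_add line_laplacian_id)
        qed
        have "(4 * \<epsilon>) ^ CARD('n) \<le> (8 * (\<epsilon> - t N)) ^ CARD('n)"
          using elim(3) \<epsilon> by (intro power_mono) auto
        then have X: "mv N x + (4 * \<epsilon>) ^ CARD('n) \<le> moore_det (hessmat (Hw x))"
          using moore_det_add_scalar [OF ps, of "8 * (\<epsilon> - t N)"] elim(3) \<epsilon> unfolding Hw mv_def by simp
        have "0 \<le> mv N x + (4 * \<epsilon>) ^ CARD('n)"
          using moore_det_nonneg [OF ps] \<epsilon> by (simp add: mv_def)
        then have "\<psi> (b - h) x * (mv N x + (4 * \<epsilon>) ^ CARD('n)) \<le> 1 * (mv N x + (4 * \<epsilon>) ^ CARD('n))"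
          using \<psi>b by (intro mult_right_mono) auto
        then show ?thesis using X xK by (simp add: distrib_left)
      qed
      have high: "indicator KK x * moore_det (hessmat (Hu N x)) \<le> \<psi> a x * mu N x" for x
      proof (cases "x \<in> L")
        case True
        have "moore_det (hessmat (Hu N x)) + (8 * t N) ^ CARD('n) \<le> mu N x"
          using moore_det_add_scalar [OF psdu [OF True], of "8 * t N" N] t [of N]
          unfolding mu_def hessmat_add_id by simp
        moreover have "0 \<le> (8 * t N) ^ CARD('n)" using t [of N] by simp
        ultimately have le: "moore_det (hessmat (Hu N x)) \<le> mu N x" by linarith
        have "0 \<le> moore_det (hessmat (Hu N x))" by (rule moore_det_nonneg [OF psdu [OF True]])
        then show ?thesis
          using le \<psi>1 [of a x] \<psi>b [of a x] by (auto simp: indicator_def KK_def K_def)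
      next
        case False
        then have "x \<notin> KK" "D x \<le> a" using KK U(2) ab by (auto simp: L_def K_def)
        then show ?thesis using \<psi>0 [of x a] by simp
      qed
      have bh: "0 \<le> b - h" using h ab by simp
      have "(\<integral>x. \<psi> (b - h) x * mv N x \<partial>lborel) + (4 * \<epsilon>) ^ CARD('n) * (\<integral>x. \<psi> (b - h) x \<partial>lborel) =
          (\<integral>x. \<psi> (b - h) x * mv N x + \<psi> (b - h) x * (4 * \<epsilon>) ^ CARD('n) \<partial>lborel)"
        using i\<psi>(2) [OF bh cmv [of N]] i\<psi>(1) [OF bh] by simp
      also have "\<dots> \<le> (\<integral>x. indicator KK x * moore_det (hessmat (Hw x)) \<partial>lborel)"
      proof (rule integral_mono [OF _ iwK low])
        show "integrable lborel (\<lambda>x. \<psi> (b - h) x * mv N x + \<psi> (b - h) x * (4 * \<epsilon>) ^ CARD('n))"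
          by (intro Bochner_Integration.integrable_add integrable_mult_left i\<psi> bh cmv)
      qed
      also have "\<dots> = (\<integral>x. indicator KK x * moore_det (hessmat (Hu N x)) \<partial>lborel)" by (rule mass)
      also have "\<dots> \<le> (\<integral>x. \<psi> a x * mu N x \<partial>lborel)"
        by (rule integral_mono [OF iuK i\<psi>(2) high]) (use ab cmu in auto)
      finally show ?case .
    qed
  qed
  have 0: "(\<integral>x. \<psi> (b - h) x \<partial>\<nu>) + (4 * \<epsilon>) ^ CARD('n) * (\<integral>x. \<psi> (b - h) x \<partial>lborel) \<le> (\<integral>x. \<psi> a x \<partial>\<mu>)"
    by (rule tendsto_le [OF _ lim_u tendsto_add [OF lim_v tendsto_const] key]) simp
  have bb: "b - h + h = b" "0 < b - h" "b - h \<le> b" "0 < b" using h ab by auto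
  have 1: "measure \<nu> (K b) \<le> (\<integral>x. \<psi> (b - h) x \<partial>\<nu>)"
    by (rule measure_integral_sandwich(1) [OF setsM [OF MA(2)] \<Omega>(2) finM [OF MA(2)] c\<psi> compK compK Kmono K\<Omega>, of "b - h" b])
       (use bb sand [of "b - h"] in auto)
  have 2: "(\<integral>x. \<psi> a x \<partial>\<mu>) \<le> measure \<mu> (K a)"
    by (rule measure_integral_sandwich(2) [OF setsM [OF MA(1)] \<Omega>(2) finM [OF MA(1)] c\<psi> compK compK Kmono K\<Omega>, of a "a + h"])
       (use h ab sand [of a] in auto)
  have "sets lborel = sets (restrict_space (borel :: (quat^'n) measure) UNIV)"
    by (simp add: sets_restrict_space)
  then have 3: "measure lborel (K b) \<le> (\<integral>x. \<psi> (b - h) x \<partial>lborel)"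
    by (rule measure_integral_sandwich(1) [of lborel UNIV "K (b - h)" "\<psi> (b - h)" "K b"])
       (use bb sand [of "b - h"] compK [of "b - h"] compK [of b] Kmono c\<psi> emeasure_compact_finite in auto)
  have "(4 * \<epsilon>) ^ CARD('n) * measure lborel (K b) \<le> (4 * \<epsilon>) ^ CARD('n) * (\<integral>x. \<psi> (b - h) x \<partial>lborel)"
    by (intro mult_left_mono 3) (use \<epsilon> in simp)
  with 0 1 2 have "measure \<nu> (K b) + (4 * \<epsilon>) ^ CARD('n) * measure lborel (K b) \<le> measure \<mu> (K a)"
    by linarith
  then show "measure \<nu> {x\<in>\<Omega>. b \<le> d x} + (4 * \<epsilon>) ^ CARD('n) * measure lborel {x\<in>\<Omega>. b \<le> d x} \<le> measure \<mu> {x\<in>\<Omega>. a \<le> d x}"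
    unfolding K_eq [OF ab(1)] K_eq [OF bb(4)] .
qed

section \<open>The comparison principle\<close>

text \<open>
  Below a level \<open>s\<close> with \<open>{d > s} \<noteq> {}\<close> the mass inequality forces
  \<open>\<nu> {d \<ge> t}\<close> to increase by at least \<open>\<eta> > 0\<close> whenever \<open>t\<close>
  decreases, by however little. The levels \<open>b k\<close> decrease to \<open>s / 2\<close>, and
  \<open>\<nu>\<close> is finite on the compact set \<open>{d \<ge> s / 2}\<close>.
\<close>

lemma MA_comparison_interior:
  fixes \<Omega> :: "(quat^'n) set" and u v :: "quat^'n \<Rightarrow> real" and \<mu> \<nu> :: "(quat^'n) measure"
  assumes \<Omega>: "bounded \<Omega>" "open \<Omega>"
    and cu: "continuous_on (closure \<Omega>) u" and cv: "continuous_on (closure \<Omega>) v"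
    and psh: "quat_psh_on \<Omega> u" "quat_psh_on \<Omega> v"
    and MA: "is_MA_measure \<Omega> u \<mu>" "is_MA_measure \<Omega> v \<nu>"
    and le: "\<forall>E\<in>sets borel. E \<subseteq> \<Omega> \<longrightarrow> emeasure \<mu> E \<le> emeasure \<nu> E"
    and fr: "\<And>z. z \<in> frontier \<Omega> \<Longrightarrow> m \<le> u z - v z" and z0: "z0 \<in> \<Omega>"
  shows "m \<le> u z0 - v z0"
proof (rule ccontr)
  assume neg: "\<not> ?thesis"
  define g where "g = m - (u z0 - v z0)"
  have g: "0 < g" using neg by (simp add: g_def)
  have "bounded (closure \<Omega>)" using \<Omega>(1) by (rule bounded_closure)
  then obtain R where R: "\<And>x. x \<in> closure \<Omega> \<Longrightarrow> norm x \<le> R" using bounded_iff by metis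
  (* The perturbation eps |x|^2 is at most a quarter of the gap g, and R^2 + 1 avoids a division by zero. *)
  define \<epsilon> where "\<epsilon> = g / (4 * (R\<^sup>2 + 1))"
  have R1: "0 < R\<^sup>2 + 1" by (simp add: add_nonneg_pos)
  have \<epsilon>: "0 < \<epsilon>" using g R1 by (simp add: \<epsilon>_def)
  have \<epsilon>R: "\<epsilon> * (x \<bullet> x) \<le> g / 4" if "x \<in> closure \<Omega>" for x
  proof -
    have "x \<bullet> x \<le> R\<^sup>2" using R [OF that] by (simp add: power2_norm_eq_inner [symmetric] power_mono)
    then have "\<epsilon> * (x \<bullet> x) \<le> \<epsilon> * (R\<^sup>2 + 1)" using \<epsilon> by (intro mult_left_mono) auto
    also have "\<dots> = g / 4" using R1 unfolding \<epsilon>_def by (auto simp: divide_simps)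
    finally show ?thesis .
  qed
  define d where "d x = v x + \<epsilon> * (x \<bullet> x) + (m - g / 2) - u x" for x
  have dfr: "d x < 0" if "x \<in> frontier \<Omega>" for x
  proof -
    have "x \<in> closure \<Omega>" using that by (simp add: frontier_def)
    from \<epsilon>R [OF this] fr [OF that] g show ?thesis by (simp add: d_def)
  qed
  note mass = moore_det_mass_inequality [OF \<Omega> cu cv psh MA \<epsilon> d_def dfr]
  have comp: "compact {x \<in> \<Omega>. s \<le> d x}" if "0 < s" for s
    by (rule mass(2) [of 1 2]) (use that in auto)
  define s where "s = d z0 / 2"
  have "0 \<le> \<epsilon> * (z0 \<bullet> z0)" using \<epsilon> by simp
  moreover have "u z0 - v z0 = m - g" by (simp add: g_def)
  ultimately have "0 < d z0" using g unfolding d_def by linarith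
  then have s: "0 < s" "s < d z0" by (auto simp: s_def)
  define A where "A t = {x \<in> \<Omega>. t \<le> d x}" for t
  have cA: "compact (A t)" if "0 < t" for t using comp [OF that] by (simp add: A_def)
  have A\<Omega>: "A t \<subseteq> \<Omega>" for t by (auto simp: A_def)
  have Amono: "A t \<subseteq> A t'" if "t' \<le> t" for t t' using that by (auto simp: A_def)
  have fin: "emeasure M (A t) < \<infinity>" if "is_MA_measure \<Omega> f M" "0 < t" for M f t
  proof -
    have "\<forall>K. compact K \<and> K \<subseteq> \<Omega> \<longrightarrow> emeasure M K < \<infinity>"
      using that(1) unfolding is_MA_measure_def by (elim conjE)
    then show ?thesis using cA [OF that(2)] A\<Omega> by simp
  qed
  have A_borel: "A t \<in> sets borel" if "0 < t" for t
    by (rule borel_closed [OF compact_imp_closed [OF cA [OF that]]])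
  have A_fmeasurable: "A t \<in> fmeasurable lborel" if "0 < t" for t
    by (rule fmeasurableI) (simp add: A_borel that, rule emeasure_compact_finite [OF cA [OF that]])
  have setsA: "A t \<in> sets M" if "is_MA_measure \<Omega> f M" "0 < t" for M f t
  proof -
    have "sets M = sets (restrict_space borel \<Omega>)"
      using that(1) unfolding is_MA_measure_def by (elim conjE)
    then show ?thesis using A_borel [OF that(2)] A\<Omega> \<Omega>(2) by (simp add: sets_restrict_space_iff)
  qed
  define \<kappa> where "\<kappa> = measure lborel (A s)"
  have \<kappa>: "0 < \<kappa>"
  proof -
    have "open {x \<in> \<Omega>. s < d x}"
      by (rule mass(3) [of 1 2]) (use s in auto)
    moreover have "z0 \<in> {x \<in> \<Omega>. s < d x}" using z0 s by simp
    ultimately obtain r where r: "0 < r" "ball z0 r \<subseteq> {x \<in> \<Omega>. s < d x}"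
      by (rule openE)
    have "0 < measure lborel (ball z0 r)" using r(1) by (simp add: content_ball_pos)
    also have "\<dots> \<le> \<kappa>"
      unfolding \<kappa>_def
    proof (rule measure_mono_fmeasurable)
      show "ball z0 r \<subseteq> A s" using r(2) by (auto simp: A_def)
      show "A s \<in> fmeasurable lborel" by (rule A_fmeasurable [OF s(1)])
    qed simp
    finally show ?thesis .
  qed
  define \<eta> where "\<eta> = (4 * \<epsilon>) ^ CARD('n) * \<kappa>"
  have \<eta>: "0 < \<eta>" using \<epsilon> \<kappa> by (simp add: \<eta>_def)
  have drop: "measure \<nu> (A b) + \<eta> \<le> measure \<nu> (A a)" if ab: "0 < a" "a < b" "b \<le> s" for a b
  proof -
    have "\<kappa> \<le> measure lborel (A b)"
      unfolding \<kappa>_def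
    proof (rule measure_mono_fmeasurable)
      show "A s \<subseteq> A b" by (rule Amono [OF ab(3)])
      show "A s \<in> sets lborel" using A_borel [OF s(1)] by simp
      show "A b \<in> fmeasurable lborel" by (rule A_fmeasurable) (use ab in simp)
    qed
    then have "\<eta> \<le> (4 * \<epsilon>) ^ CARD('n) * measure lborel (A b)"
      unfolding \<eta>_def using \<epsilon> by (intro mult_left_mono) auto
    moreover have "measure \<nu> (A b) + (4 * \<epsilon>) ^ CARD('n) * measure lborel (A b) \<le> measure \<mu> (A a)"
      using mass(1) [OF _ ab(1,2)] by (simp add: A_def)
    moreover have "measure \<mu> (A a) \<le> measure \<nu> (A a)"
    proof -
      have "emeasure \<mu> (A a) \<le> emeasure \<nu> (A a)" using le A_borel [OF ab(1)] A\<Omega> by blast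
      then show ?thesis
        unfolding measure_def using fin [OF MA(2) ab(1)] by (intro enn2real_mono) auto
    qed
    ultimately show ?thesis by linarith
  qed
  define b where "b k = s / 2 + s / (2 * real (Suc k))" for k
  have b0: "0 < b k" "s / 2 < b k" for k using s(1) by (auto simp: b_def add_pos_pos)
  have bs: "b k \<le> s" for k
  proof -
    have "s / (2 * real (Suc k)) \<le> s / 2" using s(1) by (intro divide_left_mono) auto
    then show ?thesis unfolding b_def by linarith
  qed
  have bdec: "b (Suc k) < b k" for k
  proof -
    have "s / (2 * real (Suc (Suc k))) < s / (2 * real (Suc k))" using s(1) by (intro divide_strict_left_mono) auto
    then show ?thesis by (simp add: b_def)
  qed
  have low: "real k * \<eta> \<le> measure \<nu> (A (b k))" for k
  proof (induction k)
    case (Suc k)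
    have "measure \<nu> (A (b k)) + \<eta> \<le> measure \<nu> (A (b (Suc k)))" by (rule drop [OF b0(1) bdec bs])
    then show ?case using Suc by (simp add: distrib_right)
  qed simp
  have s2: "0 < s / 2" using s(1) by simp
  have bd: "measure \<nu> (A (b k)) \<le> measure \<nu> (A (s / 2))" for k
  proof (rule measure_mono_fmeasurable)
    show "A (b k) \<subseteq> A (s / 2)" by (rule Amono) (use b0 in \<open>simp add: less_imp_le\<close>)
    show "A (s / 2) \<in> fmeasurable \<nu>" using setsA [OF MA(2) s2] fin [OF MA(2) s2] by (intro fmeasurableI)
  qed (rule setsA [OF MA(2) b0(1)])
  obtain k :: nat where "measure \<nu> (A (s / 2)) / \<eta> < real k" using reals_Archimedean2 by blast
  then have "measure \<nu> (A (s / 2)) < real k * \<eta>" using \<eta> by (simp add: pos_divide_less_eq)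
  then show False using low [of k] bd [of k] by linarith
qed

text \<open>
  On the reals \<open>LEAST\<close> is meaningful only if a minimum is attained.
\<close>

lemma Least_image_minimum:
  fixes f :: "'a \<Rightarrow> real"
  assumes "z \<in> S" "\<And>x. x \<in> S \<Longrightarrow> f z \<le> f x"
  shows "(LEAST m. m \<in> {f z | z. z \<in> S}) = f z"
  by (rule Least_equality) (use assms in auto)

theorem theorem2p2p1:
  fixes \<Omega> :: "(quat^'n) set" and u v :: "quat^'n \<Rightarrow> real" and \<mu> \<nu> :: "(quat^'n) measure"
  assumes "bounded \<Omega>" and "open \<Omega>"
    and "continuous_on (closure \<Omega>) u" and "continuous_on (closure \<Omega>) v"
    and "quat_psh_on \<Omega> u" and "quat_psh_on \<Omega> v"
    and "is_MA_measure \<Omega> u \<mu>" and "is_MA_measure \<Omega> v \<nu>"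
    and "\<forall>E\<in>sets borel. E \<subseteq> \<Omega> \<longrightarrow> emeasure \<mu> E \<le> emeasure \<nu> E"
  shows "(LEAST m. m \<in> {u z - v z | z. z \<in> closure \<Omega>}) =
         (LEAST m. m \<in> {u z - v z | z. z \<in> frontier \<Omega>})"
proof (cases "\<Omega> = {}")
  case True
  then show ?thesis by simp
next
  case False
  have cc: "compact (closure \<Omega>)" "compact (frontier \<Omega>)"
    using assms(1) by (auto simp: compact_closure compact_frontier_bounded)
  have fne: "frontier \<Omega> \<noteq> {}"
    using False assms(1) not_bounded_UNIV by (auto simp: frontier_eq_empty)
  have fc: "frontier \<Omega> \<subseteq> closure \<Omega>" by (auto simp: frontier_def)
  have cont: "continuous_on (closure \<Omega>) (\<lambda>z. u z - v z)" by (intro continuous_intros assms)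
  obtain z1 where z1: "z1 \<in> frontier \<Omega>" "\<And>z. z \<in> frontier \<Omega> \<Longrightarrow> u z1 - v z1 \<le> u z - v z"
    using continuous_attains_inf [OF cc(2) fne continuous_on_subset [OF cont fc]] by blast
  have "u z1 - v z1 \<le> u z - v z" if "z \<in> closure \<Omega>" for z
  proof (cases "z \<in> \<Omega>")
    case True
    show ?thesis by (rule MA_comparison_interior [OF assms z1(2) True])
  next
    case False
    then have "z \<in> frontier \<Omega>" using that assms(2) by (simp add: frontier_def interior_open)
    then show ?thesis by (rule z1(2))
  qed
  then show ?thesis
    using Least_image_minimum [of z1 "closure \<Omega>" "\<lambda>z. u z - v z"]
      Least_image_minimum [of z1 "frontier \<Omega>" "\<lambda>z. u z - v z"] z1 fc by auto
qed

end
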